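(* Let $(A,m,u)$ be an algebra in an abelian monoidal category $(\mathcal{M},\otimes,\mathbf{1})$. The following assertions are equivalent: (a) $A$ is separable, i.e. the multiplication $m:A\otimes A\to A$ has a section in the category ${}_A\mathcal{M}_A$ of $(A,A)$-bimodules. (b) $\mathbf{H}^1(A,M)=0$ for all $M\in{}_A\mathcal{M}_A$. (c) $\mathbf{H}^n(A,M)=0$ for all $M\in{}_A\mathcal{M}_A$ and all $n>0$.
   Context: $(\mathcal{M},\otimes,\mathbf{1})$ is a monoidal category with $\mathcal{M}$ abelian; associativity and unit constraints are suppressed. An algebra in $\mathcal{M}$ is an object $A$ with morphisms $m:A\otimes A\to A$, $u:\mathbf{1}\to A$ satisfying the associativity and unit axioms; ${}_A\mathcal{M}_A$ is the category of objects of $\mathcal M$ with compatible left and right (associative, unital) $A$-actions. Let $\mathcal{E}$ be the class of epimorphisms of ${}_A\mathcal{M}_A$ that have a section in $\mathcal{M}$. A bimodule $P$ is $\mathcal{E}$-projective if ${}_A\mathcal{M}_A(P,\varepsilon)$ is surjective for each $\varepsilon\in\mathcal{E}$. A morphism is $\mathcal{E}$-admissible if, in its canonical factorization (monomorphism)$\circ$(epimorphism), the epimorphism is in $\mathcal{E}$. An $\mathcal{E}$-projective resolution of $N$ is an exact sequence $\cdots\to P_1\to P_0\to N\to0$ in ${}_A\mathcal{M}_A$ with all maps $\mathcal{E}$-admissible and all $P_n$ $\mathcal{E}$-projective; such resolutions exist for every $N$ and are unique up to homotopy. $\mathbf{Ext}^\bullet_{\mathcal{E}}(N,M)$ is the cohomology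 of ${}_A\mathcal{M}_A(P_\bullet,M)$. The Hochschild cohomology of $A$ with coefficients in $M$ is $\mathbf{H}^\bullet(A,M)=\mathbf{Ext}^\bullet_{\mathcal{E}}(A,M)$.
   Formalization: The tensor product is assumed additive in each variable; without this (e.g. when the tensor product is the direct sum) the bimodule category has no zero morphisms or Hom-groups, so the Ext groups are undefined. *)

theory Defs
  imports "HOL-Algebra.Elementary_Groups"
begin

section \<open>Preadditive and abelian categories\<close>

text \<open>
  Hom-sets are indexed by pairs of objects and need not be disjoint; composition, addition and
  the tensor product are total functions that are only constrained on composable, parallel,
  resp. well-typed arguments.  This lets a category of bimodules share the morphisms
  (and their composition and addition) of the underlying category.
\<close>

record ('o, 'm) precat =
  Ob :: "'o set"
  Hom :: "'o \<Rightarrow> 'o \<Rightarrow> 'm set"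
  Id :: "'o \<Rightarrow> 'm"
  comp :: "'m \<Rightarrow> 'm \<Rightarrow> 'm"  (infixl \<open>\<cdot>\<index>\<close> 70)
  madd :: "'m \<Rightarrow> 'm \<Rightarrow> 'm"
  mzero :: "'o \<Rightarrow> 'o \<Rightarrow> 'm"

definition hom_group :: "('o, 'm, 'x) precat_scheme \<Rightarrow> 'o \<Rightarrow> 'o \<Rightarrow> 'm monoid" where
  "hom_group C X Y = \<lparr>carrier = Hom C X Y, mult = madd C, one = mzero C X Y\<rparr>"

locale cat =
  fixes C :: "('o, 'm, 'x) precat_scheme" (structure)
  assumes Id_in: "X \<in> Ob C \<Longrightarrow> Id C X \<in> Hom C X X"
    and comp_in: "\<lbrakk>X \<in> Ob C; Y \<in> Ob C; Z \<in> Ob C; f \<in> Hom C X Y; g \<in> Hom C Y Z\<rbrakk>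
      \<Longrightarrow> g \<cdot> f \<in> Hom C X Z"
    and comp_Id: "\<lbrakk>X \<in> Ob C; Y \<in> Ob C; f \<in> Hom C X Y\<rbrakk> \<Longrightarrow> f \<cdot> Id C X = f"
    and Id_comp: "\<lbrakk>X \<in> Ob C; Y \<in> Ob C; f \<in> Hom C X Y\<rbrakk> \<Longrightarrow> Id C Y \<cdot> f = f"
    and comp_assoc: "\<lbrakk>W \<in> Ob C; X \<in> Ob C; Y \<in> Ob C; Z \<in> Ob C;
        f \<in> Hom C W X; g \<in> Hom C X Y; h \<in> Hom C Y Z\<rbrakk> \<Longrightarrow> h \<cdot> g \<cdot> f = h \<cdot> (g \<cdot> f)"

locale preadditive_cat = cat +
  assumes hom_comm_group: "\<lbrakk>X \<in> Ob C; Y \<in> Ob C\<rbrakk> \<Longrightarrow> comm_group (hom_group C X Y)"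
    and comp_madd_right: "\<lbrakk>X \<in> Ob C; Y \<in> Ob C; Z \<in> Ob C; f \<in> Hom C X Y; f' \<in> Hom C X Y;
        g \<in> Hom C Y Z\<rbrakk> \<Longrightarrow> g \<cdot> madd C f f' = madd C (g \<cdot> f) (g \<cdot> f')"
    and comp_madd_left: "\<lbrakk>X \<in> Ob C; Y \<in> Ob C; Z \<in> Ob C; f \<in> Hom C X Y; g \<in> Hom C Y Z;
        g' \<in> Hom C Y Z\<rbrakk> \<Longrightarrow> madd C g g' \<cdot> f = madd C (g \<cdot> f) (g' \<cdot> f)"

definition is_mono :: "('o, 'm, 'x) precat_scheme \<Rightarrow> 'o \<Rightarrow> 'o \<Rightarrow> 'm \<Rightarrow> bool" where
  "is_mono C X Y f \<longleftrightarrow> f \<in> Hom C X Y \<and>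
    (\<forall>W\<in>Ob C. \<forall>g\<in>Hom C W X. \<forall>h\<in>Hom C W X. f \<cdot>\<^bsub>C\<^esub> g = f \<cdot>\<^bsub>C\<^esub> h \<longrightarrow> g = h)"

definition is_epi :: "('o, 'm, 'x) precat_scheme \<Rightarrow> 'o \<Rightarrow> 'o \<Rightarrow> 'm \<Rightarrow> bool" where
  "is_epi C X Y f \<longleftrightarrow> f \<in> Hom C X Y \<and>
    (\<forall>Z\<in>Ob C. \<forall>g\<in>Hom C Y Z. \<forall>h\<in>Hom C Y Z. g \<cdot>\<^bsub>C\<^esub> f = h \<cdot>\<^bsub>C\<^esub> f \<longrightarrow> g = h)"

definition has_section :: "('o, 'm, 'x) precat_scheme \<Rightarrow> 'o \<Rightarrow> 'o \<Rightarrow> 'm \<Rightarrow> bool" where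
  "has_section C X Y f \<longleftrightarrow> f \<in> Hom C X Y \<and> (\<exists>s\<in>Hom C Y X. f \<cdot>\<^bsub>C\<^esub> s = Id C Y)"

definition is_inverse :: "('o, 'm, 'x) precat_scheme \<Rightarrow> 'o \<Rightarrow> 'o \<Rightarrow> 'm \<Rightarrow> 'm \<Rightarrow> bool" where
  "is_inverse C X Y f g \<longleftrightarrow> f \<in> Hom C X Y \<and> g \<in> Hom C Y X \<and>
    g \<cdot>\<^bsub>C\<^esub> f = Id C X \<and> f \<cdot>\<^bsub>C\<^esub> g = Id C Y"

definition is_iso :: "('o, 'm, 'x) precat_scheme \<Rightarrow> 'o \<Rightarrow> 'o \<Rightarrow> 'm \<Rightarrow> bool" where
  "is_iso C X Y f \<longleftrightarrow> (\<exists>g. is_inverse C X Y f g)"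

definition inverse_of :: "('o, 'm, 'x) precat_scheme \<Rightarrow> 'o \<Rightarrow> 'o \<Rightarrow> 'm \<Rightarrow> 'm" where
  "inverse_of C X Y f = (THE g. is_inverse C X Y f g)"

definition is_zero_object :: "('o, 'm, 'x) precat_scheme \<Rightarrow> 'o \<Rightarrow> bool" where
  "is_zero_object C Z \<longleftrightarrow> Z \<in> Ob C \<and>
    (\<forall>X\<in>Ob C. (\<exists>!f. f \<in> Hom C X Z) \<and> (\<exists>!f. f \<in> Hom C Z X))"

definition is_biproduct ::
  "('o, 'm, 'x) precat_scheme \<Rightarrow> 'o \<Rightarrow> 'o \<Rightarrow> 'o \<Rightarrow> 'm \<Rightarrow> 'm \<Rightarrow> 'm \<Rightarrow> 'm \<Rightarrow> bool" where
  "is_biproduct C X Y S i j p q \<longleftrightarrow> S \<in> Ob C \<and>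
    i \<in> Hom C X S \<and> j \<in> Hom C Y S \<and> p \<in> Hom C S X \<and> q \<in> Hom C S Y \<and>
    p \<cdot>\<^bsub>C\<^esub> i = Id C X \<and> q \<cdot>\<^bsub>C\<^esub> j = Id C Y \<and>
    q \<cdot>\<^bsub>C\<^esub> i = mzero C X Y \<and> p \<cdot>\<^bsub>C\<^esub> j = mzero C Y X \<and>
    madd C (i \<cdot>\<^bsub>C\<^esub> p) (j \<cdot>\<^bsub>C\<^esub> q) = Id C S"

definition is_kernel :: "('o, 'm, 'x) precat_scheme \<Rightarrow> 'o \<Rightarrow> 'o \<Rightarrow> 'm \<Rightarrow> 'o \<Rightarrow> 'm \<Rightarrow> bool" where
  "is_kernel C X Y f K k \<longleftrightarrow> K \<in> Ob C \<and> k \<in> Hom C K X \<and> f \<cdot>\<^bsub>C\<^esub> k = mzero C K Y \<and>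
    (\<forall>W\<in>Ob C. \<forall>g\<in>Hom C W X. f \<cdot>\<^bsub>C\<^esub> g = mzero C W Y \<longrightarrow>
      (\<exists>!h. h \<in> Hom C W K \<and> k \<cdot>\<^bsub>C\<^esub> h = g))"

definition is_cokernel :: "('o, 'm, 'x) precat_scheme \<Rightarrow> 'o \<Rightarrow> 'o \<Rightarrow> 'm \<Rightarrow> 'o \<Rightarrow> 'm \<Rightarrow> bool" where
  "is_cokernel C X Y f Q q \<longleftrightarrow> Q \<in> Ob C \<and> q \<in> Hom C Y Q \<and> q \<cdot>\<^bsub>C\<^esub> f = mzero C X Q \<and>
    (\<forall>Z\<in>Ob C. \<forall>g\<in>Hom C Y Z. g \<cdot>\<^bsub>C\<^esub> f = mzero C X Z \<longrightarrow>
      (\<exists>!h. h \<in> Hom C Q Z \<and> h \<cdot>\<^bsub>C\<^esub> q = g))"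

locale abelian_cat = preadditive_cat +
  assumes ex_zero_object: "\<exists>Z. is_zero_object C Z"
    and ex_biproduct: "\<lbrakk>X \<in> Ob C; Y \<in> Ob C\<rbrakk> \<Longrightarrow> \<exists>S i j p q. is_biproduct C X Y S i j p q"
    and ex_kernel: "\<lbrakk>X \<in> Ob C; Y \<in> Ob C; f \<in> Hom C X Y\<rbrakk> \<Longrightarrow> \<exists>K k. is_kernel C X Y f K k"
    and ex_cokernel: "\<lbrakk>X \<in> Ob C; Y \<in> Ob C; f \<in> Hom C X Y\<rbrakk> \<Longrightarrow> \<exists>Q q. is_cokernel C X Y f Q q"
    and mono_is_kernel: "\<lbrakk>X \<in> Ob C; Y \<in> Ob C; is_mono C X Y f\<rbrakk>
      \<Longrightarrow> \<exists>Z\<in>Ob C. \<exists>g\<in>Hom C Y Z. is_kernel C Y Z g X f"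
    and epi_is_cokernel: "\<lbrakk>X \<in> Ob C; Y \<in> Ob C; is_epi C X Y f\<rbrakk>
      \<Longrightarrow> \<exists>W\<in>Ob C. \<exists>g\<in>Hom C W X. is_cokernel C W X g Y f"


section \<open>Abelian monoidal categories\<close>

record ('o, 'm) moncat = "('o, 'm) precat" +
  tob :: "'o \<Rightarrow> 'o \<Rightarrow> 'o"  (infixr \<open>\<otimes>\<^sub>o\<index>\<close> 75)
  tmor :: "'m \<Rightarrow> 'm \<Rightarrow> 'm"  (infixr \<open>\<otimes>\<^sub>m\<index>\<close> 75)
  unitob :: 'o
  asc :: "'o \<Rightarrow> 'o \<Rightarrow> 'o \<Rightarrow> 'm"
  lun :: "'o \<Rightarrow> 'm"
  run :: "'o \<Rightarrow> 'm"

locale monoidal_cat = cat M for M :: "('o, 'm, 'x) moncat_scheme" (structure) +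
  assumes unitob_in: "unitob M \<in> Ob M"
    and tob_in: "\<lbrakk>X \<in> Ob M; Y \<in> Ob M\<rbrakk> \<Longrightarrow> X \<otimes>\<^sub>o Y \<in> Ob M"
    and tmor_in: "\<lbrakk>X \<in> Ob M; X' \<in> Ob M; Y \<in> Ob M; Y' \<in> Ob M; f \<in> Hom M X X'; g \<in> Hom M Y Y'\<rbrakk>
      \<Longrightarrow> f \<otimes>\<^sub>m g \<in> Hom M (X \<otimes>\<^sub>o Y) (X' \<otimes>\<^sub>o Y')"
    and tmor_Id: "\<lbrakk>X \<in> Ob M; Y \<in> Ob M\<rbrakk> \<Longrightarrow> Id M X \<otimes>\<^sub>m Id M Y = Id M (X \<otimes>\<^sub>o Y)"
    and tmor_comp: "\<lbrakk>X \<in> Ob M; X' \<in> Ob M; X'' \<in> Ob M; Y \<in> Ob M; Y' \<in> Ob M; Y'' \<in> Ob M;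
        f \<in> Hom M X X'; f' \<in> Hom M X' X''; g \<in> Hom M Y Y'; g' \<in> Hom M Y' Y''\<rbrakk>
      \<Longrightarrow> (f' \<cdot> f) \<otimes>\<^sub>m (g' \<cdot> g) = (f' \<otimes>\<^sub>m g') \<cdot> (f \<otimes>\<^sub>m g)"
    and asc_iso: "\<lbrakk>X \<in> Ob M; Y \<in> Ob M; Z \<in> Ob M\<rbrakk>
      \<Longrightarrow> is_iso M ((X \<otimes>\<^sub>o Y) \<otimes>\<^sub>o Z) (X \<otimes>\<^sub>o (Y \<otimes>\<^sub>o Z)) (asc M X Y Z)"
    and asc_natural: "\<lbrakk>X \<in> Ob M; X' \<in> Ob M; Y \<in> Ob M; Y' \<in> Ob M; Z \<in> Ob M; Z' \<in> Ob M;
        f \<in> Hom M X X'; g \<in> Hom M Y Y'; h \<in> Hom M Z Z'\<rbrakk>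
      \<Longrightarrow> asc M X' Y' Z' \<cdot> ((f \<otimes>\<^sub>m g) \<otimes>\<^sub>m h) = (f \<otimes>\<^sub>m (g \<otimes>\<^sub>m h)) \<cdot> asc M X Y Z"
    and lun_iso: "X \<in> Ob M \<Longrightarrow> is_iso M (unitob M \<otimes>\<^sub>o X) X (lun M X)"
    and lun_natural: "\<lbrakk>X \<in> Ob M; Y \<in> Ob M; f \<in> Hom M X Y\<rbrakk>
      \<Longrightarrow> lun M Y \<cdot> (Id M (unitob M) \<otimes>\<^sub>m f) = f \<cdot> lun M X"
    and run_iso: "X \<in> Ob M \<Longrightarrow> is_iso M (X \<otimes>\<^sub>o unitob M) X (run M X)"
    and run_natural: "\<lbrakk>X \<in> Ob M; Y \<in> Ob M; f \<in> Hom M X Y\<rbrakk>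
      \<Longrightarrow> run M Y \<cdot> (f \<otimes>\<^sub>m Id M (unitob M)) = f \<cdot> run M X"
    and pentagon: "\<lbrakk>W \<in> Ob M; X \<in> Ob M; Y \<in> Ob M; Z \<in> Ob M\<rbrakk>
      \<Longrightarrow> asc M W X (Y \<otimes>\<^sub>o Z) \<cdot> asc M (W \<otimes>\<^sub>o X) Y Z =
        (Id M W \<otimes>\<^sub>m asc M X Y Z) \<cdot> asc M W (X \<otimes>\<^sub>o Y) Z \<cdot> (asc M W X Y \<otimes>\<^sub>m Id M Z)"
    and triangle: "\<lbrakk>X \<in> Ob M; Y \<in> Ob M\<rbrakk>
      \<Longrightarrow> (Id M X \<otimes>\<^sub>m lun M Y) \<cdot> asc M X (unitob M) Y = run M X \<otimes>\<^sub>m Id M Y"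

text \<open>
  Bimodule categories over an abelian category are preadditive only if the functors
  \<open>X \<otimes> -\<close> and \<open>- \<otimes> X\<close> are additive.  For instance, \<open>\<oplus>\<close> is a monoidal structure on any
  abelian category, but its categories of bimodules have no zero morphisms in general.
\<close>

locale abelian_monoidal_cat = abelian_cat M + monoidal_cat M
  for M :: "('o, 'm, 'x) moncat_scheme" (structure) +
  assumes tmor_madd_right: "\<lbrakk>X \<in> Ob M; Y \<in> Ob M; Z \<in> Ob M; f \<in> Hom M Y Z; g \<in> Hom M Y Z\<rbrakk>
      \<Longrightarrow> Id M X \<otimes>\<^sub>m madd M f g = madd M (Id M X \<otimes>\<^sub>m f) (Id M X \<otimes>\<^sub>m g)"
    and tmor_madd_left: "\<lbrakk>X \<in> Ob M; Y \<in> Ob M; Z \<in> Ob M; f \<in> Hom M Y Z; g \<in> Hom M Y Z\<rbrakk>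
      \<Longrightarrow> madd M f g \<otimes>\<^sub>m Id M X = madd M (f \<otimes>\<^sub>m Id M X) (g \<otimes>\<^sub>m Id M X)"


section \<open>Algebras and bimodules\<close>

locale algebra_in = monoidal_cat M for M :: "('o, 'm, 'x) moncat_scheme" (structure) +
  fixes A :: 'o and m :: 'm and u :: 'm
  assumes A_in: "A \<in> Ob M"
    and m_in: "m \<in> Hom M (A \<otimes>\<^sub>o A) A"
    and u_in: "u \<in> Hom M (unitob M) A"
    and m_assoc: "m \<cdot> (m \<otimes>\<^sub>m Id M A) = m \<cdot> (Id M A \<otimes>\<^sub>m m) \<cdot> asc M A A A"
    and unit_left: "m \<cdot> (u \<otimes>\<^sub>m Id M A) = lun M A"
    and unit_right: "m \<cdot> (Id M A \<otimes>\<^sub>m u) = run M A"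

definition is_left_module ::
  "('o, 'm, 'x) moncat_scheme \<Rightarrow> 'o \<Rightarrow> 'm \<Rightarrow> 'm \<Rightarrow> 'o \<Rightarrow> 'm \<Rightarrow> bool" where
  "is_left_module M A m u X l \<longleftrightarrow> X \<in> Ob M \<and> l \<in> Hom M (A \<otimes>\<^sub>o\<^bsub>M\<^esub> X) X \<and>
    l \<cdot>\<^bsub>M\<^esub> (m \<otimes>\<^sub>m\<^bsub>M\<^esub> Id M X) = l \<cdot>\<^bsub>M\<^esub> (Id M A \<otimes>\<^sub>m\<^bsub>M\<^esub> l) \<cdot>\<^bsub>M\<^esub> asc M A A X \<and>
    l \<cdot>\<^bsub>M\<^esub> (u \<otimes>\<^sub>m\<^bsub>M\<^esub> Id M X) = lun M X"

definition is_right_module ::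
  "('o, 'm, 'x) moncat_scheme \<Rightarrow> 'o \<Rightarrow> 'm \<Rightarrow> 'm \<Rightarrow> 'o \<Rightarrow> 'm \<Rightarrow> bool" where
  "is_right_module M A m u X r \<longleftrightarrow> X \<in> Ob M \<and> r \<in> Hom M (X \<otimes>\<^sub>o\<^bsub>M\<^esub> A) X \<and>
    r \<cdot>\<^bsub>M\<^esub> (r \<otimes>\<^sub>m\<^bsub>M\<^esub> Id M A) = r \<cdot>\<^bsub>M\<^esub> (Id M X \<otimes>\<^sub>m\<^bsub>M\<^esub> m) \<cdot>\<^bsub>M\<^esub> asc M X A A \<and>
    r \<cdot>\<^bsub>M\<^esub> (Id M X \<otimes>\<^sub>m\<^bsub>M\<^esub> u) = run M X"

definition is_bimodule ::
  "('o, 'm, 'x) moncat_scheme \<Rightarrow> 'o \<Rightarrow> 'm \<Rightarrow> 'm \<Rightarrow> 'o \<times> 'm \<times> 'm \<Rightarrow> bool" where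
  "is_bimodule M A m u = (\<lambda>(X, l, r).
    is_left_module M A m u X l \<and> is_right_module M A m u X r \<and>
    r \<cdot>\<^bsub>M\<^esub> (l \<otimes>\<^sub>m\<^bsub>M\<^esub> Id M A) = l \<cdot>\<^bsub>M\<^esub> (Id M A \<otimes>\<^sub>m\<^bsub>M\<^esub> r) \<cdot>\<^bsub>M\<^esub> asc M A X A)"

definition bimod_hom ::
  "('o, 'm, 'x) moncat_scheme \<Rightarrow> 'o \<Rightarrow> 'o \<times> 'm \<times> 'm \<Rightarrow> 'o \<times> 'm \<times> 'm \<Rightarrow> 'm set" where
  "bimod_hom M A = (\<lambda>(X, l, r) (X', l', r').
    {f \<in> Hom M X X'. f \<cdot>\<^bsub>M\<^esub> l = l' \<cdot>\<^bsub>M\<^esub> (Id M A \<otimes>\<^sub>m\<^bsub>M\<^esub> f) \<and>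
      f \<cdot>\<^bsub>M\<^esub> r = r' \<cdot>\<^bsub>M\<^esub> (f \<otimes>\<^sub>m\<^bsub>M\<^esub> Id M A)})"

definition Bimod ::
  "('o, 'm, 'x) moncat_scheme \<Rightarrow> 'o \<Rightarrow> 'm \<Rightarrow> 'm \<Rightarrow> ('o \<times> 'm \<times> 'm, 'm) precat" where
  "Bimod M A m u = \<lparr>Ob = {B. is_bimodule M A m u B}, Hom = bimod_hom M A,
    Id = (\<lambda>B. Id M (fst B)), comp = comp M, madd = madd M,
    mzero = (\<lambda>B B'. mzero M (fst B) (fst B'))\<rparr>"

definition regular_bimod :: "'o \<Rightarrow> 'm \<Rightarrow> 'o \<times> 'm \<times> 'm" where
  "regular_bimod A m = (A, m, m)"

definition tensor_square_bimod ::
  "('o, 'm, 'x) moncat_scheme \<Rightarrow> 'o \<Rightarrow> 'm \<Rightarrow> 'o \<times> 'm \<times> 'm" where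
  "tensor_square_bimod M A m =
    (A \<otimes>\<^sub>o\<^bsub>M\<^esub> A,
     (m \<otimes>\<^sub>m\<^bsub>M\<^esub> Id M A) \<cdot>\<^bsub>M\<^esub>
       inverse_of M ((A \<otimes>\<^sub>o\<^bsub>M\<^esub> A) \<otimes>\<^sub>o\<^bsub>M\<^esub> A) (A \<otimes>\<^sub>o\<^bsub>M\<^esub> (A \<otimes>\<^sub>o\<^bsub>M\<^esub> A)) (asc M A A A),
     (Id M A \<otimes>\<^sub>m\<^bsub>M\<^esub> m) \<cdot>\<^bsub>M\<^esub> asc M A A A)"

definition separable :: "('o, 'm, 'x) moncat_scheme \<Rightarrow> 'o \<Rightarrow> 'm \<Rightarrow> 'm \<Rightarrow> bool" where
  "separable M A m u \<longleftrightarrow>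
    has_section (Bimod M A m u) (tensor_square_bimod M A m) (regular_bimod A m) m"


section \<open>Relative homological algebra\<close>

text \<open>
  A class of morphisms is a predicate \<open>E X Y e\<close> on a source, a target and a morphism.
\<close>

definition E_projective ::
  "('o, 'm, 'x) precat_scheme \<Rightarrow> ('o \<Rightarrow> 'o \<Rightarrow> 'm \<Rightarrow> bool) \<Rightarrow> 'o \<Rightarrow> bool" where
  "E_projective C E P \<longleftrightarrow> P \<in> Ob C \<and>
    (\<forall>X\<in>Ob C. \<forall>Y\<in>Ob C. \<forall>e. E X Y e \<longrightarrow> (\<lambda>g. e \<cdot>\<^bsub>C\<^esub> g) ` Hom C P X = Hom C P Y)"

text \<open>
  The last conjunct says that \<open>i\<close> is the least subobject through which \<open>f\<close> factors.  In an
  abelian category it follows from the other ones; it makes the factorization unique up to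
  isomorphism in any category.
\<close>

definition canonical_factorization ::
  "('o, 'm, 'x) precat_scheme \<Rightarrow> 'o \<Rightarrow> 'o \<Rightarrow> 'm \<Rightarrow> 'o \<Rightarrow> 'm \<Rightarrow> 'm \<Rightarrow> bool" where
  "canonical_factorization C X Y f I i e \<longleftrightarrow> I \<in> Ob C \<and>
    is_epi C X I e \<and> is_mono C I Y i \<and> f = i \<cdot>\<^bsub>C\<^esub> e \<and>
    (\<forall>J\<in>Ob C. \<forall>j. \<forall>g\<in>Hom C X J. is_mono C J Y j \<and> f = j \<cdot>\<^bsub>C\<^esub> g \<longrightarrow>
      (\<exists>t\<in>Hom C I J. i = j \<cdot>\<^bsub>C\<^esub> t))"

definition E_admissible ::
  "('o, 'm, 'x) precat_scheme \<Rightarrow> ('o \<Rightarrow> 'o \<Rightarrow> 'm \<Rightarrow> bool) \<Rightarrow> 'o \<Rightarrow> 'o \<Rightarrow> 'm \<Rightarrow> bool" where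
  "E_admissible C E X Y f \<longleftrightarrow> (\<exists>I i e. canonical_factorization C X Y f I i e \<and> E X I e)"

definition exact_at ::
  "('o, 'm, 'x) precat_scheme \<Rightarrow> 'o \<Rightarrow> 'o \<Rightarrow> 'o \<Rightarrow> 'm \<Rightarrow> 'm \<Rightarrow> bool" where
  "exact_at C X Y Z f g \<longleftrightarrow> f \<in> Hom C X Y \<and> g \<in> Hom C Y Z \<and>
    (\<exists>I i e. canonical_factorization C X Y f I i e \<and> is_kernel C Y Z g I i)"

definition E_projective_resolution ::
  "('o, 'm, 'x) precat_scheme \<Rightarrow> ('o \<Rightarrow> 'o \<Rightarrow> 'm \<Rightarrow> bool) \<Rightarrow> 'o \<Rightarrow>
    (nat \<Rightarrow> 'o) \<Rightarrow> (nat \<Rightarrow> 'm) \<Rightarrow> 'm \<Rightarrow> bool" where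
  "E_projective_resolution C E N P d a \<longleftrightarrow>
    (\<forall>n. E_projective C E (P n)) \<and>
    (\<forall>n. E_admissible C E (P (Suc n)) (P n) (d n)) \<and>
    E_admissible C E (P 0) N a \<and>
    (\<forall>n. exact_at C (P (Suc (Suc n))) (P (Suc n)) (P n) (d (Suc n)) (d n)) \<and>
    exact_at C (P (Suc 0)) (P 0) N (d 0) a \<and>
    (\<exists>Z. is_zero_object C Z \<and> exact_at C (P 0) N Z a (mzero C N Z))"

definition cocycles ::
  "('o, 'm, 'x) precat_scheme \<Rightarrow> (nat \<Rightarrow> 'o) \<Rightarrow> (nat \<Rightarrow> 'm) \<Rightarrow> 'o \<Rightarrow> nat \<Rightarrow> 'm set" where
  "cocycles C P d Y n =
    kernel (hom_group C (P n) Y) (hom_group C (P (Suc n)) Y) (\<lambda>f. f \<cdot>\<^bsub>C\<^esub> d n)"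

fun coboundaries ::
  "('o, 'm, 'x) precat_scheme \<Rightarrow> (nat \<Rightarrow> 'o) \<Rightarrow> (nat \<Rightarrow> 'm) \<Rightarrow> 'o \<Rightarrow> nat \<Rightarrow> 'm set" where
  "coboundaries C P d Y 0 = {mzero C (P 0) Y}"
| "coboundaries C P d Y (Suc n) = (\<lambda>f. f \<cdot>\<^bsub>C\<^esub> d n) ` Hom C (P n) Y"

definition hom_cohomology ::
  "('o, 'm, 'x) precat_scheme \<Rightarrow> (nat \<Rightarrow> 'o) \<Rightarrow> (nat \<Rightarrow> 'm) \<Rightarrow> 'o \<Rightarrow> nat \<Rightarrow> 'm set monoid" where
  "hom_cohomology C P d Y n =
    hom_group C (P n) Y\<lparr>carrier := cocycles C P d Y n\<rparr> Mod coboundaries C P d Y n"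

definition Ext ::
  "('o, 'm, 'x) precat_scheme \<Rightarrow> ('o \<Rightarrow> 'o \<Rightarrow> 'm \<Rightarrow> bool) \<Rightarrow> nat \<Rightarrow> 'o \<Rightarrow> 'o \<Rightarrow> 'm set monoid" where
  "Ext C E n N Y =
    (let (P, d, a) = (SOME (P, d, a). E_projective_resolution C E N P d a)
     in hom_cohomology C P d Y n)"


section \<open>Hochschild cohomology\<close>

definition split_epi_class ::
  "('o, 'm, 'x) moncat_scheme \<Rightarrow> 'o \<Rightarrow> 'm \<Rightarrow> 'm \<Rightarrow>
    'o \<times> 'm \<times> 'm \<Rightarrow> 'o \<times> 'm \<times> 'm \<Rightarrow> 'm \<Rightarrow> bool" where
  "split_epi_class M A m u B B' e \<longleftrightarrow>
    is_epi (Bimod M A m u) B B' e \<and> has_section M (fst B) (fst B') e"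

definition Hochschild ::
  "('o, 'm, 'x) moncat_scheme \<Rightarrow> 'o \<Rightarrow> 'm \<Rightarrow> 'm \<Rightarrow> nat \<Rightarrow> 'o \<times> 'm \<times> 'm \<Rightarrow> 'm set monoid" where
  "Hochschild M A m u n B =
    Ext (Bimod M A m u) (split_epi_class M A m u) n (regular_bimod A m) B"

end

theory Submission
  imports Defs
begin

text \<open>
  All three conditions are equivalent to \<open>\<E>\<close>-projectivity of the regular bimodule.  The bimodule
  \<open>A \<otimes> A\<close> is free on the unit object, hence \<open>\<E>\<close>-projective, and the multiplication
  \<open>A \<otimes> A \<rightarrow> A\<close> lies in \<open>\<E>\<close>; so \<open>A\<close> is \<open>\<E>\<close>-projective iff it is a retract of \<open>A \<otimes> A\<close>
  via the multiplication, that is, iff \<open>A\<close> is separable.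

  For an \<open>\<E>\<close>-projective resolution \<open>P\<close> of a projective object, exactness and admissibility yield
  maps \<open>h\<close> with \<open>d\<^sub>n h d\<^sub>n = d\<^sub>n\<close> one degree after the other, and \<open>f = (f h) d\<^sub>n\<close> for every
  cocycle \<open>f\<close>.  Conversely, if \<open>Ext\<^sup>1(N, I) = 0\<close> for the image \<open>I\<close> of \<open>d\<^sub>0\<close>, then the epimorphism
  \<open>P\<^sub>1 \<rightarrow> I\<close>, being a cocycle, factors through \<open>d\<^sub>0\<close>, so that \<open>I\<close> splits off \<open>P\<^sub>0\<close> and \<open>N\<close> is a
  retract of \<open>P\<^sub>0\<close>.

  Bimodules are objects with actions of the two monads \<open>A \<otimes> -\<close> and \<open>- \<otimes> A\<close> that are compatible
  with the associativity constraint, which is a distributive law between them.  In this generality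
  kernels lift from the base category, epimorphisms that split there are cokernels of their kernels,
  and free objects are projective relative to them, which provides the resolutions.
\<close>


section \<open>Arrows\<close>

text \<open>
  The hom-sets of a category may overlap.  Bundling a morphism with its source and target turns
  well-typedness into equations that the simplifier can discharge.
\<close>

datatype ('o, 'm) arrow = Arrow (src: 'o) (tgt: 'o) (mor: 'm)

lemma Arrow_mor [simp]: "\<lbrakk>src f = X; tgt f = Y\<rbrakk> \<Longrightarrow> Arrow X Y (mor f) = f"
  by auto

definition arr :: "('o, 'm, 'x) precat_scheme \<Rightarrow> ('o, 'm) arrow \<Rightarrow> bool" where
  "arr C f \<longleftrightarrow> src f \<in> Ob C \<and> tgt f \<in> Ob C \<and> mor f \<in> Hom C (src f) (tgt f)"

abbreviation in_hom :: "('o, 'm, 'x) precat_scheme \<Rightarrow> ('o, 'm) arrow \<Rightarrow> 'o \<Rightarrow> 'o \<Rightarrow> bool"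
    (\<open>\<guillemotleft>_ : _ \<rightarrow> _\<guillemotright>\<index>\<close> [51, 51, 51]) where
  "\<guillemotleft>f : X \<rightarrow> Y\<guillemotright>\<^bsub>C\<^esub> \<equiv> arr C f \<and> src f = X \<and> tgt f = Y"

definition comp_arrow :: "('o, 'm, 'x) precat_scheme \<Rightarrow> ('o, 'm) arrow \<Rightarrow> ('o, 'm) arrow \<Rightarrow>
    ('o, 'm) arrow"
    (infixr \<open>\<star>\<index>\<close> 70) where
  "g \<star>\<^bsub>C\<^esub> f = Arrow (src f) (tgt g) (mor g \<cdot>\<^bsub>C\<^esub> mor f)"

definition id_arrow :: "('o, 'm, 'x) precat_scheme \<Rightarrow> 'o \<Rightarrow> ('o, 'm) arrow" (\<open>idt\<index>\<close>) where
  "idt\<^bsub>C\<^esub> X = Arrow X X (Id C X)"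

definition iso_arrow :: "('o, 'm, 'x) precat_scheme \<Rightarrow> ('o, 'm) arrow \<Rightarrow> bool" where
  "iso_arrow C f \<longleftrightarrow> arr C f \<and> is_iso C (src f) (tgt f) (mor f)"

definition inv_arrow :: "('o, 'm, 'x) precat_scheme \<Rightarrow> ('o, 'm) arrow \<Rightarrow> ('o, 'm) arrow"
    (\<open>_\<inverse>\<index>\<close> [1000] 999) where
  "f\<inverse>\<^bsub>C\<^esub> = Arrow (tgt f) (src f) (inverse_of C (src f) (tgt f) (mor f))"

definition monic :: "('o, 'm, 'x) precat_scheme \<Rightarrow> ('o, 'm) arrow \<Rightarrow> bool" where
  "monic C f \<longleftrightarrow> arr C f \<and> is_mono C (src f) (tgt f) (mor f)"

definition epic :: "('o, 'm, 'x) precat_scheme \<Rightarrow> ('o, 'm) arrow \<Rightarrow> bool" where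
  "epic C f \<longleftrightarrow> arr C f \<and> is_epi C (src f) (tgt f) (mor f)"

context cat
begin

lemma src_comp [simp]: "src (g \<star> f) = src f"
  and tgt_comp [simp]: "tgt (g \<star> f) = tgt g"
  and mor_comp [simp]: "mor (g \<star> f) = mor g \<cdot> mor f"
  by (simp_all add: comp_arrow_def)

lemma src_idt [simp]: "src (idt X) = X"
  and tgt_idt [simp]: "tgt (idt X) = X"
  and mor_idt [simp]: "mor (idt X) = Id C X"
  by (simp_all add: id_arrow_def)

lemma src_inv [simp]: "src (f\<inverse>) = tgt f"
  and tgt_inv [simp]: "tgt (f\<inverse>) = src f"
  by (simp_all add: inv_arrow_def)

lemma arr_src [simp]: "arr C f \<Longrightarrow> src f \<in> Ob C"
  and arr_tgt [simp]: "arr C f \<Longrightarrow> tgt f \<in> Ob C"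
  unfolding arr_def by simp_all

lemma mor_in [simp]: "\<guillemotleft>f : X \<rightarrow> Y\<guillemotright> \<Longrightarrow> mor f \<in> Hom C X Y"
  unfolding arr_def by auto

lemma arr_Arrow: "arr C (Arrow X Y f) \<longleftrightarrow> X \<in> Ob C \<and> Y \<in> Ob C \<and> f \<in> Hom C X Y"
  unfolding arr_def by simp

lemma arrow_eqI: "\<lbrakk>src f = src g; tgt f = tgt g; mor f = mor g\<rbrakk> \<Longrightarrow> f = g"
  by (rule arrow.expand) simp

lemma arr_comp [simp]: "\<lbrakk>arr C f; arr C g; tgt f = src g\<rbrakk> \<Longrightarrow> arr C (g \<star> f)"
  using comp_in[of "src f" "tgt f" "tgt g" "mor f" "mor g"] by (simp add: comp_arrow_def arr_Arrow)

lemma arr_idt [simp]: "X \<in> Ob C \<Longrightarrow> arr C (idt X)"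
  by (simp add: id_arrow_def arr_Arrow Id_in)

lemma comp_idt [simp]: "\<lbrakk>arr C f; src f = X\<rbrakk> \<Longrightarrow> f \<star> idt X = f"
  using comp_Id[of "src f" "tgt f" "mor f"] by (intro arrow_eqI) auto

lemma idt_comp [simp]: "\<lbrakk>arr C f; tgt f = X\<rbrakk> \<Longrightarrow> idt X \<star> f = f"
  using Id_comp[of "src f" "tgt f" "mor f"] by (intro arrow_eqI) auto

lemma comp_arrow_assoc [simp]:
  "\<lbrakk>arr C f; arr C g; arr C h; tgt f = src g; tgt g = src h\<rbrakk> \<Longrightarrow> (h \<star> g) \<star> f = h \<star> g \<star> f"
  using comp_assoc[of "src f" "src g" "src h" "tgt h" "mor f" "mor g" "mor h"]
  by (simp add: arr_Arrow comp_arrow_def)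

lemma comp_prefix:
  "\<lbrakk>f \<star> g = h; arr C f; arr C g; arr C k; tgt g = src f; tgt k = src g\<rbrakk> \<Longrightarrow> f \<star> g \<star> k = h \<star> k"
  by (metis comp_arrow_assoc)

lemma is_inverse_unique:
  assumes "is_inverse C X Y f g" "is_inverse C X Y f h" and X: "X \<in> Ob C" and Y: "Y \<in> Ob C"
  shows "g = h"
proof -
  have "g = g \<cdot> (f \<cdot> h)"
    using assms comp_Id[of Y X g] by (simp add: is_inverse_def)
  also have "\<dots> = g \<cdot> f \<cdot> h"
    using assms comp_assoc[of Y X Y X h f g] by (simp add: is_inverse_def)
  also have "\<dots> = h"
    using assms Id_comp[of Y X h] by (simp add: is_inverse_def)
  finally show ?thesis .
qed

lemma inverse_of_is_inverse:
  assumes "is_iso C X Y f" "X \<in> Ob C" "Y \<in> Ob C"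
  shows "is_inverse C X Y f (inverse_of C X Y f)"
proof -
  obtain g where "is_inverse C X Y f g" using assms(1) by (auto simp: is_iso_def)
  then have "\<exists>!g. is_inverse C X Y f g"
    using is_inverse_unique assms(2,3) by blast
  then show ?thesis unfolding inverse_of_def by (rule theI')
qed

lemma iso_arrow_arr [simp]: "iso_arrow C f \<Longrightarrow> arr C f"
  by (simp add: iso_arrow_def)

lemma inverse_arrow:
  assumes "iso_arrow C f"
  shows arr_inv [simp]: "arr C (f\<inverse>)"
    and comp_inv_right [simp]: "f \<star> f\<inverse> = idt (tgt f)"
    and comp_inv_left [simp]: "f\<inverse> \<star> f = idt (src f)"
  using assms inverse_of_is_inverse[of "src f" "tgt f" "mor f"]
  by (auto simp: iso_arrow_def arr_Arrow is_inverse_def inv_arrow_def comp_arrow_def id_arrow_def)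

lemma comp_inv_cancel [simp]:
  assumes "iso_arrow C f" "arr C g"
  shows "tgt g = tgt f \<Longrightarrow> f \<star> f\<inverse> \<star> g = g" and "tgt g = src f \<Longrightarrow> f\<inverse> \<star> f \<star> g = g"
  using assms by (simp_all add: comp_prefix[OF comp_inv_right] comp_prefix[OF comp_inv_left])

lemma iso_arrowI:
  assumes "\<guillemotleft>f : X \<rightarrow> Y\<guillemotright>" "\<guillemotleft>g : Y \<rightarrow> X\<guillemotright>" "f \<star> g = idt Y" "g \<star> f = idt X"
  shows "iso_arrow C f"
proof -
  have "is_inverse C X Y (mor f) (mor g)"
    using assms by (auto simp: is_inverse_def arr_Arrow comp_arrow_def id_arrow_def)
  then show ?thesis using assms(1) by (auto simp: iso_arrow_def is_iso_def)
qed

lemma iso_idt [simp]: "X \<in> Ob C \<Longrightarrow> iso_arrow C (idt X)"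
  by (rule iso_arrowI[of _ X X "idt X"]) simp_all

lemma comp_iso_eq_iff:
  assumes "iso_arrow C h" "arr C f" "arr C g" "src f = tgt h" "src g = src h"
  shows "f \<star> h = g \<longleftrightarrow> f = g \<star> h\<inverse>"
  using assms by auto

lemma iso_square_inverse:
  assumes "iso_arrow C h" "iso_arrow C h'" and f: "\<guillemotleft>f : src h \<rightarrow> src h'\<guillemotright>"
    and g: "\<guillemotleft>g : tgt h \<rightarrow> tgt h'\<guillemotright>"
    and eq: "h' \<star> f = g \<star> h"
  shows "h'\<inverse> \<star> g = f \<star> h\<inverse>"
proof -
  have "h'\<inverse> \<star> g = h'\<inverse> \<star> (g \<star> h) \<star> h\<inverse>"
    using assms(1,2) g by simp
  also have "\<dots> = f \<star> h\<inverse>"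
    using assms(1,2) f by (simp flip: eq)
  finally show ?thesis .
qed

lemma monic_arr [simp]: "monic C f \<Longrightarrow> arr C f"
  by (simp add: monic_def)

lemma epic_arr [simp]: "epic C f \<Longrightarrow> arr C f"
  by (simp add: epic_def)

lemma monic_Arrow: "\<lbrakk>X \<in> Ob C; Y \<in> Ob C\<rbrakk> \<Longrightarrow> monic C (Arrow X Y f) \<longleftrightarrow> is_mono C X Y f"
  by (auto simp: monic_def is_mono_def arr_Arrow)

lemma monic_cancel:
  assumes "monic C i" "i \<star> f = i \<star> g" "\<guillemotleft>f : X \<rightarrow> src i\<guillemotright>" "\<guillemotleft>g : X \<rightarrow> src i\<guillemotright>"
  shows "f = g"
proof (rule arrow_eqI)
  have "mor i \<cdot> mor f = mor i \<cdot> mor g" using assms(2) by (metis mor_comp)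
  then show "mor f = mor g"
    using assms(1) mor_in[OF assms(3)] mor_in[OF assms(4)] arr_src[of f] assms(3)
    unfolding monic_def is_mono_def by blast
qed (use assms in simp_all)

lemma monicI:
  assumes "arr C i"
    and cancel: "\<And>X f g. \<lbrakk>\<guillemotleft>f : X \<rightarrow> src i\<guillemotright>; \<guillemotleft>g : X \<rightarrow> src i\<guillemotright>; i \<star> f = i \<star> g\<rbrakk> \<Longrightarrow> f = g"
  shows "monic C i"
proof -
  have "f = g" if "W \<in> Ob C" "f \<in> Hom C W (src i)" "g \<in> Hom C W (src i)" "mor i \<cdot> f = mor i \<cdot> g"
    for W f g
    using cancel[of "Arrow W (src i) f" W "Arrow W (src i) g"] that assms(1)
    by (simp add: arr_Arrow comp_arrow_def)
  moreover have "mor i \<in> Hom C (src i) (tgt i)" using assms(1) by simp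
  ultimately show ?thesis unfolding monic_def is_mono_def using assms(1) by blast
qed

lemma epic_cancel:
  assumes "epic C e" "f \<star> e = g \<star> e" "\<guillemotleft>f : tgt e \<rightarrow> X\<guillemotright>" "\<guillemotleft>g : tgt e \<rightarrow> X\<guillemotright>"
  shows "f = g"
proof (rule arrow_eqI)
  have "mor f \<cdot> mor e = mor g \<cdot> mor e" using assms(2) by (metis mor_comp)
  then show "mor f = mor g"
    using assms(1) mor_in[OF assms(3)] mor_in[OF assms(4)] arr_tgt[of f] assms(3)
    unfolding epic_def is_epi_def by blast
qed (use assms in simp_all)

lemma epicI:
  assumes "arr C e"
    and cancel: "\<And>X f g. \<lbrakk>\<guillemotleft>f : tgt e \<rightarrow> X\<guillemotright>; \<guillemotleft>g : tgt e \<rightarrow> X\<guillemotright>; f \<star> e = g \<star> e\<rbrakk> \<Longrightarrow> f = g"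
  shows "epic C e"
proof -
  have "f = g" if "Z \<in> Ob C" "f \<in> Hom C (tgt e) Z" "g \<in> Hom C (tgt e) Z" "f \<cdot> mor e = g \<cdot> mor e"
    for Z f g
    using cancel[of "Arrow (tgt e) Z f" Z "Arrow (tgt e) Z g"] that assms(1)
    by (simp add: arr_Arrow comp_arrow_def)
  moreover have "mor e \<in> Hom C (src e) (tgt e)" using assms(1) by simp
  ultimately show ?thesis unfolding epic_def is_epi_def using assms(1) by blast
qed

lemma monic_iso: "iso_arrow C f \<Longrightarrow> monic C f"
  by (rule monicI) (metis comp_inv_cancel(2) iso_arrow_arr)+

lemma epic_split:
  assumes e: "arr C e" and s: "\<guillemotleft>s : tgt e \<rightarrow> src e\<guillemotright>" "e \<star> s = idt (tgt e)"
  shows "epic C e"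
proof (rule epicI[OF e])
  fix X f g
  assume f: "\<guillemotleft>f : tgt e \<rightarrow> X\<guillemotright>" and g: "\<guillemotleft>g : tgt e \<rightarrow> X\<guillemotright>" and eq: "f \<star> e = g \<star> e"
  have "(f \<star> e) \<star> s = (g \<star> e) \<star> s" by (simp only: eq)
  then show "f = g" using e f g s by simp
qed

lemma epic_iso: "iso_arrow C e \<Longrightarrow> epic C e"
  by (rule epic_split[of _ "e\<inverse>"]) simp_all

lemma has_section_iff:
  assumes f: "\<guillemotleft>f : X \<rightarrow> Y\<guillemotright>"
  shows "has_section C X Y (mor f) \<longleftrightarrow> (\<exists>s. \<guillemotleft>s : Y \<rightarrow> X\<guillemotright> \<and> f \<star> s = idt Y)"
proof
  assume "has_section C X Y (mor f)"
  then obtain s where "s \<in> Hom C Y X" "mor f \<cdot> s = Id C Y"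
    by (auto simp: has_section_def)
  then show "\<exists>s. \<guillemotleft>s : Y \<rightarrow> X\<guillemotright> \<and> f \<star> s = idt Y"
    using f by (intro exI[of _ "Arrow Y X s"]) (auto simp: arr_Arrow comp_arrow_def id_arrow_def)
next
  assume "\<exists>s. \<guillemotleft>s : Y \<rightarrow> X\<guillemotright> \<and> f \<star> s = idt Y"
  then obtain s where s: "\<guillemotleft>s : Y \<rightarrow> X\<guillemotright>" "f \<star> s = idt Y" by blast
  then have "mor f \<cdot> mor s = Id C Y" by (metis mor_comp mor_idt)
  then show "has_section C X Y (mor f)"
    using mor_in[OF f] mor_in[OF s(1)] by (auto simp: has_section_def)
qed

end


section \<open>Preadditive categories\<close>

definition zero_arrow :: "('o, 'm, 'x) precat_scheme \<Rightarrow> 'o \<Rightarrow> 'o \<Rightarrow> ('o, 'm) arrow" (\<open>\<zero>\<index>\<close>) where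
  "\<zero>\<^bsub>C\<^esub> X Y = Arrow X Y (mzero C X Y)"

definition minus_arrow :: "('o, 'm, 'x) precat_scheme \<Rightarrow> ('o, 'm) arrow \<Rightarrow> ('o, 'm) arrow \<Rightarrow>
    ('o, 'm) arrow"
    (infixl \<open>\<ominus>\<index>\<close> 65) where
  "f \<ominus>\<^bsub>C\<^esub> g = Arrow (src f) (tgt f) (madd C (mor f) (inv\<^bsub>hom_group C (src f) (tgt f)\<^esub> mor g))"

definition kernel_of :: "('o, 'm, 'x) precat_scheme \<Rightarrow> ('o, 'm) arrow \<Rightarrow> ('o, 'm) arrow \<Rightarrow> bool" where
  "kernel_of C f k \<longleftrightarrow>
    arr C f \<and> tgt k = src f \<and> is_kernel C (src f) (tgt f) (mor f) (src k) (mor k)"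

lemma hom_group_sel [simp]:
  "carrier (hom_group C X Y) = Hom C X Y" "mult (hom_group C X Y) = madd C"
  "one (hom_group C X Y) = mzero C X Y"
  by (simp_all add: hom_group_def)

lemma (in comm_group) subgroup_comm_group:
  assumes "subgroup H G"
  shows "comm_group (G\<lparr>carrier := H\<rparr>)"
  using group.group_comm_groupI[OF subgroup_imp_group[OF assms]] m_comm
    subgroup.mem_carrier[OF assms]
  by simp

lemma subgroup_equalizer:
  assumes "group_hom G H f" "group_hom G H g"
  shows "subgroup {x \<in> carrier G. f x = g x} G"
proof -
  interpret f: group_hom G H f by fact
  interpret g: group_hom G H g by fact
  show ?thesis by (rule f.G.subgroupI) (auto intro: f.G.one_closed)
qed

context preadditive_cat
begin

lemma group_hom_group: "\<lbrakk>X \<in> Ob C; Y \<in> Ob C\<rbrakk> \<Longrightarrow> group (hom_group C X Y)"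
  by (rule comm_group.axioms(2)[OF hom_comm_group])

lemma group_hom_precomp:
  assumes "arr C d" "Y \<in> Ob C"
  shows "group_hom (hom_group C (tgt d) Y) (hom_group C (src d) Y) (\<lambda>f. f \<cdot> mor d)"
  using assms comp_in[of "src d" "tgt d" Y "mor d"] comp_madd_left[of "src d" "tgt d" Y "mor d"]
  by (auto simp: group_hom_def group_hom_axioms_def hom_def arr_Arrow group_hom_group)

lemma group_hom_postcomp:
  assumes "arr C d" "X \<in> Ob C"
  shows "group_hom (hom_group C X (src d)) (hom_group C X (tgt d)) (\<lambda>f. mor d \<cdot> f)"
  using assms comp_in[of X "src d" "tgt d" _ "mor d"]
    comp_madd_right[of X "src d" "tgt d" _ _ "mor d"]
  by (auto simp: group_hom_def group_hom_axioms_def hom_def arr_Arrow group_hom_group)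

lemma src_zero [simp]: "src (\<zero> X Y) = X"
  and tgt_zero [simp]: "tgt (\<zero> X Y) = Y"
  and mor_zero [simp]: "mor (\<zero> X Y) = mzero C X Y"
  by (simp_all add: zero_arrow_def)

lemma src_minus [simp]: "src (f \<ominus> g) = src f"
  and tgt_minus [simp]: "tgt (f \<ominus> g) = tgt f"
  by (simp_all add: minus_arrow_def)

lemma mzero_in [simp]: "\<lbrakk>X \<in> Ob C; Y \<in> Ob C\<rbrakk> \<Longrightarrow> mzero C X Y \<in> Hom C X Y"
  using monoid.one_closed[OF group.is_monoid[OF group_hom_group[of X Y]]] by simp

lemma arr_zero [simp]: "\<lbrakk>X \<in> Ob C; Y \<in> Ob C\<rbrakk> \<Longrightarrow> arr C (\<zero> X Y)"
  by (simp add: zero_arrow_def arr_Arrow)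

lemma zero_comp [simp]: "\<lbrakk>arr C f; tgt f = Y; Z \<in> Ob C\<rbrakk> \<Longrightarrow> \<zero> Y Z \<star> f = \<zero> (src f) Z"
  using group_hom.hom_one[OF group_hom_precomp[of f Z]]
  by (auto simp: comp_arrow_def zero_arrow_def)

lemma comp_zero [simp]: "\<lbrakk>arr C f; src f = Y; X \<in> Ob C\<rbrakk> \<Longrightarrow> f \<star> \<zero> X Y = \<zero> X (tgt f)"
  using group_hom.hom_one[OF group_hom_postcomp[of f X]]
  by (auto simp: comp_arrow_def zero_arrow_def)

lemma arr_minus [simp]:
  assumes "arr C f" "arr C g" "src f = src g" "tgt f = tgt g"
  shows "arr C (f \<ominus> g)"
proof -
  interpret group "hom_group C (src f) (tgt f)" using assms(1) by (intro group_hom_group) simp_all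
  show ?thesis
    using m_closed[of "mor f" "inv\<^bsub>hom_group C (src f) (tgt f)\<^esub> mor g"] inv_closed[of "mor g"] assms
    by (simp add: arr_Arrow minus_arrow_def)
qed

lemma minus_comp:
  assumes "arr C f" "arr C g" "src f = src g" "tgt f = tgt g" "arr C d" "tgt d = src f"
  shows "(f \<ominus> g) \<star> d = f \<star> d \<ominus> g \<star> d"
proof -
  interpret group_hom "hom_group C (tgt d) (tgt f)" "hom_group C (src d) (tgt f)" "\<lambda>f. f \<cdot> mor d"
    using assms by (intro group_hom_precomp) simp_all
  show ?thesis
    using hom_mult[of "mor f" "inv\<^bsub>hom_group C (src f) (tgt f)\<^esub> mor g"] hom_inv[of "mor g"]
      G.inv_closed[of "mor g"] assms
    by (simp add: arr_Arrow comp_arrow_def minus_arrow_def)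
qed

lemma comp_minus:
  assumes "arr C f" "arr C g" "src f = src g" "tgt f = tgt g" "arr C d" "src d = tgt f"
  shows "d \<star> (f \<ominus> g) = d \<star> f \<ominus> d \<star> g"
proof -
  interpret group_hom "hom_group C (src f) (src d)" "hom_group C (src f) (tgt d)" "\<lambda>f. mor d \<cdot> f"
    using assms by (intro group_hom_postcomp) simp_all
  show ?thesis
    using hom_mult[of "mor f" "inv\<^bsub>hom_group C (src f) (tgt f)\<^esub> mor g"] hom_inv[of "mor g"]
      G.inv_closed[of "mor g"] assms
    by (simp add: arr_Arrow comp_arrow_def minus_arrow_def)
qed

lemma minus_zero [simp]: "\<guillemotleft>f : X \<rightarrow> Y\<guillemotright> \<Longrightarrow> f \<ominus> \<zero> X Y = f"
  using group.is_monoid[OF group_hom_group, THEN monoid.r_one, of X Y "mor f"]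
    monoid.inv_one[OF group.is_monoid[OF group_hom_group[of X Y]]]
  by (intro arrow_eqI) (auto simp: arr_Arrow minus_arrow_def)

lemma minus_eq_zero_iff:
  assumes f: "\<guillemotleft>f : X \<rightarrow> Y\<guillemotright>" and g: "\<guillemotleft>g : X \<rightarrow> Y\<guillemotright>"
  shows "f \<ominus> g = \<zero> X Y \<longleftrightarrow> f = g"
proof -
  interpret group "hom_group C X Y" using f by (intro group_hom_group) auto
  have "f = g \<longleftrightarrow> mor f = mor g" using f g by (auto intro: arrow_eqI)
  then show ?thesis
    using f g inv_solve_right[of "mzero C X Y" "mor f" "mor g"] l_one[of "mor g"] one_closed
    by (auto simp: minus_arrow_def zero_arrow_def)
qed

lemma minus_self [simp]: "arr C f \<Longrightarrow> f \<ominus> f = \<zero> (src f) (tgt f)"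
  by (simp add: minus_eq_zero_iff)

lemma kernel_ofD:
  assumes "kernel_of C f k"
  shows "arr C f" "arr C k" "tgt k = src f" "f \<star> k = \<zero> (src k) (tgt f)"
  using assms unfolding kernel_of_def is_kernel_def arr_def comp_arrow_def zero_arrow_def
  by simp_all

lemma kernel_factor:
  assumes "kernel_of C f k" "\<guillemotleft>g : X \<rightarrow> src f\<guillemotright>" "f \<star> g = \<zero> X (tgt f)"
  obtains h where "\<guillemotleft>h : X \<rightarrow> src k\<guillemotright>" "k \<star> h = g"
proof -
  have "mor f \<cdot> mor g = mzero C X (tgt f)" using assms(3) by (metis mor_comp mor_zero)
  moreover have "X \<in> Ob C" "mor g \<in> Hom C X (src f)" using assms(2) by auto
  ultimately obtain h where "h \<in> Hom C X (src k)" "mor k \<cdot> h = mor g"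
    using assms(1) unfolding kernel_of_def is_kernel_def by blast
  moreover have "X \<in> Ob C" "arr C k" using assms kernel_ofD(2) by auto
  ultimately show thesis
    using that[of "Arrow X (src k) h"] assms kernel_ofD(3)[OF assms(1)]
    by (simp add: arr_Arrow comp_arrow_def arrow.expand)
qed

lemma kernel_monic:
  assumes "kernel_of C f k"
  shows "monic C k"
proof (rule monicI)
  note [simp] = kernel_ofD[OF assms]
  fix X g h assume g: "\<guillemotleft>g : X \<rightarrow> src k\<guillemotright>" and h: "\<guillemotleft>h : X \<rightarrow> src k\<guillemotright>" and eq: "k \<star> g = k \<star> h"
  have "f \<star> k \<star> g = \<zero> X (tgt f)"
    using g by (simp add: comp_prefix[OF kernel_ofD(4)[OF assms]])
  then have "mor f \<cdot> mor (k \<star> g) = mzero C X (tgt f)" by (metis mor_comp mor_zero)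
  moreover have "mor (k \<star> g) \<in> Hom C X (src f)" "X \<in> Ob C"
    using g mor_in[of "k \<star> g" X "src f"] by auto
  ultimately have "\<exists>!x. x \<in> Hom C X (src k) \<and> mor k \<cdot> x = mor (k \<star> g)"
    using assms unfolding kernel_of_def is_kernel_def by blast
  moreover have "mor k \<cdot> mor g = mor (k \<star> g)" "mor k \<cdot> mor h = mor (k \<star> g)"
    using eq by (metis mor_comp)+
  ultimately have "mor g = mor h" using mor_in[OF g] mor_in[OF h] by blast
  then show "g = h" using g h by (intro arrow_eqI) simp_all
qed (rule kernel_ofD(2)[OF assms])

lemma kernel_ofI:
  assumes f: "arr C f" and k: "monic C k" "tgt k = src f" and fk: "f \<star> k = \<zero> (src k) (tgt f)"
    and factor: "\<And>X g. \<lbrakk>\<guillemotleft>g : X \<rightarrow> src f\<guillemotright>; f \<star> g = \<zero> X (tgt f)\<rbrakk> \<Longrightarrow> \<exists>h. \<guillemotleft>h : X \<rightarrow> src k\<guillemotright> \<and> k \<star> h = g"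
  shows "kernel_of C f k"
proof -
  have unique_factor: "\<exists>!h. h \<in> Hom C W (src k) \<and> mor k \<cdot> h = g"
    if "W \<in> Ob C" "g \<in> Hom C W (src f)" "mor f \<cdot> g = mzero C W (tgt f)" for W g
  proof -
    have "\<guillemotleft>Arrow W (src f) g : W \<rightarrow> src f\<guillemotright>" "f \<star> Arrow W (src f) g = \<zero> W (tgt f)"
      using that f by (simp_all add: arr_Arrow comp_arrow_def zero_arrow_def)
    then obtain h where h: "\<guillemotleft>h : W \<rightarrow> src k\<guillemotright>" "k \<star> h = Arrow W (src f) g"
      using factor by blast
    have "mor k \<cdot> mor h = g" using h(2) by (metis mor_comp arrow.sel(3))
    moreover have "mor h \<in> Hom C W (src k)" using mor_in[OF h(1)] .
    ultimately show ?thesis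
      using k(1) that(1) unfolding monic_def is_mono_def by metis
  qed
  have "mor f \<cdot> mor k = mzero C (src k) (tgt f)" using fk by (metis mor_comp mor_zero)
  then show ?thesis
    unfolding kernel_of_def is_kernel_def using f k
    by (intro conjI ballI impI unique_factor) simp_all
qed

lemma kernel_of_monic_comp_iff:
  assumes "monic C j" "arr C f" "tgt f = src j"
  shows "kernel_of C (j \<star> f) k \<longleftrightarrow> kernel_of C f k"
proof -
  have zero_iff: "j \<star> f \<star> g = \<zero> X (tgt j) \<longleftrightarrow> f \<star> g = \<zero> X (tgt f)" if "\<guillemotleft>g : X \<rightarrow> src f\<guillemotright>" for g X
  proof
    assume "j \<star> f \<star> g = \<zero> X (tgt j)"
    then have "j \<star> f \<star> g = j \<star> \<zero> X (tgt f)" using assms that by auto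
    then show "f \<star> g = \<zero> X (tgt f)"
      by (rule monic_cancel[OF assms(1)]) (use assms that in auto)
  qed (use assms that in auto)
  show ?thesis
  proof
    assume K: "kernel_of C (j \<star> f) k"
    show "kernel_of C f k"
    proof (rule kernel_ofI[OF assms(2) kernel_monic[OF K]])
      show "f \<star> k = \<zero> (src k) (tgt f)"
        using kernel_ofD[OF K] assms zero_iff[of k "src k"] by simp
      show "\<exists>h. \<guillemotleft>h : X \<rightarrow> src k\<guillemotright> \<and> k \<star> h = g" if "\<guillemotleft>g : X \<rightarrow> src f\<guillemotright>" "f \<star> g = \<zero> X (tgt f)" for X g
        using kernel_factor[OF K, of g X] that assms zero_iff[OF that(1)] by auto
    qed (use kernel_ofD[OF K] in simp)
  next
    assume K: "kernel_of C f k"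
    show "kernel_of C (j \<star> f) k"
    proof (rule kernel_ofI[OF _ kernel_monic[OF K]])
      show "(j \<star> f) \<star> k = \<zero> (src k) (tgt (j \<star> f))"
        using kernel_ofD[OF K] assms by simp
      show "\<exists>h. \<guillemotleft>h : X \<rightarrow> src k\<guillemotright> \<and> k \<star> h = g"
        if "\<guillemotleft>g : X \<rightarrow> src (j \<star> f)\<guillemotright>" "(j \<star> f) \<star> g = \<zero> X (tgt (j \<star> f))" for X g
        using kernel_factor[OF K, of g X] that assms zero_iff[of g X] by auto
    qed (use assms kernel_ofD[OF K] in simp_all)
  qed
qed

lemma comp_split_epi_kernel:
  assumes k: "kernel_of C e k" and s: "\<guillemotleft>s : tgt e \<rightarrow> src e\<guillemotright>" and es: "e \<star> s = idt (tgt e)"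
    and g: "arr C g" "src g = src e" and gk: "g \<star> k = \<zero> (src k) (tgt g)"
  shows "g \<star> s \<star> e = g"
proof -
  note [simp] = kernel_ofD(1-3)[OF k] s g
  let ?w = "idt (src e) \<ominus> s \<star> e"
  have "e \<star> ?w = \<zero> (src e) (tgt e)"
    by (simp add: comp_minus comp_prefix[OF es])
  then obtain v where v: "\<guillemotleft>v : src e \<rightarrow> src k\<guillemotright>" "k \<star> v = ?w"
    using kernel_factor[OF k, of ?w "src e"] by auto
  have "g \<star> ?w = \<zero> (src e) (tgt g)"
    using v(1) by (simp flip: v(2) add: comp_prefix[OF gk])
  then have "g \<ominus> g \<star> s \<star> e = \<zero> (src g) (tgt g)"
    by (simp add: comp_minus)
  then show ?thesis by (simp add: minus_eq_zero_iff)
qed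

end


section \<open>Relative homological algebra\<close>

lemma (in normal) trivial_factor_group_iff:
  "trivial_group (G Mod H) \<longleftrightarrow> carrier G \<subseteq> H"
proof
  assume "trivial_group (G Mod H)"
  then have "carrier (G Mod H) = {H}"
    by (simp add: trivial_group_def FactGroup_def)
  then have "H #> x = H" if "x \<in> carrier G" for x
    using that by (auto simp: FactGroup_def RCOSETS_def)
  then show "carrier G \<subseteq> H"
    using rcos_self[OF _ subgroup_axioms] by blast
next
  assume "carrier G \<subseteq> H"
  then have "H #> x = H" if "x \<in> carrier G" for x
    using coset_join2[OF that subgroup_axioms] that by blast
  then have "carrier (G Mod H) = {H}"
    by (auto simp: FactGroup_def RCOSETS_def)
  then show "trivial_group (G Mod H)"
    using factorgroup_is_group by (simp add: trivial_group_def FactGroup_def)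
qed

context preadditive_cat
begin

lemma mem_cocycles_iff:
  assumes d: "\<And>n. \<guillemotleft>d n : P (Suc n) \<rightarrow> P n\<guillemotright>" and Y: "Y \<in> Ob C"
  shows "f \<in> cocycles C P (\<lambda>n. mor (d n)) Y n \<longleftrightarrow>
    \<guillemotleft>Arrow (P n) Y f : P n \<rightarrow> Y\<guillemotright> \<and> Arrow (P n) Y f \<star> d n = \<zero> (P (Suc n)) Y"
  using Y d[of n] arr_tgt[of "d n"]
  by (auto simp: cocycles_def kernel_def arr_Arrow comp_arrow_def zero_arrow_def)

lemma mem_coboundaries_Suc_iff:
  assumes d: "\<And>n. \<guillemotleft>d n : P (Suc n) \<rightarrow> P n\<guillemotright>" and Y: "Y \<in> Ob C"
  shows "f \<in> coboundaries C P (\<lambda>n. mor (d n)) Y (Suc n) \<longleftrightarrow>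
    (\<exists>g. \<guillemotleft>g : P n \<rightarrow> Y\<guillemotright> \<and> Arrow (P (Suc n)) Y f = g \<star> d n)"
proof
  assume "f \<in> coboundaries C P (\<lambda>n. mor (d n)) Y (Suc n)"
  then obtain g where "g \<in> Hom C (P n) Y" "f = g \<cdot> mor (d n)" by auto
  then show "\<exists>g. \<guillemotleft>g : P n \<rightarrow> Y\<guillemotright> \<and> Arrow (P (Suc n)) Y f = g \<star> d n"
    using Y d[of n] arr_tgt[of "d n"]
    by (intro exI[of _ "Arrow (P n) Y g"]) (simp add: arr_Arrow comp_arrow_def)
qed (auto simp: comp_arrow_def)

lemma trivial_hom_cohomology_iff:
  assumes d: "\<And>n. \<guillemotleft>d n : P (Suc n) \<rightarrow> P n\<guillemotright>"
    and dd: "\<And>n. d n \<star> d (Suc n) = \<zero> (P (Suc (Suc n))) (P n)" and Y: "Y \<in> Ob C"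
  shows "trivial_group (hom_cohomology C P (\<lambda>n. mor (d n)) Y (Suc n)) \<longleftrightarrow>
    (\<forall>f. \<guillemotleft>f : P (Suc n) \<rightarrow> Y\<guillemotright> \<and> f \<star> d (Suc n) = \<zero> (P (Suc (Suc n))) Y \<longrightarrow>
      (\<exists>g. \<guillemotleft>g : P n \<rightarrow> Y\<guillemotright> \<and> f = g \<star> d n))"
proof -
  let ?G = "hom_group C (P (Suc n)) Y"
  let ?Z = "cocycles C P (\<lambda>n. mor (d n)) Y (Suc n)"
    and ?B = "coboundaries C P (\<lambda>n. mor (d n)) Y (Suc n)"
  note mem_iff = mem_cocycles_iff[of d P, OF d Y] mem_coboundaries_Suc_iff[of d P, OF d Y]
  have P: "P n \<in> Ob C" for n using arr_tgt[of "d n"] d[of n] by simp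
  interpret G: comm_group ?G using P Y by (intro hom_comm_group)
  have Z: "subgroup ?Z ?G"
    using group_hom.subgroup_kernel[OF group_hom_precomp[of "d (Suc n)" Y]] d[of "Suc n"] Y
    by (simp add: cocycles_def)
  have B: "subgroup ?B ?G"
    using group_hom.img_is_subgroup[OF group_hom_precomp[of "d n" Y]] d[of n] Y by simp
  have "g \<star> d n \<star> d (Suc n) = \<zero> (P (Suc (Suc n))) Y" if "\<guillemotleft>g : P n \<rightarrow> Y\<guillemotright>" for g
    using that by (simp add: dd P)
  then have BZ: "?B \<subseteq> ?Z"
    using d unfolding subset_iff mem_iff by auto
  have "normal ?B (?G\<lparr>carrier := ?Z\<rparr>)"
    using comm_group.subgroup_imp_normal[OF G.subgroup_comm_group[OF Z]] G.subgroup_incl[OF B Z BZ]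
    by blast
  then have trivial_iff: "trivial_group (hom_cohomology C P (\<lambda>n. mor (d n)) Y (Suc n)) \<longleftrightarrow> ?Z \<subseteq> ?B"
    unfolding hom_cohomology_def by (simp add: normal.trivial_factor_group_iff)
  show ?thesis unfolding trivial_iff
  proof (intro iffI allI impI subsetI)
    fix f assume "?Z \<subseteq> ?B" "\<guillemotleft>f : P (Suc n) \<rightarrow> Y\<guillemotright> \<and> f \<star> d (Suc n) = \<zero> (P (Suc (Suc n))) Y"
    then show "\<exists>g. \<guillemotleft>g : P n \<rightarrow> Y\<guillemotright> \<and> f = g \<star> d n"
      using mem_iff(1)[of "mor f" "Suc n"] mem_iff(2)[of "mor f" n] by auto
  next
    fix f assume "\<forall>f. \<guillemotleft>f : P (Suc n) \<rightarrow> Y\<guillemotright> \<and> f \<star> d (Suc n) = \<zero> (P (Suc (Suc n))) Y \<longrightarrow>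
      (\<exists>g. \<guillemotleft>g : P n \<rightarrow> Y\<guillemotright> \<and> f = g \<star> d n)" "f \<in> ?Z"
    then show "f \<in> ?B" unfolding mem_iff by blast
  qed
qed

lemma kernel_of_equivalent:
  assumes "kernel_of C g i" and j: "monic C j" and t: "\<guillemotleft>t : src i \<rightarrow> src j\<guillemotright>" "i = j \<star> t"
    and t': "\<guillemotleft>t' : src j \<rightarrow> src i\<guillemotright>" "j = i \<star> t'"
  shows "kernel_of C g j"
proof (rule kernel_ofI[OF _ j])
  note [simp] = kernel_ofD(1-3)[OF assms(1)]
  have tgt_j: "tgt j = src g" using t'(2) by (metis kernel_ofD(3)[OF assms(1)] tgt_comp)
  show "arr C g" "tgt j = src g" by (simp_all add: tgt_j)
  have "g \<star> j = g \<star> i \<star> t'" by (simp flip: t'(2))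
  also have "\<dots> = \<zero> (src j) (tgt g)"
    using t'(1) by (simp add: comp_prefix[OF kernel_ofD(4)[OF assms(1)]])
  finally show "g \<star> j = \<zero> (src j) (tgt g)" .
  fix X h assume "\<guillemotleft>h : X \<rightarrow> src g\<guillemotright>" "g \<star> h = \<zero> X (tgt g)"
  then obtain v where v: "\<guillemotleft>v : X \<rightarrow> src i\<guillemotright>" "i \<star> v = h"
    using kernel_factor[OF assms(1)] by blast
  then have "j \<star> t \<star> v = h" using t(1) j by (simp add: comp_prefix[OF t(2)[symmetric]])
  then show "\<exists>w. \<guillemotleft>w : X \<rightarrow> src j\<guillemotright> \<and> j \<star> w = h"
    using v(1) t(1) by (intro exI[of _ "t \<star> v"]) simp
qed

lemma kernel_of_zero_iff:
  assumes "X \<in> Ob C" "Y \<in> Ob C"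
  shows "kernel_of C (\<zero> X Y) j \<longleftrightarrow> iso_arrow C j \<and> tgt j = X"
proof
  assume K: "kernel_of C (\<zero> X Y) j"
  note [simp] = kernel_ofD(2,3)[OF K]
  obtain v where v: "\<guillemotleft>v : X \<rightarrow> src j\<guillemotright>" "j \<star> v = idt X"
    using kernel_factor[OF K, of "idt X" X] assms by auto
  have "v \<star> j = idt (src j)"
    by (rule monic_cancel[OF kernel_monic[OF K]]) (use v in \<open>simp_all add: comp_prefix[OF v(2)]\<close>)
  then show "iso_arrow C j \<and> tgt j = X"
    using iso_arrowI[of j "src j" X v] v by simp
next
  assume j: "iso_arrow C j \<and> tgt j = X"
  show "kernel_of C (\<zero> X Y) j"
  proof (rule kernel_ofI[OF _ monic_iso])
    show "\<exists>h. \<guillemotleft>h : Z \<rightarrow> src j\<guillemotright> \<and> j \<star> h = g" if "\<guillemotleft>g : Z \<rightarrow> src (\<zero> X Y)\<guillemotright>" for Z g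
      using that j by (intro exI[of _ "j\<inverse> \<star> g"]) simp
  qed (use j assms in simp_all)
qed

lemma zero_object_kernel_idt:
  assumes "kernel_of C (idt X) k"
  shows "is_zero_object C (src k)"
proof -
  note [simp] = kernel_ofD(2,3)[OF assms]
  have X [simp]: "X \<in> Ob C" using arr_tgt[of k] by simp
  have k_eq_zero: "k = \<zero> (src k) X" using kernel_ofD(4)[OF assms] by simp
  have into: "f = \<zero> Y (src k)" if f: "\<guillemotleft>f : Y \<rightarrow> src k\<guillemotright>" for Y f
  proof (rule monic_cancel[OF kernel_monic[OF assms]])
    show "k \<star> f = k \<star> \<zero> Y (src k)"
      using f by (subst (1 2) k_eq_zero) auto
  qed (use f in auto)
  have out_of: "f = \<zero> (src k) Y" if f: "\<guillemotleft>f : src k \<rightarrow> Y\<guillemotright>" for Y f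
  proof -
    have "f = f \<star> \<zero> (src k) (src k)" using f by (simp flip: into[of "idt (src k)"])
    also have "\<dots> = \<zero> (src k) Y" using f by auto
    finally show ?thesis .
  qed
  have "\<exists>!f. f \<in> Hom C Y (src k)" "\<exists>!f. f \<in> Hom C (src k) Y" if "Y \<in> Ob C" for Y
    using that into[of "Arrow Y (src k) _" Y] out_of[of "Arrow (src k) Y _" Y]
      mzero_in[of Y "src k"] mzero_in[of "src k" Y]
    by (auto simp: arr_Arrow zero_arrow_def simp del: mzero_in)
  then show ?thesis by (simp add: is_zero_object_def)
qed

end

definition in_class ::
  "('o, 'm, 'x) precat_scheme \<Rightarrow> ('o \<Rightarrow> 'o \<Rightarrow> 'm \<Rightarrow> bool) \<Rightarrow> ('o, 'm) arrow \<Rightarrow> bool" where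
  "in_class C E e \<longleftrightarrow> src e \<in> Ob C \<and> tgt e \<in> Ob C \<and> E (src e) (tgt e) (mor e)"

context cat
begin

lemma E_projective_lift:
  assumes "E_projective C E P" "in_class C E e" "\<guillemotleft>f : P \<rightarrow> tgt e\<guillemotright>"
  obtains g where "\<guillemotleft>g : P \<rightarrow> src e\<guillemotright>" "e \<star> g = f"
proof -
  have "(\<lambda>g. mor e \<cdot> g) ` Hom C P (src e) = Hom C P (tgt e)"
    using assms(1,2) unfolding E_projective_def in_class_def by blast
  then obtain g where "g \<in> Hom C P (src e)" "mor e \<cdot> g = mor f"
    using mor_in[OF assms(3)] by (metis imageE)
  moreover have "P \<in> Ob C" "src e \<in> Ob C"
    using assms(1,2) by (simp_all add: E_projective_def in_class_def)
  ultimately show thesis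
    using that[of "Arrow P (src e) g"] assms(3) by (auto simp: arr_Arrow comp_arrow_def)
qed

lemma E_projectiveI:
  assumes E_arr: "\<And>e. in_class C E e \<Longrightarrow> arr C e" and P: "P \<in> Ob C"
    and lift: "\<And>e f. \<lbrakk>in_class C E e; \<guillemotleft>f : P \<rightarrow> tgt e\<guillemotright>\<rbrakk> \<Longrightarrow> \<exists>g. \<guillemotleft>g : P \<rightarrow> src e\<guillemotright> \<and> e \<star> g = f"
  shows "E_projective C E P"
proof -
  have "(\<lambda>g. e \<cdot> g) ` Hom C P X = Hom C P Y"
    if X: "X \<in> Ob C" and Y: "Y \<in> Ob C" and e: "E X Y e" for X Y e
  proof
    have e': "in_class C E (Arrow X Y e)" using X Y e by (simp add: in_class_def)
    then have "e \<in> Hom C X Y" using E_arr[OF e'] by (simp add: arr_Arrow)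
    then show "(\<lambda>g. e \<cdot> g) ` Hom C P X \<subseteq> Hom C P Y"
      using comp_in[OF P X Y] by blast
    show "Hom C P Y \<subseteq> (\<lambda>g. e \<cdot> g) ` Hom C P X"
    proof
      fix f assume "f \<in> Hom C P Y"
      then obtain g where "\<guillemotleft>g : P \<rightarrow> X\<guillemotright>" "Arrow X Y e \<star> g = Arrow P Y f"
        using lift[OF e', of "Arrow P Y f"] P Y by (auto simp: arr_Arrow)
      then show "f \<in> (\<lambda>g. e \<cdot> g) ` Hom C P X"
        by (intro image_eqI[of _ _ "mor g"]) (auto simp: comp_arrow_def)
    qed
  qed
  then show ?thesis using P unfolding E_projective_def by blast
qed

lemma canonical_factorizationD:
  assumes "canonical_factorization C X Y f I i e" "X \<in> Ob C" "Y \<in> Ob C"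
  shows "epic C (Arrow X I e)" "monic C (Arrow I Y i)" "Arrow X Y f = Arrow I Y i \<star> Arrow X I e"
  using assms
  by (simp_all add: canonical_factorization_def epic_def monic_def is_epi_def is_mono_def
      arr_Arrow comp_arrow_def)

lemma canonical_factorization_least:
  assumes "canonical_factorization C X Y f I i e" "X \<in> Ob C"
    and j: "monic C j" "tgt j = Y" and g: "\<guillemotleft>g : X \<rightarrow> src j\<guillemotright>" "Arrow X Y f = j \<star> g"
  obtains t where "\<guillemotleft>t : I \<rightarrow> src j\<guillemotright>" "Arrow I Y i = j \<star> t"
proof -
  have "src j \<in> Ob C" "is_mono C (src j) Y (mor j)" "mor g \<in> Hom C X (src j)" "f = mor j \<cdot> mor g"
    using j g by (auto simp: monic_def comp_arrow_def)
  then obtain t where "t \<in> Hom C I (src j)" "i = mor j \<cdot> t"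
    using assms(1) unfolding canonical_factorization_def by blast
  then show thesis
    using that[of "Arrow I (src j) t"] assms(1) j
    by (auto simp: canonical_factorization_def arr_Arrow comp_arrow_def)
qed

end

text \<open>
  Only the epimorphisms in \<open>E\<close> are asked to be cokernels of their kernels: categories of bimodules
  need not have cokernels unless the functors \<open>A \<otimes> -\<close> and \<open>- \<otimes> A\<close> are right exact.
\<close>

locale relative_cat = preadditive_cat C for C :: "('o, 'm, 'x) precat_scheme" (structure) +
  fixes E :: "'o \<Rightarrow> 'o \<Rightarrow> 'm \<Rightarrow> bool"
  assumes kernel_exists: "arr C f \<Longrightarrow> \<exists>k. kernel_of C f k"
    and E_epic: "in_class C E e \<Longrightarrow> epic C e"
    and E_cokernel: "\<lbrakk>in_class C E e; kernel_of C e k; arr C g; src g = src e;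
      g \<star> k = \<zero> (src k) (tgt g)\<rbrakk> \<Longrightarrow> \<exists>h. \<guillemotleft>h : tgt e \<rightarrow> tgt g\<guillemotright> \<and> h \<star> e = g"
    and enough_projectives: "X \<in> Ob C \<Longrightarrow> \<exists>e. in_class C E e \<and> tgt e = X \<and> E_projective C E (src e)"
begin

lemma E_arr [simp]: "in_class C E e \<Longrightarrow> arr C e"
  using E_epic by simp

lemma E_projective_retract:
  assumes P: "E_projective C E P" and a: "\<guillemotleft>a : P \<rightarrow> N\<guillemotright>" and s: "\<guillemotleft>s : N \<rightarrow> P\<guillemotright>" and as: "a \<star> s = idt N"
  shows "E_projective C E N"
proof (rule E_projectiveI[OF E_arr])
  show "N \<in> Ob C" using a by auto
  fix e f assume e: "in_class C E e" and f: "\<guillemotleft>f : N \<rightarrow> tgt e\<guillemotright>"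
  obtain g where g: "\<guillemotleft>g : P \<rightarrow> src e\<guillemotright>" "e \<star> g = f \<star> a"
    using E_projective_lift[OF P e, of "f \<star> a"] a f by auto
  have "e \<star> g \<star> s = f"
    using a s e f g by (simp add: comp_prefix[OF g(2)] as)
  then show "\<exists>g. \<guillemotleft>g : N \<rightarrow> src e\<guillemotright> \<and> e \<star> g = f"
    using s g by (intro exI[of _ "g \<star> s"]) simp
qed

lemma E_projective_iso_iff:
  assumes "iso_arrow C j"
  shows "E_projective C E (src j) \<longleftrightarrow> E_projective C E (tgt j)"
  using assms E_projective_retract[of "src j" j "tgt j" "j\<inverse>"]
    E_projective_retract[of "tgt j" "j\<inverse>" "src j" j]
  by auto

lemma E_monic_factorization_least:
  assumes e: "in_class C E e" and i: "arr C i" "src i = tgt e"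
    and j: "monic C j" "tgt j = tgt i" and g: "\<guillemotleft>g : src e \<rightarrow> src j\<guillemotright>" and eq: "i \<star> e = j \<star> g"
  obtains t where "\<guillemotleft>t : src i \<rightarrow> src j\<guillemotright>" "i = j \<star> t"
proof -
  note [simp] = E_arr[OF e] i j(2) g monic_arr[OF j(1)]
  obtain k where K: "kernel_of C e k" using kernel_exists[of e] by auto
  note [simp] = kernel_ofD(1-3)[OF K]
  have "j \<star> g \<star> k = i \<star> e \<star> k"
    using comp_prefix[OF eq[symmetric], of k] by simp
  also have "\<dots> = j \<star> \<zero> (src k) (src j)"
    using kernel_ofD(4)[OF K] by simp
  finally have "g \<star> k = \<zero> (src k) (src j)"
    by (rule monic_cancel[OF j(1)]) simp_all
  then obtain t where t: "\<guillemotleft>t : tgt e \<rightarrow> src j\<guillemotright>" "t \<star> e = g"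
    using E_cokernel[OF e K, of g] by auto
  have "i = j \<star> t"
    by (rule epic_cancel[OF E_epic[OF e]]) (use t eq in simp_all)
  then show thesis using that t(1) by simp
qed

lemma canonical_factorization_E:
  assumes e: "in_class C E e" and i: "monic C i" "src i = tgt e"
  shows "canonical_factorization C (src e) (tgt i) (mor (i \<star> e)) (src i) (mor i) (mor e)"
proof -
  have "\<exists>t\<in>Hom C (src i) J. mor i = j \<cdot> t"
    if "J \<in> Ob C" "g \<in> Hom C (src e) J" "is_mono C J (tgt i) j \<and> mor (i \<star> e) = j \<cdot> g" for J j g
  proof -
    have "monic C (Arrow J (tgt i) j)" "\<guillemotleft>Arrow (src e) J g : src e \<rightarrow> J\<guillemotright>"
      using that e i by (simp_all add: monic_Arrow arr_Arrow)
    moreover have "i \<star> e = Arrow J (tgt i) j \<star> Arrow (src e) J g"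
      using that(3) by (intro arrow_eqI) simp_all
    ultimately obtain t where "\<guillemotleft>t : src i \<rightarrow> J\<guillemotright>" "i = Arrow J (tgt i) j \<star> t"
      using E_monic_factorization_least[OF e monic_arr[OF i(1)] i(2), of "Arrow J (tgt i) j"
          "Arrow (src e) J g"] by auto
    then show ?thesis by (metis mor_in mor_comp arrow.sel(3))
  qed
  then show ?thesis
    using i E_epic[OF e] E_arr[OF e] unfolding canonical_factorization_def epic_def monic_def
    by simp
qed

definition E_exact :: "('o, 'm) arrow \<Rightarrow> ('o, 'm) arrow \<Rightarrow> bool" where
  "E_exact f g \<longleftrightarrow> (\<exists>e j. in_class C E e \<and> kernel_of C g j \<and> tgt e = src j \<and> f = j \<star> e)"

lemma E_exactI: "\<lbrakk>in_class C E e; kernel_of C g j; tgt e = src j\<rbrakk> \<Longrightarrow> E_exact (j \<star> e) g"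
  unfolding E_exact_def by blast

lemma E_exactE:
  assumes "E_exact f g"
  obtains e j where "in_class C E e" "kernel_of C g j" "tgt e = src j" "f = j \<star> e"
  using assms unfolding E_exact_def by blast

lemma E_exactD:
  assumes "E_exact f g"
  shows "arr C f" "arr C g" "tgt f = src g" "g \<star> f = \<zero> (src f) (tgt g)"
proof -
  obtain e j where ej: "in_class C E e" "kernel_of C g j" "tgt e = src j" "f = j \<star> e"
    using assms by (rule E_exactE)
  note [simp] = kernel_ofD(1-3)[OF ej(2)] E_arr[OF ej(1)] ej(3,4)
  show "arr C f" "arr C g" "tgt f = src g" by simp_all
  show "g \<star> f = \<zero> (src f) (tgt g)" by (simp add: comp_prefix[OF kernel_ofD(4)[OF ej(2)]])
qed

lemma E_exact_iff:
  assumes X: "X \<in> Ob C" and Y: "Y \<in> Ob C" and Z: "Z \<in> Ob C"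
  shows "E_exact (Arrow X Y f) (Arrow Y Z g) \<longleftrightarrow> exact_at C X Y Z f g \<and> E_admissible C E X Y f"
proof
  assume ex: "E_exact (Arrow X Y f) (Arrow Y Z g)"
  then obtain e j where ej: "in_class C E e" "kernel_of C (Arrow Y Z g) j" "tgt e = src j"
    "Arrow X Y f = j \<star> e"
    by (rule E_exactE)
  then have [simp]: "src e = X" "tgt j = Y" "mor j \<cdot> mor e = f"
    by (simp_all add: comp_arrow_def)
  have "f \<in> Hom C X Y" "g \<in> Hom C Y Z"
    using E_exactD(1,2)[OF ex] by (simp_all add: arr_Arrow)
  moreover have "canonical_factorization C X Y f (src j) (mor j) (mor e)"
    using canonical_factorization_E[OF ej(1) kernel_monic[OF ej(2)]] ej(3) by simp
  ultimately show "exact_at C X Y Z f g \<and> E_admissible C E X Y f"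
    using ej(1-3) by (auto simp: exact_at_def E_admissible_def kernel_of_def in_class_def)
next
  assume "exact_at C X Y Z f g \<and> E_admissible C E X Y f"
  then obtain I i q J j e where fac: "canonical_factorization C X Y f I i q" "is_kernel C Y Z g I i"
    and fac': "canonical_factorization C X Y f J j e" "E X J e" and g: "g \<in> Hom C Y Z"
    unfolding exact_at_def E_admissible_def by blast
  let ?i = "Arrow I Y i" and ?j = "Arrow J Y j" and ?e = "Arrow X J e"
  note i = canonical_factorizationD[OF fac(1) X Y] and j = canonical_factorizationD[OF fac'(1) X Y]
  obtain t where t: "\<guillemotleft>t : src ?i \<rightarrow> src ?j\<guillemotright>" "?i = ?j \<star> t"
    using canonical_factorization_least[OF fac(1) X j(2) _ _ j(3)] epic_arr[OF j(1)] by auto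
  obtain t' where t': "\<guillemotleft>t' : src ?j \<rightarrow> src ?i\<guillemotright>" "?j = ?i \<star> t'"
    using canonical_factorization_least[OF fac'(1) X i(2) _ _ i(3)] epic_arr[OF i(1)] by auto
  have "kernel_of C (Arrow Y Z g) ?i"
    using fac(2) g Y Z by (simp add: kernel_of_def arr_Arrow)
  then have "kernel_of C (Arrow Y Z g) ?j"
    by (rule kernel_of_equivalent[OF _ j(2) t t'])
  moreover have "in_class C E ?e"
    using fac'(2) X t(1) arr_tgt[of t] unfolding in_class_def by simp
  ultimately show "E_exact (Arrow X Y f) (Arrow Y Z g)"
    unfolding j(3) by (intro E_exactI) simp_all
qed

lemma E_exact_monic_comp_iff:
  assumes "monic C j" "arr C g" "tgt g = src j"
  shows "E_exact f (j \<star> g) \<longleftrightarrow> E_exact f g"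
  unfolding E_exact_def kernel_of_monic_comp_iff[OF assms] ..

lemma E_exact_lift:
  assumes ex: "E_exact f g" and Q: "E_projective C E Q"
    and h: "\<guillemotleft>h : Q \<rightarrow> src g\<guillemotright>" "g \<star> h = \<zero> Q (tgt g)"
  obtains w where "\<guillemotleft>w : Q \<rightarrow> src f\<guillemotright>" "f \<star> w = h"
proof -
  obtain e j where ej: "in_class C E e" "kernel_of C g j" "tgt e = src j" "f = j \<star> e"
    using ex by (rule E_exactE)
  obtain v where v: "\<guillemotleft>v : Q \<rightarrow> src j\<guillemotright>" "j \<star> v = h"
    using kernel_factor[OF ej(2) h] .
  obtain w where "\<guillemotleft>w : Q \<rightarrow> src e\<guillemotright>" "e \<star> w = v"
    using E_projective_lift[OF Q ej(1), of v] v(1) ej(3) by auto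
  then show thesis
    using that v ej kernel_ofD(2)[OF ej(2)] by simp
qed

text \<open>
  Attaching the augmentation as \<open>\<delta> 0\<close> makes a resolution a single exact sequence, which allows
  uniform inductions.
\<close>

definition resolution :: "(nat \<Rightarrow> ('o, 'm) arrow) \<Rightarrow> bool" where
  "resolution \<delta> \<longleftrightarrow> in_class C E (\<delta> 0) \<and> (\<forall>n. E_exact (\<delta> (Suc n)) (\<delta> n)) \<and>
    (\<forall>n. E_projective C E (src (\<delta> n)))"

lemma zero_object_exists:
  assumes "X \<in> Ob C"
  obtains Z where "is_zero_object C Z" "Z \<in> Ob C"
proof -
  obtain k where "kernel_of C (idt X) k" using kernel_exists[of "idt X"] assms by auto
  then show thesis
    using that zero_object_kernel_idt kernel_ofD(2) arr_src by blast
qed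

lemma resolution_exists:
  assumes "N \<in> Ob C"
  shows "\<exists>\<delta>. resolution \<delta> \<and> tgt (\<delta> 0) = N"
proof -
  obtain cov where cov: "X \<in> Ob C \<Longrightarrow>
      in_class C E (cov X) \<and> tgt (cov X) = X \<and> E_projective C E (src (cov X))" for X
    using enough_projectives by metis
  obtain ker where ker: "arr C f \<Longrightarrow> kernel_of C f (ker f)" for f
    using kernel_exists by metis
  define \<epsilon> where "\<epsilon> n = ((\<lambda>e. cov (src (ker e))) ^^ n) (cov N)" for n
  have \<epsilon>_0: "\<epsilon> 0 = cov N" and \<epsilon>_Suc: "\<epsilon> (Suc n) = cov (src (ker (\<epsilon> n)))" for n
    by (simp_all add: \<epsilon>_def)
  have ker_Ob: "src (ker e) \<in> Ob C" if "in_class C E e" for e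
    using kernel_ofD(2)[OF ker[OF E_arr[OF that]]] by simp
  have \<epsilon>: "in_class C E (\<epsilon> n) \<and> E_projective C E (src (\<epsilon> n))" for n
    by (induction n) (use assms cov ker_Ob in \<open>auto simp: \<epsilon>_0 \<epsilon>_Suc\<close>)
  have tgt_\<epsilon>: "tgt (\<epsilon> (Suc n)) = src (ker (\<epsilon> n))" for n
    using cov ker_Ob \<epsilon> by (simp add: \<epsilon>_Suc)
  have K: "kernel_of C (\<epsilon> n) (ker (\<epsilon> n))" for n
    using \<epsilon> by (simp add: ker)
  define \<delta> where "\<delta> n = (case n of 0 \<Rightarrow> \<epsilon> 0 | Suc n \<Rightarrow> ker (\<epsilon> n) \<star> \<epsilon> (Suc n))" for n
  have "E_exact (\<delta> (Suc n)) (\<epsilon> n)" for n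
    using E_exactI[OF _ K tgt_\<epsilon>] \<epsilon> by (simp add: \<delta>_def)
  then have "E_exact (\<delta> (Suc n)) (\<delta> n)" for n
    using E_exact_monic_comp_iff[OF kernel_monic[OF K]] \<epsilon> tgt_\<epsilon>
    by (auto simp: \<delta>_def split: nat.split)
  then have "resolution \<delta>"
    using \<epsilon> by (auto simp: resolution_def \<delta>_def split: nat.split)
  then show ?thesis
    using cov[OF assms] \<epsilon>_0 by (intro exI[of _ \<delta>]) (simp add: \<delta>_def)
qed

lemma E_projective_resolution_resolution:
  assumes "resolution \<delta>"
  shows "E_projective_resolution C E (tgt (\<delta> 0)) (\<lambda>n. src (\<delta> n)) (\<lambda>n. mor (\<delta> (Suc n))) (mor (\<delta> 0))"
proof -
  have ex: "E_exact (\<delta> (Suc n)) (\<delta> n)" and P: "E_projective C E (src (\<delta> n))"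
    and e: "in_class C E (\<delta> 0)" for n
    using assms by (simp_all add: resolution_def)
  note \<delta> [simp] = E_exactD(2,3)[OF ex]
  have exact: "exact_at C (src (\<delta> (Suc n))) (src (\<delta> n)) (tgt (\<delta> n)) (mor (\<delta> (Suc n))) (mor (\<delta> n)) \<and>
      E_admissible C E (src (\<delta> (Suc n))) (src (\<delta> n)) (mor (\<delta> (Suc n)))" for n
    using ex[of n] E_exact_iff[of "src (\<delta> (Suc n))" "src (\<delta> n)" "tgt (\<delta> n)" "mor (\<delta> (Suc n))"
      "mor (\<delta> n)"]
    by simp
  obtain Z where Z: "is_zero_object C Z" "Z \<in> Ob C"
    using zero_object_exists[of "tgt (\<delta> 0)"] by auto
  have "E_exact (idt (tgt (\<delta> 0)) \<star> \<delta> 0) (\<zero> (tgt (\<delta> 0)) Z)"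
    using e Z by (intro E_exactI) (simp_all add: kernel_of_zero_iff)
  then have "exact_at C (src (\<delta> 0)) (tgt (\<delta> 0)) Z (mor (\<delta> 0)) (mzero C (tgt (\<delta> 0)) Z) \<and>
      E_admissible C E (src (\<delta> 0)) (tgt (\<delta> 0)) (mor (\<delta> 0))"
    using E_exact_iff[of "src (\<delta> 0)" "tgt (\<delta> 0)" Z "mor (\<delta> 0)"] Z by (simp add: zero_arrow_def)
  then show ?thesis
    unfolding E_projective_resolution_def using exact[of "Suc _"] exact[of 0] exact P Z(1) by auto
qed

lemma resolution_of_E_projective_resolution:
  assumes res: "E_projective_resolution C E N P d a" and N: "N \<in> Ob C"
  obtains \<delta> j where "resolution \<delta>" "iso_arrow C j" "src j = tgt (\<delta> 0)" "tgt j = N"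
    "P = (\<lambda>n. src (\<delta> n))" "d = (\<lambda>n. mor (\<delta> (Suc n)))"
proof -
  have proj: "E_projective C E (P n)" for n
    using res by (simp add: E_projective_resolution_def)
  then have P: "P n \<in> Ob C" for n by (simp add: E_projective_def)
  let ?D = "\<lambda>n. Arrow (P (Suc n)) (P n) (d n)" and ?a = "Arrow (P 0) N a"
  have ex: "E_exact (?D (Suc n)) (?D n)" "E_exact (?D 0) ?a" for n
    using res P N by (simp_all add: E_projective_resolution_def E_exact_iff)
  obtain Z where Z: "is_zero_object C Z" "exact_at C (P 0) N Z a (mzero C N Z)"
    using res unfolding E_projective_resolution_def by blast
  have "Z \<in> Ob C" using Z(1) by (simp add: is_zero_object_def)
  then have "E_exact ?a (\<zero> N Z)"
    using res Z(2) P N by (simp add: E_projective_resolution_def E_exact_iff zero_arrow_def)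
  then obtain e j where ej: "in_class C E e" "kernel_of C (\<zero> N Z) j" "tgt e = src j" "?a = j \<star> e"
    by (rule E_exactE)
  have j: "iso_arrow C j" "tgt j = N"
    using ej(2) kernel_of_zero_iff[OF N \<open>Z \<in> Ob C\<close>] by simp_all
  define \<delta> where "\<delta> n = (case n of 0 \<Rightarrow> e | Suc n \<Rightarrow> ?D n)" for n
  have "src e = P 0" using ej(4) by (metis arrow.sel(1) src_comp)
  moreover have "E_exact (?D 0) e"
    using ex(2) E_exact_monic_comp_iff[OF monic_iso[OF j(1)]] ej by simp
  ultimately have "resolution \<delta>"
    using ej(1) ex(1) proj by (auto simp: resolution_def \<delta>_def split: nat.split)
  moreover have "P = (\<lambda>n. src (\<delta> n))" "d = (\<lambda>n. mor (\<delta> (Suc n)))"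
    using \<open>src e = P 0\<close> by (auto simp: \<delta>_def fun_eq_iff split: nat.split)
  ultimately show thesis
    using that[of \<delta> j] j ej(3) by (simp add: \<delta>_def)
qed

lemma contraction_step:
  assumes ex: "E_exact f g" and proj: "E_projective C E (src g)"
    and h: "\<guillemotleft>h : tgt g \<rightarrow> src g\<guillemotright>" "g \<star> h \<star> g = g"
  obtains h' where "\<guillemotleft>h' : tgt f \<rightarrow> src f\<guillemotright>" "f \<star> h' = idt (src g) \<ominus> h \<star> g" "f \<star> h' \<star> f = f"
proof -
  note fg = E_exactD[OF ex]
  note [simp] = fg(1-3) h(1)
  let ?w = "idt (src g) \<ominus> h \<star> g"
  have "g \<star> ?w = \<zero> (src g) (tgt g)"
    by (simp add: comp_minus h(2))
  then obtain h' where h': "\<guillemotleft>h' : src g \<rightarrow> src f\<guillemotright>" "f \<star> h' = ?w"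
    using E_exact_lift[OF ex proj, of ?w] by auto
  have "f \<star> h' \<star> f = ?w \<star> f"
    using h'(1) by (simp add: comp_prefix[OF h'(2)])
  also have "\<dots> = f"
    by (simp add: minus_comp fg(4))
  finally show thesis using that h' by simp
qed

context
  fixes \<delta> assumes res: "resolution \<delta>"
begin

lemma resolutionD:
  shows resolution_E: "in_class C E (\<delta> 0)" and resolution_exact: "E_exact (\<delta> (Suc n)) (\<delta> n)"
    and resolution_projective: "E_projective C E (src (\<delta> n))"
  using res by (simp_all add: resolution_def)

lemma resolution_arr [simp]: "arr C (\<delta> n)"
  and resolution_tgt [simp]: "tgt (\<delta> (Suc n)) = src (\<delta> n)"
  and resolution_comp: "\<delta> n \<star> \<delta> (Suc n) = \<zero> (src (\<delta> (Suc n))) (tgt (\<delta> n))"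
  using E_exactD[OF resolution_exact] by simp_all

lemma resolution_cohomology_trivial_iff:
  assumes "Y \<in> Ob C"
  shows "trivial_group (hom_cohomology C (\<lambda>n. src (\<delta> n)) (\<lambda>n. mor (\<delta> (Suc n))) Y (Suc n)) \<longleftrightarrow>
    (\<forall>f. \<guillemotleft>f : src (\<delta> (Suc n)) \<rightarrow> Y\<guillemotright> \<and> f \<star> \<delta> (Suc (Suc n)) = \<zero> (src (\<delta> (Suc (Suc n)))) Y \<longrightarrow>
      (\<exists>g. \<guillemotleft>g : src (\<delta> n) \<rightarrow> Y\<guillemotright> \<and> f = g \<star> \<delta> (Suc n)))"
  by (rule trivial_hom_cohomology_iff[of "\<lambda>n. \<delta> (Suc n)" "\<lambda>n. src (\<delta> n)"])
    (simp_all add: assms resolution_comp)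

lemma resolution_contraction:
  assumes "E_projective C E (tgt (\<delta> 0))"
  shows "\<exists>h. \<guillemotleft>h : tgt (\<delta> n) \<rightarrow> src (\<delta> n)\<guillemotright> \<and> \<delta> n \<star> h \<star> \<delta> n = \<delta> n"
proof (induction n)
  case 0
  obtain s where s: "\<guillemotleft>s : tgt (\<delta> 0) \<rightarrow> src (\<delta> 0)\<guillemotright>" "\<delta> 0 \<star> s = idt (tgt (\<delta> 0))"
    using E_projective_lift[OF assms resolution_E, of "idt (tgt (\<delta> 0))"] by auto
  then show ?case by (intro exI[of _ s]) (simp add: comp_prefix[OF s(2)])
next
  case (Suc n)
  then show ?case
    using contraction_step[OF resolution_exact resolution_projective] by metis
qed

lemma cohomology_trivial_if_projective:
  assumes N: "E_projective C E (tgt (\<delta> 0))" and Y: "Y \<in> Ob C"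
  shows "trivial_group (hom_cohomology C (\<lambda>n. src (\<delta> n)) (\<lambda>n. mor (\<delta> (Suc n))) Y (Suc n))"
  unfolding resolution_cohomology_trivial_iff[OF Y]
proof (intro allI impI)
  fix f assume f: "\<guillemotleft>f : src (\<delta> (Suc n)) \<rightarrow> Y\<guillemotright> \<and> f \<star> \<delta> (Suc (Suc n)) = \<zero> (src (\<delta> (Suc (Suc n)))) Y"
  obtain h where h: "\<guillemotleft>h : src (\<delta> n) \<rightarrow> src (\<delta> (Suc n))\<guillemotright>" "\<delta> (Suc n) \<star> h \<star> \<delta> (Suc n) = \<delta> (Suc n)"
    using resolution_contraction[OF N, of "Suc n"] by auto
  obtain h' where h': "\<guillemotleft>h' : src (\<delta> (Suc n)) \<rightarrow> src (\<delta> (Suc (Suc n)))\<guillemotright>"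
    "\<delta> (Suc (Suc n)) \<star> h' = idt (src (\<delta> (Suc n))) \<ominus> h \<star> \<delta> (Suc n)"
    using contraction_step[OF resolution_exact resolution_projective, of h "Suc n"] h by auto
  have "f \<star> (idt (src (\<delta> (Suc n))) \<ominus> h \<star> \<delta> (Suc n)) = \<zero> (src (\<delta> (Suc n))) Y"
    using f h'(1) comp_prefix[of f "\<delta> (Suc (Suc n))" _ h'] by (auto simp flip: h'(2))
  then have "f = f \<star> h \<star> \<delta> (Suc n)"
    using f h(1) by (simp add: comp_minus minus_eq_zero_iff)
  then show "\<exists>g. \<guillemotleft>g : src (\<delta> n) \<rightarrow> Y\<guillemotright> \<and> f = g \<star> \<delta> (Suc n)"
    using f h(1) by (intro exI[of _ "f \<star> h"]) simp
qed

lemma projective_if_cohomology_trivial: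
  assumes triv: "\<And>Y. Y \<in> Ob C \<Longrightarrow>
    trivial_group (hom_cohomology C (\<lambda>n. src (\<delta> n)) (\<lambda>n. mor (\<delta> (Suc n))) Y 1)"
  shows "E_projective C E (tgt (\<delta> 0))"
proof -
  obtain q i where q: "in_class C E q" and i: "kernel_of C (\<delta> 0) i"
    and qi: "tgt q = src i" "\<delta> (Suc 0) = i \<star> q"
    using resolution_exact[of 0] by (rule E_exactE)
  have src_q: "src q = src (\<delta> (Suc 0))" using qi(2) by simp
  note [simp] = E_arr[OF q] kernel_ofD(1-3)[OF i] qi(1) src_q
  have "i \<star> q \<star> \<delta> (Suc (Suc 0)) = i \<star> \<zero> (src (\<delta> (Suc (Suc 0)))) (src i)"
    using resolution_comp[of "Suc 0"] by (simp add: comp_prefix[OF qi(2)[symmetric]])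
  then have "q \<star> \<delta> (Suc (Suc 0)) = \<zero> (src (\<delta> (Suc (Suc 0)))) (src i)"
    by (rule monic_cancel[OF kernel_monic[OF i]]) simp_all
  moreover have "trivial_group
      (hom_cohomology C (\<lambda>n. src (\<delta> n)) (\<lambda>n. mor (\<delta> (Suc n))) (src i) (Suc 0))"
    using triv[of "src i"] by simp
  ultimately obtain g where g: "\<guillemotleft>g : src (\<delta> 0) \<rightarrow> src i\<guillemotright>" "q = g \<star> \<delta> (Suc 0)"
    using iffD1[OF resolution_cohomology_trivial_iff, THEN spec, of "src i" 0 q] by auto
  have retraction: "g \<star> i = idt (src i)"
    by (rule epic_cancel[OF E_epic[OF q]]) (use g(1) in \<open>simp_all flip: g(2) qi(2)\<close>)
  let ?w = "idt (src (\<delta> 0)) \<ominus> i \<star> g"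
  have "?w \<star> i = \<zero> (src i) (src (\<delta> 0))"
    using g(1) by (simp add: minus_comp retraction)
  then obtain h where h: "\<guillemotleft>h : tgt (\<delta> 0) \<rightarrow> src (\<delta> 0)\<guillemotright>" "h \<star> \<delta> 0 = ?w"
    using E_cokernel[OF resolution_E i, of ?w] g(1) by auto
  have "(\<delta> 0 \<star> h) \<star> \<delta> 0 = idt (tgt (\<delta> 0)) \<star> \<delta> 0"
    using g(1) h(1) by (simp add: h(2) comp_minus comp_prefix[OF kernel_ofD(4)[OF i]])
  then have "\<delta> 0 \<star> h = idt (tgt (\<delta> 0))"
    by (rule epic_cancel[OF E_epic[OF resolution_E]]) (use h(1) in simp_all)
  then show ?thesis
    using E_projective_retract[OF resolution_projective] h(1) by auto
qed

end

lemma Ext_eq_cohomology_resolution: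
  assumes "N \<in> Ob C"
  obtains \<delta> j where "resolution \<delta>" "iso_arrow C j" "src j = tgt (\<delta> 0)" "tgt j = N"
    "\<And>n Y. Ext C E n N Y = hom_cohomology C (\<lambda>n. src (\<delta> n)) (\<lambda>n. mor (\<delta> (Suc n))) Y n"
proof -
  obtain P d a where eq: "(SOME (P, d, a). E_projective_resolution C E N P d a) = (P, d, a)"
    by (metis prod_cases3)
  have "case (SOME (P, d, a). E_projective_resolution C E N P d a) of
      (P, d, a) \<Rightarrow> E_projective_resolution C E N P d a"
    using resolution_exists[OF assms] E_projective_resolution_resolution
    by (intro someI_ex[of "\<lambda>(P, d, a). E_projective_resolution C E N P d a"]) fastforce
  then have "E_projective_resolution C E N P d a" by (simp add: eq)
  then obtain \<delta> j where "resolution \<delta>" "iso_arrow C j" "src j = tgt (\<delta> 0)" "tgt j = N"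
    and "P = (\<lambda>n. src (\<delta> n))" "d = (\<lambda>n. mor (\<delta> (Suc n)))"
    using assms by (rule resolution_of_E_projective_resolution)
  then show thesis
    using that[of \<delta> j] eq by (simp add: Ext_def)
qed

theorem E_projective_iff_Ext_trivial:
  assumes N: "N \<in> Ob C"
  shows "E_projective C E N \<longleftrightarrow> (\<forall>Y\<in>Ob C. trivial_group (Ext C E 1 N Y))"
    and "E_projective C E N \<longleftrightarrow> (\<forall>Y\<in>Ob C. \<forall>n>0. trivial_group (Ext C E n N Y))"
proof -
  obtain \<delta> j where res: "resolution \<delta>" and j: "iso_arrow C j" "src j = tgt (\<delta> 0)" "tgt j = N"
    and Ext: "\<And>n Y. Ext C E n N Y = hom_cohomology C (\<lambda>n. src (\<delta> n)) (\<lambda>n. mor (\<delta> (Suc n))) Y n"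
    using Ext_eq_cohomology_resolution[OF N] by metis
  have iso: "E_projective C E N \<longleftrightarrow> E_projective C E (tgt (\<delta> 0))"
    using E_projective_iso_iff[OF j(1)] j by simp
  have projectiveI: "E_projective C E N" if "\<forall>Y\<in>Ob C. trivial_group (Ext C E 1 N Y)"
    unfolding iso using projective_if_cohomology_trivial[OF res] that by (simp add: Ext)
  have Ext_trivial: "trivial_group (Ext C E n N Y)"
    if "E_projective C E N" "Y \<in> Ob C" "n > 0" for n Y
    using cohomology_trivial_if_projective[OF res, of Y "n - 1"] that by (simp add: iso Ext)
  show "E_projective C E N \<longleftrightarrow> (\<forall>Y\<in>Ob C. trivial_group (Ext C E 1 N Y))"
    using projectiveI Ext_trivial by auto
  show "E_projective C E N \<longleftrightarrow> (\<forall>Y\<in>Ob C. \<forall>n>0. trivial_group (Ext C E n N Y))"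
    using projectiveI Ext_trivial by auto
qed

end


section \<open>Monads and their algebras\<close>

locale monad = cat C for C :: "('o, 'm, 'x) precat_scheme" (structure) +
  fixes T0 :: "'o \<Rightarrow> 'o" and T :: "('o, 'm) arrow \<Rightarrow> ('o, 'm) arrow" and \<mu> \<eta> :: "'o \<Rightarrow> ('o, 'm) arrow"
  assumes T_typed: "\<guillemotleft>f : X \<rightarrow> Y\<guillemotright> \<Longrightarrow> \<guillemotleft>T f : T0 X \<rightarrow> T0 Y\<guillemotright>"
    and T_idt [simp]: "X \<in> Ob C \<Longrightarrow> T (idt X) = idt (T0 X)"
    and T_comp: "\<lbrakk>arr C f; arr C g; tgt f = src g\<rbrakk> \<Longrightarrow> T (g \<star> f) = T g \<star> T f"
    and mult_typed: "X \<in> Ob C \<Longrightarrow> \<guillemotleft>\<mu> X : T0 (T0 X) \<rightarrow> T0 X\<guillemotright>"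
    and unit_typed: "X \<in> Ob C \<Longrightarrow> \<guillemotleft>\<eta> X : X \<rightarrow> T0 X\<guillemotright>"
    and mult_natural: "\<guillemotleft>f : X \<rightarrow> Y\<guillemotright> \<Longrightarrow> \<mu> Y \<star> T (T f) = T f \<star> \<mu> X"
    and unit_natural: "\<guillemotleft>f : X \<rightarrow> Y\<guillemotright> \<Longrightarrow> \<eta> Y \<star> f = T f \<star> \<eta> X"
    and mult_assoc: "X \<in> Ob C \<Longrightarrow> \<mu> X \<star> T (\<mu> X) = \<mu> X \<star> \<mu> (T0 X)"
    and mult_unit: "X \<in> Ob C \<Longrightarrow> \<mu> X \<star> \<eta> (T0 X) = idt (T0 X)"
    and mult_T_unit: "X \<in> Ob C \<Longrightarrow> \<mu> X \<star> T (\<eta> X) = idt (T0 X)"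
begin

lemma T_sel [simp]:
  assumes "arr C f"
  shows "arr C (T f)" "src (T f) = T0 (src f)" "tgt (T f) = T0 (tgt f)"
  using T_typed[of f] assms by simp_all

lemma T0_in [simp]: "X \<in> Ob C \<Longrightarrow> T0 X \<in> Ob C"
  by (metis T_typed arr_idt arr_src src_idt tgt_idt)

lemma mult_unit_sel [simp]:
  assumes "X \<in> Ob C"
  shows "arr C (\<mu> X)" "src (\<mu> X) = T0 (T0 X)" "tgt (\<mu> X) = T0 X"
    "arr C (\<eta> X)" "src (\<eta> X) = X" "tgt (\<eta> X) = T0 X"
  using mult_typed unit_typed assms by simp_all

text \<open>
  An algebra is represented by its action alone, as its carrier is the target of the action.
\<close>

definition algebra :: "('o, 'm) arrow \<Rightarrow> bool" where
  "algebra a \<longleftrightarrow> \<guillemotleft>a : T0 (tgt a) \<rightarrow> tgt a\<guillemotright> \<and>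
    a \<star> T a = a \<star> \<mu> (tgt a) \<and> a \<star> \<eta> (tgt a) = idt (tgt a)"

definition linear :: "('o, 'm) arrow \<Rightarrow> ('o, 'm) arrow \<Rightarrow> ('o, 'm) arrow \<Rightarrow> bool" where
  "linear a b f \<longleftrightarrow> \<guillemotleft>f : tgt a \<rightarrow> tgt b\<guillemotright> \<and> f \<star> a = b \<star> T f"

lemma algebraD:
  assumes "algebra a"
  shows "arr C a" "src a = T0 (tgt a)" "a \<star> T a = a \<star> \<mu> (tgt a)" "a \<star> \<eta> (tgt a) = idt (tgt a)"
  using assms by (simp_all add: algebra_def)

lemma linearD:
  assumes "linear a b f"
  shows "arr C f" "src f = tgt a" "tgt f = tgt b" "f \<star> a = b \<star> T f"
  using assms by (simp_all add: linear_def)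

lemma linear_idt: "algebra a \<Longrightarrow> linear a a (idt (tgt a))"
  using algebraD(1,2)[of a] by (simp add: linear_def)

lemma linear_comp:
  assumes "algebra a" "algebra b" "algebra c" and f: "linear a b f" and g: "linear b c g"
  shows "linear a c (g \<star> f)"
proof -
  note [simp] = algebraD(1,2)[OF assms(1)] algebraD(1,2)[OF assms(2)] algebraD(1,2)[OF assms(3)]
    linearD(1-3)[OF f] linearD(1-3)[OF g]
  have "(g \<star> f) \<star> a = (g \<star> b) \<star> T f"
    by (simp add: linearD(4)[OF f])
  also have "\<dots> = c \<star> T (g \<star> f)"
    by (simp add: linearD(4)[OF g] T_comp)
  finally show ?thesis by (simp add: linear_def)
qed

lemma linear_descend_split_epi:
  assumes "algebra a" "algebra b" "algebra c" and e: "linear a b e"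
    and s: "\<guillemotleft>s : tgt b \<rightarrow> tgt a\<guillemotright>" "e \<star> s = idt (tgt b)"
    and h: "\<guillemotleft>h : tgt b \<rightarrow> tgt c\<guillemotright>" and he: "linear a c (h \<star> e)"
  shows "linear b c h"
proof -
  note [simp] = algebraD(1,2)[OF assms(1)] algebraD(1,2)[OF assms(2)] algebraD(1,2)[OF assms(3)]
    linearD(1-3)[OF e] s(1) h
  have "h \<star> b = h \<star> b \<star> T (e \<star> s)" by (simp add: s(2))
  also have "\<dots> = (h \<star> e) \<star> a \<star> T s"
    by (simp add: T_comp comp_prefix[OF linearD(4)[OF e]])
  also have "\<dots> = c \<star> T (h \<star> e \<star> s)"
    by (simp add: T_comp comp_prefix[OF linearD(4)[OF he]] del: comp_arrow_assoc)
       (simp add: T_comp)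
  finally show ?thesis by (simp add: s(2) linear_def)
qed

lemma linear_factor_monic:
  assumes "algebra a" "algebra b" "algebra c" and k: "linear b c k" "monic C k"
    and h: "\<guillemotleft>h : tgt a \<rightarrow> tgt b\<guillemotright>" and kh: "linear a c (k \<star> h)"
  shows "linear a b h"
proof -
  note [simp] = algebraD(1,2)[OF assms(1)] algebraD(1,2)[OF assms(2)] algebraD(1,2)[OF assms(3)]
    linearD(1-3)[OF k(1)] h
  have "k \<star> h \<star> a = k \<star> b \<star> T h"
    using linearD(4)[OF kh] by (simp add: T_comp comp_prefix[OF linearD(4)[OF k(1)]])
  then have "h \<star> a = b \<star> T h" by (rule monic_cancel[OF k(2)]) simp_all
  then show ?thesis by (simp add: linear_def)
qed

lemma algebra_monic:
  assumes b: "algebra b" and k: "linear a b k" "monic C k" and a: "\<guillemotleft>a : T0 (src k) \<rightarrow> src k\<guillemotright>"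
  shows "algebra a"
proof -
  note [simp] = algebraD(1,2)[OF b] linearD(1,3)[OF k(1)] a
  note k_linear = linearD(4)[OF k(1)]
  have "k \<star> a \<star> T a = b \<star> T (k \<star> a)"
    by (simp add: comp_prefix[OF k_linear] T_comp)
  also have "\<dots> = (b \<star> T b) \<star> T (T k)"
    unfolding k_linear by (simp add: T_comp)
  also have "\<dots> = b \<star> T k \<star> \<mu> (src k)"
    unfolding algebraD(3)[OF b] by (simp add: mult_natural[of k "src k" "tgt b"])
  also have "\<dots> = k \<star> a \<star> \<mu> (src k)"
    by (simp add: comp_prefix[OF k_linear])
  finally have "a \<star> T a = a \<star> \<mu> (src k)"
    by (rule monic_cancel[OF k(2)]) simp_all
  moreover have "k \<star> a \<star> \<eta> (src k) = k \<star> idt (src k)"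
    by (simp add: comp_prefix[OF k_linear] comp_prefix[OF algebraD(4)[OF b]]
      flip: unit_natural[of k "src k" "tgt b"])
  then have "a \<star> \<eta> (src k) = idt (src k)"
    by (rule monic_cancel[OF k(2)]) simp_all
  ultimately show ?thesis by (simp add: algebra_def)
qed

lemma algebra_free: "X \<in> Ob C \<Longrightarrow> algebra (\<mu> X)"
  by (simp add: algebra_def mult_assoc mult_unit)

lemma linear_extension:
  assumes a: "algebra a" and t: "\<guillemotleft>t : X \<rightarrow> tgt a\<guillemotright>"
  shows "linear (\<mu> X) a (a \<star> T t)"
proof -
  have [simp]: "X \<in> Ob C" using t by auto
  note [simp] = algebraD(1,2)[OF a] t
  have "(a \<star> T t) \<star> \<mu> X = (a \<star> \<mu> (tgt a)) \<star> T (T t)"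
    using mult_natural[OF t] by simp
  also have "\<dots> = a \<star> T (a \<star> T t)"
    by (simp add: T_comp flip: algebraD(3)[OF a])
  finally show ?thesis by (simp add: linear_def)
qed

lemma extension_unit:
  assumes a: "algebra a" and t: "\<guillemotleft>t : X \<rightarrow> tgt a\<guillemotright>"
  shows "a \<star> T t \<star> \<eta> X = t"
  using t algebraD(1,2)[OF a] comp_prefix[OF algebraD(4)[OF a]]
  by (simp flip: unit_natural[OF t])

lemma linear_free_eqI:
  assumes a: "algebra a" and X: "X \<in> Ob C" and f: "linear (\<mu> X) a f" and g: "linear (\<mu> X) a g"
    and eq: "f \<star> \<eta> X = g \<star> \<eta> X"
  shows "f = g"
proof -
  have "h = a \<star> T (h \<star> \<eta> X)" if h: "linear (\<mu> X) a h" for h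
    using X linearD(1-3)[OF h] comp_prefix[OF linearD(4)[OF h, symmetric], of "T (\<eta> X)"]
      algebraD(1,2)[OF a]
    by (simp add: T_comp mult_T_unit)
  then show ?thesis using f g eq by metis
qed

end

locale additive_monad = preadditive_cat C + monad C T0 T \<mu> \<eta>
  for C :: "('o, 'm, 'x) precat_scheme" (structure) and T0 T \<mu> \<eta> +
  assumes T_additive: "\<lbrakk>X \<in> Ob C; Y \<in> Ob C\<rbrakk> \<Longrightarrow>
    group_hom (hom_group C X Y) (hom_group C (T0 X) (T0 Y)) (\<lambda>f. mor (T (Arrow X Y f)))"
begin

lemma T_zero: "\<lbrakk>X \<in> Ob C; Y \<in> Ob C\<rbrakk> \<Longrightarrow> T (\<zero> X Y) = \<zero> (T0 X) (T0 Y)"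
  using group_hom.hom_one[OF T_additive, of X Y]
  by (intro arrow_eqI) (simp_all add: zero_arrow_def arr_Arrow)

lemma kernel_algebra:
  assumes "algebra a" "algebra b" and f: "linear a b f" and K: "kernel_of C f k"
  obtains c where "algebra c" "tgt c = src k" "linear c a k"
proof -
  note [simp] = algebraD(1,2)[OF assms(1)] algebraD(1,2)[OF assms(2)] linearD(1-3)[OF f]
    kernel_ofD(2,3)[OF K]
  have "f \<star> a \<star> T k = b \<star> T (f \<star> k)"
    by (simp add: comp_prefix[OF linearD(4)[OF f]] T_comp)
  also have "\<dots> = \<zero> (T0 (src k)) (tgt f)"
    by (simp add: kernel_ofD(4)[OF K] T_zero)
  finally obtain c where c: "\<guillemotleft>c : T0 (src k) \<rightarrow> src k\<guillemotright>" "k \<star> c = a \<star> T k"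
    using kernel_factor[OF K, of "a \<star> T k"] by auto
  then have "linear c a k" by (simp add: linear_def)
  then show thesis
    using that algebra_monic[OF assms(1) _ kernel_monic[OF K]] c(1) by auto
qed

lemma subgroup_linear:
  assumes a: "\<guillemotleft>a : T0 X \<rightarrow> X\<guillemotright>" and b: "\<guillemotleft>b : T0 Y \<rightarrow> Y\<guillemotright>"
  shows "subgroup {f \<in> Hom C X Y. linear a b (Arrow X Y f)} (hom_group C X Y)"
proof -
  have XY: "X \<in> Ob C" "Y \<in> Ob C" using a b by auto
  interpret precomp: group_hom "hom_group C X Y" "hom_group C (T0 X) Y" "\<lambda>f. f \<cdot> mor a"
    using group_hom_precomp[of a Y] a XY by simp
  interpret T: group_hom "hom_group C X Y" "hom_group C (T0 X) (T0 Y)" "\<lambda>f. mor (T (Arrow X Y f))"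
    using T_additive XY .
  interpret postcomp: group_hom "hom_group C (T0 X) (T0 Y)" "hom_group C (T0 X) Y" "\<lambda>f. mor b \<cdot> f"
    using group_hom_postcomp[of b "T0 X"] b XY by simp
  have "group_hom (hom_group C X Y) (hom_group C (T0 X) Y) (\<lambda>f. mor b \<cdot> mor (T (Arrow X Y f)))"
    using hom_compose[OF T.homh postcomp.homh] by unfold_locales (simp add: o_def)
  from subgroup_equalizer[OF precomp.group_hom_axioms this]
  have "subgroup {f \<in> Hom C X Y. f \<cdot> mor a = mor b \<cdot> mor (T (Arrow X Y f))} (hom_group C X Y)"
    by simp
  also have "{f \<in> Hom C X Y. f \<cdot> mor a = mor b \<cdot> mor (T (Arrow X Y f))} =
      {f \<in> Hom C X Y. linear a b (Arrow X Y f)}"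
    using a b XY by (auto simp: linear_def arr_Arrow comp_arrow_def)
  finally show ?thesis .
qed

end


section \<open>Distributive laws\<close>

locale distributive_law = cat C + L: monad C L0 L \<mu>\<^sub>L \<eta>\<^sub>L + R: monad C R0 R \<mu>\<^sub>R \<eta>\<^sub>R
  for C :: "('o, 'm, 'x) precat_scheme" (structure) and L0 L \<mu>\<^sub>L \<eta>\<^sub>L and R0 R \<mu>\<^sub>R \<eta>\<^sub>R +
  fixes \<sigma> :: "'o \<Rightarrow> ('o, 'm) arrow"
  assumes law_typed: "X \<in> Ob C \<Longrightarrow> \<guillemotleft>\<sigma> X : R0 (L0 X) \<rightarrow> L0 (R0 X)\<guillemotright>"
    and law_iso [simp]: "X \<in> Ob C \<Longrightarrow> iso_arrow C (\<sigma> X)"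
    and law_natural: "\<guillemotleft>f : X \<rightarrow> Y\<guillemotright> \<Longrightarrow> \<sigma> Y \<star> R (L f) = L (R f) \<star> \<sigma> X"
    and law_mult_L: "X \<in> Ob C \<Longrightarrow> \<sigma> X \<star> R (\<mu>\<^sub>L X) = \<mu>\<^sub>L (R0 X) \<star> L (\<sigma> X) \<star> \<sigma> (L0 X)"
    and law_unit_L: "X \<in> Ob C \<Longrightarrow> \<sigma> X \<star> R (\<eta>\<^sub>L X) = \<eta>\<^sub>L (R0 X)"
    and law_mult_R: "X \<in> Ob C \<Longrightarrow> \<sigma> X \<star> \<mu>\<^sub>R (L0 X) = L (\<mu>\<^sub>R X) \<star> \<sigma> (R0 X) \<star> R (\<sigma> X)"
    and law_unit_R: "X \<in> Ob C \<Longrightarrow> \<sigma> X \<star> \<eta>\<^sub>R (L0 X) = L (\<eta>\<^sub>R X)"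
begin

lemma law_sel [simp]:
  assumes "X \<in> Ob C"
  shows "src (\<sigma> X) = R0 (L0 X)" "tgt (\<sigma> X) = L0 (R0 X)"
  using law_typed[OF assms] by simp_all

text \<open>
  A bialgebra carries compatible algebra structures for the two monads, in contrast to the
  bialgebras of Hopf theory.
\<close>

definition bialgebra :: "('o, 'm) arrow \<Rightarrow> ('o, 'm) arrow \<Rightarrow> bool" where
  "bialgebra l r \<longleftrightarrow> L.algebra l \<and> R.algebra r \<and> tgt l = tgt r \<and> r \<star> R l = l \<star> L r \<star> \<sigma> (tgt r)"

definition bilinear :: "('o, 'm) arrow \<Rightarrow> ('o, 'm) arrow \<Rightarrow> ('o, 'm) arrow \<Rightarrow> ('o, 'm) arrow \<Rightarrow>
    ('o, 'm) arrow \<Rightarrow> bool" where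
  "bilinear l r l' r' f \<longleftrightarrow> L.linear l l' f \<and> R.linear r r' f"

lemma bialgebraD:
  assumes "bialgebra l r"
  shows "L.algebra l" "R.algebra r" "tgt l = tgt r" "r \<star> R l = l \<star> L r \<star> \<sigma> (tgt r)"
    "arr C l" "src l = L0 (tgt r)" "arr C r" "src r = R0 (tgt r)"
  using assms by (auto simp: bialgebra_def dest: L.algebraD R.algebraD)

lemma bilinearD:
  assumes "bilinear l r l' r' f"
  shows "L.linear l l' f" "R.linear r r' f" "arr C f" "src f = tgt r" "tgt f = tgt r'"
  using assms by (auto simp: bilinear_def dest: R.linearD)

lemma bilinear_idt: "bialgebra l r \<Longrightarrow> bilinear l r l r (idt (tgt r))"
  using L.linear_idt[of l] R.linear_idt[of r] by (simp add: bialgebra_def bilinear_def)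

lemma bilinear_comp:
  assumes "bialgebra l r" "bialgebra l' r'" "bialgebra l'' r''"
    and "bilinear l r l' r' f" "bilinear l' r' l'' r'' g"
  shows "bilinear l r l'' r'' (g \<star> f)"
  using assms L.linear_comp[of l l' l'' f g] R.linear_comp[of r r' r'' f g]
  by (simp add: bilinear_def bialgebra_def)

definition induced_left :: "('o, 'm) arrow \<Rightarrow> ('o, 'm) arrow" where
  "induced_left v = R v \<star> (\<sigma> (tgt v))\<inverse>"

lemma induced_left_sel [simp]:
  assumes "L.algebra v"
  shows "arr C (induced_left v)" "src (induced_left v) = L0 (R0 (tgt v))"
    "tgt (induced_left v) = R0 (tgt v)"
  using L.algebraD(1,2)[OF assms] by (simp_all add: induced_left_def)

lemma induced_left_law:
  assumes v: "L.algebra v" and k: "\<guillemotleft>k : X \<rightarrow> R0 (L0 (tgt v))\<guillemotright>"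
  shows "induced_left v \<star> \<sigma> (tgt v) \<star> k = R v \<star> k"
  using L.algebraD(1,2)[OF v] k by (simp add: induced_left_def)

lemma algebra_induced_left:
  assumes v: "L.algebra v"
  shows "L.algebra (induced_left v)"
proof -
  note [simp] = L.algebraD(1,2)[OF v]
  let ?V = "tgt v" and ?l = "induced_left v"
  let ?c = "(\<sigma> (L0 ?V))\<inverse> \<star> L ((\<sigma> ?V)\<inverse>)"
  have L_inv: "L (\<sigma> ?V) \<star> L ((\<sigma> ?V)\<inverse>) = idt (L0 (L0 (R0 ?V)))"
    by (simp flip: L.T_comp)
  have "?l \<star> L ?l = R v \<star> (\<sigma> ?V)\<inverse> \<star> L (R v) \<star> L ((\<sigma> ?V)\<inverse>)"
    using v by (simp add: induced_left_def L.T_comp)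
  also have "\<dots> = R v \<star> (\<sigma> ?V)\<inverse> \<star> (L (R v) \<star> \<sigma> (L0 ?V)) \<star> ?c"
    by simp
  also have "\<dots> = R (v \<star> L v) \<star> ?c"
    by (simp add: R.T_comp flip: law_natural[of v "L0 ?V" ?V])
  also have "\<dots> = ?l \<star> (\<sigma> ?V \<star> R (\<mu>\<^sub>L ?V)) \<star> ?c"
    using v by (simp add: L.algebraD(3)[OF v] R.T_comp induced_left_law)
  also have "\<dots> = ?l \<star> \<mu>\<^sub>L (R0 ?V)"
    using v by (simp add: law_mult_L L_inv)
  finally have assoc: "?l \<star> L ?l = ?l \<star> \<mu>\<^sub>L (R0 ?V)" .
  have "?l \<star> \<eta>\<^sub>L (R0 ?V) = R (v \<star> \<eta>\<^sub>L ?V)"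
    using v by (simp add: induced_left_law R.T_comp flip: law_unit_L)
  then show ?thesis
    using v assoc by (simp add: L.algebra_def L.algebraD(4)[OF v])
qed

lemma bialgebra_induced:
  assumes v: "L.algebra v"
  shows "bialgebra (induced_left v) (\<mu>\<^sub>R (tgt v))"
proof -
  note [simp] = L.algebraD(1,2)[OF v]
  let ?V = "tgt v" and ?l = "induced_left v"
  have R_inv: "R (\<sigma> ?V) \<star> R ((\<sigma> ?V)\<inverse>) = idt (R0 (L0 (R0 ?V)))"
    by (simp flip: R.T_comp)
  have "\<mu>\<^sub>R ?V \<star> R ?l = (\<mu>\<^sub>R ?V \<star> R (R v)) \<star> R ((\<sigma> ?V)\<inverse>)"
    by (simp add: induced_left_def R.T_comp)
  also have "\<dots> = ?l \<star> (\<sigma> ?V \<star> \<mu>\<^sub>R (L0 ?V)) \<star> R ((\<sigma> ?V)\<inverse>)"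
    using v by (simp add: R.mult_natural[of v "L0 ?V" ?V] induced_left_law)
  also have "\<dots> = ?l \<star> L (\<mu>\<^sub>R ?V) \<star> \<sigma> (R0 ?V)"
    using v by (simp add: law_mult_R R_inv)
  finally show ?thesis
    using v algebra_induced_left R.algebra_free by (simp add: bialgebra_def)
qed

lemma unit_linear_induced:
  assumes v: "L.algebra v"
  shows "L.linear v (induced_left v) (\<eta>\<^sub>R (tgt v))"
proof -
  note [simp] = L.algebraD(1,2)[OF v]
  have "\<eta>\<^sub>R (tgt v) \<star> v = induced_left v \<star> \<sigma> (tgt v) \<star> \<eta>\<^sub>R (L0 (tgt v))"
    using v by (simp add: R.unit_natural[of v "L0 (tgt v)" "tgt v"] induced_left_law)
  also have "\<dots> = induced_left v \<star> L (\<eta>\<^sub>R (tgt v))"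
    by (simp add: law_unit_R)
  finally show ?thesis using v by (simp add: L.linear_def)
qed

lemma bilinear_induced_extension:
  assumes v: "L.algebra v" and lr: "bialgebra l r" and g: "L.linear v l g"
  shows "bilinear (induced_left v) (\<mu>\<^sub>R (tgt v)) l r (r \<star> R g)"
proof -
  note [simp] = L.algebraD(1,2)[OF v] bialgebraD(3,5-8)[OF lr] L.linearD(1-3)[OF g]
  let ?V = "tgt v"
  have "(r \<star> R g) \<star> induced_left v = r \<star> R (g \<star> v) \<star> (\<sigma> ?V)\<inverse>"
    by (simp add: induced_left_def R.T_comp)
  also have "\<dots> = (r \<star> R l) \<star> R (L g) \<star> (\<sigma> ?V)\<inverse>"
    by (simp add: L.linearD(4)[OF g] R.T_comp)
  also have "\<dots> = l \<star> L r \<star> (\<sigma> (tgt r) \<star> R (L g)) \<star> (\<sigma> ?V)\<inverse>"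
    unfolding bialgebraD(4)[OF lr] by simp
  also have "\<dots> = l \<star> L (r \<star> R g)"
    by (simp add: law_natural[of g ?V "tgt r"] L.T_comp)
  finally have "L.linear (induced_left v) l (r \<star> R g)"
    using v by (simp add: L.linear_def)
  then show ?thesis
    using R.linear_extension[OF bialgebraD(2)[OF lr], of g ?V] by (simp add: bilinear_def)
qed

lemma bilinear_induced_map:
  assumes v: "L.algebra v" and w: "L.algebra w" and g: "L.linear v w g"
  shows "bilinear (induced_left v) (\<mu>\<^sub>R (tgt v)) (induced_left w) (\<mu>\<^sub>R (tgt w)) (R g)"
proof -
  note [simp] = L.algebraD(1,2)[OF w] L.linearD(1-3)[OF g]
  have "L.linear v (induced_left w) (\<eta>\<^sub>R (tgt w) \<star> g)"
    by (rule L.linear_comp[OF v w algebra_induced_left[OF w] g unit_linear_induced[OF w]])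
  moreover have "\<mu>\<^sub>R (tgt w) \<star> R (\<eta>\<^sub>R (tgt w) \<star> g) = R g"
    by (simp add: R.T_comp comp_prefix[OF R.mult_T_unit])
  ultimately show ?thesis
    using bilinear_induced_extension[OF v bialgebra_induced[OF w]] by metis
qed

definition free_left :: "'o \<Rightarrow> ('o, 'm) arrow" where
  "free_left X = induced_left (\<mu>\<^sub>L X)"

definition free_right :: "'o \<Rightarrow> ('o, 'm) arrow" where
  "free_right X = \<mu>\<^sub>R (L0 X)"

definition free_unit :: "'o \<Rightarrow> ('o, 'm) arrow" where
  "free_unit X = \<eta>\<^sub>R (L0 X) \<star> \<eta>\<^sub>L X"

lemma free_unit_sel [simp]:
  assumes "X \<in> Ob C"
  shows "arr C (free_unit X)" "src (free_unit X) = X" "tgt (free_unit X) = R0 (L0 X)"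
  using assms by (simp_all add: free_unit_def)

lemma bialgebra_free: "X \<in> Ob C \<Longrightarrow> bialgebra (free_left X) (free_right X)"
  using bialgebra_induced[OF L.algebra_free] by (simp add: free_left_def free_right_def)

lemma tgt_free [simp]:
  assumes "X \<in> Ob C"
  shows "tgt (free_left X) = R0 (L0 X)" "tgt (free_right X) = R0 (L0 X)"
  using bialgebraD(3)[OF bialgebra_free[OF assms]] assms by (simp_all add: free_right_def)

lemma free_extension:
  assumes lr: "bialgebra l r" and t: "\<guillemotleft>t : X \<rightarrow> tgt r\<guillemotright>"
  obtains g where "bilinear (free_left X) (free_right X) l r g" "g \<star> free_unit X = t"
proof
  have X: "X \<in> Ob C" using t by auto
  note [simp] = X t bialgebraD(3,5-8)[OF lr]
  have lin: "L.linear (\<mu>\<^sub>L X) l (l \<star> L t)"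
    using L.linear_extension[OF bialgebraD(1)[OF lr], of t X] by simp
  show "bilinear (free_left X) (free_right X) l r (r \<star> R (l \<star> L t))"
    using bilinear_induced_extension[OF L.algebra_free[OF X] lr lin]
    by (simp add: free_left_def free_right_def)
  have "(r \<star> R (l \<star> L t)) \<star> free_unit X = (r \<star> R (l \<star> L t) \<star> \<eta>\<^sub>R (L0 X)) \<star> \<eta>\<^sub>L X"
    by (simp add: free_unit_def)
  also have "\<dots> = t"
    using R.extension_unit[OF bialgebraD(2)[OF lr], of "l \<star> L t"]
      L.extension_unit[OF bialgebraD(1)[OF lr], of t] by simp
  finally show "(r \<star> R (l \<star> L t)) \<star> free_unit X = t" .
qed

lemma bilinear_free_eqI:
  assumes X: "X \<in> Ob C" and lr: "bialgebra l r" and f: "bilinear (free_left X) (free_right X) l r f"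
    and g: "bilinear (free_left X) (free_right X) l r g" and eq: "f \<star> free_unit X = g \<star> free_unit X"
  shows "f = g"
proof (rule R.linear_free_eqI[OF bialgebraD(2)[OF lr]])
  show "L0 X \<in> Ob C" using X by simp
  show "R.linear (\<mu>\<^sub>R (L0 X)) r f" "R.linear (\<mu>\<^sub>R (L0 X)) r g"
    using bilinearD(2)[OF f] bilinearD(2)[OF g] by (simp_all add: free_right_def)
  have lin: "L.linear (\<mu>\<^sub>L X) l (h \<star> \<eta>\<^sub>R (L0 X))" if "bilinear (free_left X) (free_right X) l r h"
    for h
    using L.linear_comp[OF L.algebra_free[OF X] algebra_induced_left[OF L.algebra_free[OF X]]
        bialgebraD(1)[OF lr] unit_linear_induced[OF L.algebra_free[OF X]]] bilinearD(1)[OF that] X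
    by (simp add: free_left_def)
  show "f \<star> \<eta>\<^sub>R (L0 X) = g \<star> \<eta>\<^sub>R (L0 X)"
    by (rule L.linear_free_eqI[OF bialgebraD(1)[OF lr] X lin[OF f] lin[OF g]])
      (use eq X bilinearD(3,4)[OF f] bilinearD(3,4)[OF g] in \<open>simp add: free_unit_def\<close>)
qed

end


section \<open>The category of bialgebras\<close>

definition forget :: "('o \<times> 'a, 'm) arrow \<Rightarrow> ('o, 'm) arrow" where
  "forget f = Arrow (fst (src f)) (fst (tgt f)) (mor f)"

lemma forget_sel [simp]:
  "src (forget f) = fst (src f)" "tgt (forget f) = fst (tgt f)" "mor (forget f) = mor f"
  by (simp_all add: forget_def)

context distributive_law
begin

lemma bilinear_descend_split_epi:
  assumes "bialgebra l r" "bialgebra l' r'" "bialgebra l'' r''" and e: "bilinear l r l' r' e"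
    and s: "\<guillemotleft>s : tgt r' \<rightarrow> tgt r\<guillemotright>" "e \<star> s = idt (tgt r')"
    and h: "\<guillemotleft>h : tgt r' \<rightarrow> tgt r''\<guillemotright>" and he: "bilinear l r l'' r'' (h \<star> e)"
  shows "bilinear l' r' l'' r'' h"
  using L.linear_descend_split_epi[of l l' l'' e s h] R.linear_descend_split_epi[of r r' r'' e s h]
    assms
  by (simp add: bialgebra_def bilinear_def)

lemma bilinear_factor_monic:
  assumes "bialgebra l r" "bialgebra l' r'" "bialgebra l'' r''"
    and k: "bilinear l' r' l'' r'' k" "monic C k"
    and h: "\<guillemotleft>h : tgt r \<rightarrow> tgt r'\<guillemotright>" and kh: "bilinear l r l'' r'' (k \<star> h)"
  shows "bilinear l r l' r' h"
  using L.linear_factor_monic[of l l' l'' k h] R.linear_factor_monic[of r r' r'' k h] assms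
  by (simp add: bialgebra_def bilinear_def)

lemma bialgebra_monic:
  assumes lr: "bialgebra l r" and k: "L.linear l' l k" "R.linear r' r k" "monic C k"
    and "L.algebra l'" "R.algebra r'"
  shows "bialgebra l' r'"
proof -
  note [simp] = bialgebraD(3,5-8)[OF lr] R.algebraD(1,2)[OF \<open>R.algebra r'\<close>] R.linearD(1-3)[OF k(2)]
  have tgt_eq: "tgt l' = tgt r'"
    using L.linearD(2)[OF k(1)] by simp
  note [simp] = L.algebraD(1,2)[OF \<open>L.algebra l'\<close>, unfolded tgt_eq] tgt_eq
  note k_left = L.linearD(4)[OF k(1)] and k_right = R.linearD(4)[OF k(2)]
  have "k \<star> r' \<star> R l' = r \<star> R (k \<star> l')"
    by (simp add: comp_prefix[OF k_right] R.T_comp)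
  also have "\<dots> = (r \<star> R l) \<star> R (L k)"
    unfolding k_left by (simp add: R.T_comp)
  also have "\<dots> = l \<star> L (r \<star> R k) \<star> \<sigma> (tgt r')"
    unfolding bialgebraD(4)[OF lr] by (simp add: L.T_comp law_natural[of k "tgt r'" "tgt r"])
  also have "\<dots> = k \<star> l' \<star> L r' \<star> \<sigma> (tgt r')"
    by (simp add: comp_prefix[OF k_left] L.T_comp flip: k_right)
  finally have "r' \<star> R l' = l' \<star> L r' \<star> \<sigma> (tgt r')"
    by (rule monic_cancel[OF k(3)]) simp_all
  then show ?thesis using assms(5,6) by (simp add: bialgebra_def)
qed

definition left_action :: "'o \<times> 'm \<times> 'm \<Rightarrow> ('o, 'm) arrow" where
  "left_action B = Arrow (L0 (fst B)) (fst B) (fst (snd B))"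

definition right_action :: "'o \<times> 'm \<times> 'm \<Rightarrow> ('o, 'm) arrow" where
  "right_action B = Arrow (R0 (fst B)) (fst B) (snd (snd B))"

definition Bialg :: "('o \<times> 'm \<times> 'm, 'm) precat" where
  "Bialg = \<lparr>Ob = {B. bialgebra (left_action B) (right_action B)},
    Hom = (\<lambda>B B'. {f \<in> Hom C (fst B) (fst B').
      Arrow (fst B) (fst B') f \<star> left_action B = left_action B' \<star> L (Arrow (fst B) (fst B') f) \<and>
      Arrow (fst B) (fst B') f \<star> right_action B = right_action B' \<star> R (Arrow (fst B) (fst B') f)}),
    Id = (\<lambda>B. Id C (fst B)), comp = comp C, madd = madd C,
    mzero = (\<lambda>B B'. mzero C (fst B) (fst B'))\<rparr>"

abbreviation bilinear_between :: "'o \<times> 'm \<times> 'm \<Rightarrow> 'o \<times> 'm \<times> 'm \<Rightarrow> ('o, 'm) arrow \<Rightarrow> bool" where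
  "bilinear_between B B' \<equiv>
    bilinear (left_action B) (right_action B) (left_action B') (right_action B')"

lemma action_sel [simp]:
  "src (left_action B) = L0 (fst B)" "tgt (left_action B) = fst B"
  "src (right_action B) = R0 (fst B)" "tgt (right_action B) = fst B"
  by (simp_all add: left_action_def right_action_def)

lemma Bialg_sel [simp]:
  "Id Bialg B = Id C (fst B)" "comp Bialg = comp C" "madd Bialg = madd C"
  "mzero Bialg B B' = mzero C (fst B) (fst B')"
  by (simp_all add: Bialg_def)

lemma Bialg_Ob_iff: "B \<in> Ob Bialg \<longleftrightarrow> bialgebra (left_action B) (right_action B)"
  by (simp add: Bialg_def)

lemma Bialg_Ob_fst [simp]: "B \<in> Ob Bialg \<Longrightarrow> fst B \<in> Ob C"
  using arr_tgt[OF bialgebraD(7)] by (fastforce simp: Bialg_Ob_iff)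

lemma Bialg_Hom_iff:
  assumes "B \<in> Ob Bialg" "B' \<in> Ob Bialg"
  shows "f \<in> Hom Bialg B B' \<longleftrightarrow> bilinear_between B B' (Arrow (fst B) (fst B') f)"
  using Bialg_Ob_fst[OF assms(1)] Bialg_Ob_fst[OF assms(2)]
  by (auto simp: Bialg_def bilinear_def L.linear_def R.linear_def arr_Arrow)

lemma Bialg_Hom_in: "f \<in> Hom Bialg B B' \<Longrightarrow> f \<in> Hom C (fst B) (fst B')"
  by (simp add: Bialg_def)

lemma arr_Bialg_iff:
  "arr Bialg f \<longleftrightarrow> src f \<in> Ob Bialg \<and> tgt f \<in> Ob Bialg \<and> bilinear_between (src f) (tgt f) (forget f)"
  unfolding arr_def by (auto simp: Bialg_Hom_iff forget_def)

lemma bilinear_forget: "\<guillemotleft>f : B \<rightarrow> B'\<guillemotright>\<^bsub>Bialg\<^esub> \<Longrightarrow> bilinear_between B B' (forget f)"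
  by (auto simp: arr_Bialg_iff)

lemma arr_forget [simp]: "arr Bialg f \<Longrightarrow> arr C (forget f)"
  using bilinearD(3)[OF bilinear_forget] by blast

lemma forget_comp [simp]: "forget (g \<star>\<^bsub>Bialg\<^esub> f) = forget g \<star> forget f"
  by (simp add: forget_def comp_arrow_def)

lemma forget_idt [simp]: "forget (idt\<^bsub>Bialg\<^esub> B) = idt (fst B)"
  by (simp add: forget_def id_arrow_def)

lemma forget_zero [simp]: "forget (\<zero>\<^bsub>Bialg\<^esub> B B') = \<zero> (fst B) (fst B')"
  by (simp add: forget_def zero_arrow_def)

lemma forget_eqI: "\<lbrakk>src f = src g; tgt f = tgt g; forget f = forget g\<rbrakk> \<Longrightarrow> f = g"
  by (rule arrow_eqI) (simp_all add: forget_def)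

lemma lift_bilinear:
  assumes "B \<in> Ob Bialg" "B' \<in> Ob Bialg" "bilinear_between B B' h"
  obtains f where "\<guillemotleft>f : B \<rightarrow> B'\<guillemotright>\<^bsub>Bialg\<^esub>" "forget f = h"
proof
  show "forget (Arrow B B' (mor h)) = h"
    using bilinearD(4,5)[OF assms(3)] by (simp add: forget_def)
  then show "\<guillemotleft>Arrow B B' (mor h) : B \<rightarrow> B'\<guillemotright>\<^bsub>Bialg\<^esub>"
    using assms by (simp add: arr_Bialg_iff)
qed

lemma cat_Bialg: "cat Bialg"
proof (rule cat.intro)
  fix B assume B: "B \<in> Ob Bialg"
  show "Id Bialg B \<in> Hom Bialg B B"
    using bilinear_idt[of "left_action B" "right_action B"] B
    by (simp add: Bialg_Hom_iff Bialg_Ob_iff id_arrow_def)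
next
  fix B B' B'' f g
  assume B: "B \<in> Ob Bialg" "B' \<in> Ob Bialg" "B'' \<in> Ob Bialg"
    and fg: "f \<in> Hom Bialg B B'" "g \<in> Hom Bialg B' B''"
  have "bilinear_between B B'' (Arrow (fst B') (fst B'') g \<star> Arrow (fst B) (fst B') f)"
    using B fg by (intro bilinear_comp) (auto simp: Bialg_Hom_iff Bialg_Ob_iff)
  then show "g \<cdot>\<^bsub>Bialg\<^esub> f \<in> Hom Bialg B B''"
    using B by (simp add: Bialg_Hom_iff comp_arrow_def)
next
  fix B B' f assume "B \<in> Ob Bialg" "B' \<in> Ob Bialg" "f \<in> Hom Bialg B B'"
  then show "f \<cdot>\<^bsub>Bialg\<^esub> Id Bialg B = f" "Id Bialg B' \<cdot>\<^bsub>Bialg\<^esub> f = f"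
    using comp_Id[of "fst B" "fst B'" f] Id_comp[of "fst B" "fst B'" f] Bialg_Hom_in by simp_all
next
  fix B B' B'' B''' f g h
  assume "B \<in> Ob Bialg" "B' \<in> Ob Bialg" "B'' \<in> Ob Bialg" "B''' \<in> Ob Bialg"
    "f \<in> Hom Bialg B B'" "g \<in> Hom Bialg B' B''" "h \<in> Hom Bialg B'' B'''"
  then show "h \<cdot>\<^bsub>Bialg\<^esub> g \<cdot>\<^bsub>Bialg\<^esub> f = h \<cdot>\<^bsub>Bialg\<^esub> (g \<cdot>\<^bsub>Bialg\<^esub> f)"
    using comp_assoc[of "fst B" "fst B'" "fst B''" "fst B'''" f g h] Bialg_Hom_in by simp
qed

end

locale additive_distributive_law =
  preadditive_cat C + L: additive_monad C L0 L \<mu>\<^sub>L \<eta>\<^sub>L + R: additive_monad C R0 R \<mu>\<^sub>R \<eta>\<^sub>R +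
  distributive_law C L0 L \<mu>\<^sub>L \<eta>\<^sub>L R0 R \<mu>\<^sub>R \<eta>\<^sub>R \<sigma>
  for C :: "('o, 'm, 'x) precat_scheme" (structure) and L0 L \<mu>\<^sub>L \<eta>\<^sub>L and R0 R \<mu>\<^sub>R \<eta>\<^sub>R and \<sigma> +
  assumes has_kernels: "arr C f \<Longrightarrow> \<exists>k. kernel_of C f k"
begin

lemma subgroup_Bialg_Hom:
  assumes B: "B \<in> Ob Bialg" "B' \<in> Ob Bialg"
  shows "subgroup (Hom Bialg B B') (hom_group C (fst B) (fst B'))"
proof -
  let ?linear_L = "\<lambda>f. L.linear (left_action B) (left_action B') (Arrow (fst B) (fst B') f)"
  let ?linear_R = "\<lambda>f. R.linear (right_action B) (right_action B') (Arrow (fst B) (fst B') f)"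
  have actions: "arr C (left_action B)" "arr C (right_action B)" "arr C (left_action B')"
    "arr C (right_action B')"
    using B by (auto simp: Bialg_Ob_iff dest: bialgebraD)
  have "f \<in> Hom Bialg B B' \<longleftrightarrow> f \<in> Hom C (fst B) (fst B') \<and> ?linear_L f \<and> ?linear_R f" for f
    using Bialg_Hom_iff[OF B] Bialg_Hom_in[of f B B'] by (auto simp: bilinear_def)
  then have "Hom Bialg B B' =
      {f \<in> Hom C (fst B) (fst B'). ?linear_L f} \<inter> {f \<in> Hom C (fst B) (fst B'). ?linear_R f}"
    by blast
  then show ?thesis
    using actions B
    by (auto intro!: group.subgroups_Inter_pair group_hom_group L.subgroup_linear R.subgroup_linear)
qed

lemma preadditive_Bialg: "preadditive_cat Bialg"
proof (intro preadditive_cat.intro cat_Bialg preadditive_cat_axioms.intro)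
  fix B B' assume B: "B \<in> Ob Bialg" "B' \<in> Ob Bialg"
  have hom_group_eq: "hom_group Bialg B B' =
      hom_group C (fst B) (fst B')\<lparr>carrier := Hom Bialg B B'\<rparr>"
    by (simp add: hom_group_def)
  show "comm_group (hom_group Bialg B B')"
    unfolding hom_group_eq
    using comm_group.subgroup_comm_group[OF hom_comm_group subgroup_Bialg_Hom] B by simp
next
  fix B B' B'' f f' g
  assume "B \<in> Ob Bialg" "B' \<in> Ob Bialg" "B'' \<in> Ob Bialg"
    "f \<in> Hom Bialg B B'" "f' \<in> Hom Bialg B B'" "g \<in> Hom Bialg B' B''"
  then show "g \<cdot>\<^bsub>Bialg\<^esub> madd Bialg f f' =
      madd Bialg (g \<cdot>\<^bsub>Bialg\<^esub> f) (g \<cdot>\<^bsub>Bialg\<^esub> f')"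
    using comp_madd_right[of "fst B" "fst B'" "fst B''" f f' g] Bialg_Hom_in by simp
next
  fix B B' B'' f g g'
  assume "B \<in> Ob Bialg" "B' \<in> Ob Bialg" "B'' \<in> Ob Bialg"
    "f \<in> Hom Bialg B B'" "g \<in> Hom Bialg B' B''" "g' \<in> Hom Bialg B' B''"
  then show "madd Bialg g g' \<cdot>\<^bsub>Bialg\<^esub> f =
      madd Bialg (g \<cdot>\<^bsub>Bialg\<^esub> f) (g' \<cdot>\<^bsub>Bialg\<^esub> f)"
    using comp_madd_left[of "fst B" "fst B'" "fst B''" f g g'] Bialg_Hom_in by simp
qed

sublocale Bialg: preadditive_cat Bialg
  by (rule preadditive_Bialg)

lemma monic_forget:
  assumes "arr Bialg k" "monic C (forget k)"
  shows "monic Bialg k"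
proof (rule Bialg.monicI[OF assms(1)])
  fix B f g
  assume f: "\<guillemotleft>f : B \<rightarrow> src k\<guillemotright>\<^bsub>Bialg\<^esub>" and g: "\<guillemotleft>g : B \<rightarrow> src k\<guillemotright>\<^bsub>Bialg\<^esub>"
    and eq: "k \<star>\<^bsub>Bialg\<^esub> f = k \<star>\<^bsub>Bialg\<^esub> g"
  have "forget k \<star> forget f = forget k \<star> forget g" using arg_cong[OF eq, of forget] by simp
  then have "forget f = forget g" by (rule monic_cancel[OF assms(2)]) (use f g in simp_all)
  then show "f = g" using f g by (intro forget_eqI) simp_all
qed

lemma epic_forget:
  assumes "arr Bialg e" "epic C (forget e)"
  shows "epic Bialg e"
proof (rule Bialg.epicI[OF assms(1)])
  fix B f g
  assume f: "\<guillemotleft>f : tgt e \<rightarrow> B\<guillemotright>\<^bsub>Bialg\<^esub>" and g: "\<guillemotleft>g : tgt e \<rightarrow> B\<guillemotright>\<^bsub>Bialg\<^esub>"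
    and eq: "f \<star>\<^bsub>Bialg\<^esub> e = g \<star>\<^bsub>Bialg\<^esub> e"
  have "forget f \<star> forget e = forget g \<star> forget e" using arg_cong[OF eq, of forget] by simp
  then have "forget f = forget g" by (rule epic_cancel[OF assms(2)]) (use f g in simp_all)
  then show "f = g" using f g by (intro forget_eqI) simp_all
qed

lemma kernel_bialgebra:
  assumes "arr Bialg f" and K: "kernel_of C (forget f) k"
  obtains B where "B \<in> Ob Bialg" "bilinear_between B (src f) k"
proof -
  let ?B = "src f" and ?B' = "tgt f"
  have f: "bialgebra (left_action ?B) (right_action ?B)"
    "bialgebra (left_action ?B') (right_action ?B')"
    "bilinear_between ?B ?B' (forget f)"
    using assms(1) bilinear_forget by (simp_all flip: Bialg_Ob_iff)
  obtain l where l: "L.algebra l" "tgt l = src k" "L.linear l (left_action ?B) k"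
    by (rule L.kernel_algebra[OF bialgebraD(1)[OF f(1)] bialgebraD(1)[OF f(2)]
          bilinearD(1)[OF f(3)] K])
  obtain r where r: "R.algebra r" "tgt r = src k" "R.linear r (right_action ?B) k"
    by (rule R.kernel_algebra[OF bialgebraD(2)[OF f(1)] bialgebraD(2)[OF f(2)]
          bilinearD(2)[OF f(3)] K])
  let ?K = "(src k, mor l, mor r)"
  have K_actions: "left_action ?K = l" "right_action ?K = r"
    using l(2) r(2) L.algebraD(2)[OF l(1)] R.algebraD(2)[OF r(1)]
    by (simp_all add: left_action_def right_action_def)
  have "bialgebra l r"
    by (rule bialgebra_monic[OF f(1) l(3) r(3) kernel_monic[OF K] l(1) r(1)])
  then show thesis
    using that[of ?K] l(3) r(3) by (simp add: Bialg_Ob_iff K_actions bilinear_def)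
qed

lemma kernel_of_forget:
  assumes "arr Bialg f" and k: "\<guillemotleft>k : K \<rightarrow> src f\<guillemotright>\<^bsub>Bialg\<^esub>" and ker: "kernel_of C (forget f) (forget k)"
  shows "kernel_of Bialg f k"
proof (rule Bialg.kernel_ofI[OF assms(1)])
  have K: "K \<in> Ob Bialg" using k by auto
  note [simp] = assms(1) k
  show "monic Bialg k"
    using kernel_monic[OF ker] by (intro monic_forget) simp_all
  show "f \<star>\<^bsub>Bialg\<^esub> k = \<zero>\<^bsub>Bialg\<^esub> (src k) (tgt f)"
    by (rule forget_eqI) (simp_all add: kernel_ofD(4)[OF ker])
  fix B g
  assume g: "\<guillemotleft>g : B \<rightarrow> src f\<guillemotright>\<^bsub>Bialg\<^esub>" and fg: "f \<star>\<^bsub>Bialg\<^esub> g = \<zero>\<^bsub>Bialg\<^esub> B (tgt f)"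
  have "forget f \<star> forget g = \<zero> (fst B) (fst (tgt f))" using arg_cong[OF fg, of forget] by simp
  then obtain h where h: "\<guillemotleft>h : fst B \<rightarrow> fst K\<guillemotright>" "forget k \<star> h = forget g"
    using kernel_factor[OF ker, of "forget g" "fst B"] g by auto
  have B: "B \<in> Ob Bialg" using g by auto
  have "bilinear_between B K h"
  proof (rule bilinear_factor_monic[OF _ _ _ bilinear_forget[OF k] kernel_monic[OF ker]])
    show "bilinear_between B (src f) (forget k \<star> h)"
      using bilinear_forget[OF g] by (simp add: h(2))
  qed (use B K h(1) in \<open>simp_all flip: Bialg_Ob_iff\<close>)
  then obtain h' where "\<guillemotleft>h' : B \<rightarrow> K\<guillemotright>\<^bsub>Bialg\<^esub>" "forget h' = h"
    using lift_bilinear[OF B K] by blast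
  then show "\<exists>h. \<guillemotleft>h : B \<rightarrow> src k\<guillemotright>\<^bsub>Bialg\<^esub> \<and> k \<star>\<^bsub>Bialg\<^esub> h = g"
    using g h(2) by (intro exI[of _ h']) (auto intro: forget_eqI)
qed (simp add: k)

lemma Bialg_kernel:
  assumes f: "arr Bialg f"
  obtains k where "kernel_of Bialg f k" "kernel_of C (forget f) (forget k)"
proof -
  obtain k where ker: "kernel_of C (forget f) k" using has_kernels[of "forget f"] f by auto
  obtain K where K: "K \<in> Ob Bialg" "bilinear_between K (src f) k"
    using kernel_bialgebra[OF f ker] .
  obtain k' where k': "\<guillemotleft>k' : K \<rightarrow> src f\<guillemotright>\<^bsub>Bialg\<^esub>" "forget k' = k"
    using lift_bilinear[OF K(1) _ K(2)] f by auto
  then show thesis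
    using that[of k'] kernel_of_forget[OF f k'(1)] ker by simp
qed

definition split_epi :: "'o \<times> 'm \<times> 'm \<Rightarrow> 'o \<times> 'm \<times> 'm \<Rightarrow> 'm \<Rightarrow> bool" where
  "split_epi B B' e \<longleftrightarrow> is_epi Bialg B B' e \<and> has_section C (fst B) (fst B') e"

lemma in_class_split_epi_iff:
  "in_class Bialg split_epi e \<longleftrightarrow>
    arr Bialg e \<and> (\<exists>s. \<guillemotleft>s : fst (tgt e) \<rightarrow> fst (src e)\<guillemotright> \<and> forget e \<star> s = idt (fst (tgt e)))"
proof -
  have section_iff: "has_section C (fst (src e)) (fst (tgt e)) (mor e) \<longleftrightarrow>
      (\<exists>s. \<guillemotleft>s : fst (tgt e) \<rightarrow> fst (src e)\<guillemotright> \<and> forget e \<star> s = idt (fst (tgt e)))" if "arr Bialg e"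
    using has_section_iff[of "forget e"] that by simp
  have "epic Bialg e" if "arr Bialg e" "\<guillemotleft>s : fst (tgt e) \<rightarrow> fst (src e)\<guillemotright>"
    "forget e \<star> s = idt (fst (tgt e))" for s
    using that epic_split[of "forget e" s] by (intro epic_forget) simp_all
  moreover have "in_class Bialg split_epi e \<longleftrightarrow>
      epic Bialg e \<and> has_section C (fst (src e)) (fst (tgt e)) (mor e)"
    unfolding in_class_def split_epi_def epic_def arr_def is_epi_def by blast
  ultimately show ?thesis
    using section_iff Bialg.epic_arr by blast
qed

lemma in_class_split_epiE:
  assumes "in_class Bialg split_epi e"
  obtains s where "arr Bialg e" "\<guillemotleft>s : fst (tgt e) \<rightarrow> fst (src e)\<guillemotright>" "forget e \<star> s = idt (fst (tgt e))"
  using assms by (auto simp: in_class_split_epi_iff)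

lemma split_epi_cokernel:
  assumes e: "in_class Bialg split_epi e" and k: "kernel_of Bialg e k"
    and g: "\<guillemotleft>g : src e \<rightarrow> B\<guillemotright>\<^bsub>Bialg\<^esub>" and gk: "g \<star>\<^bsub>Bialg\<^esub> k = \<zero>\<^bsub>Bialg\<^esub> (src k) B"
  obtains h where "\<guillemotleft>h : tgt e \<rightarrow> B\<guillemotright>\<^bsub>Bialg\<^esub>" "h \<star>\<^bsub>Bialg\<^esub> e = g"
proof -
  obtain s where e': "arr Bialg e"
    and s: "\<guillemotleft>s : fst (tgt e) \<rightarrow> fst (src e)\<guillemotright>" "forget e \<star> s = idt (fst (tgt e))"
    using e by (rule in_class_split_epiE)
  have B: "B \<in> Ob Bialg" using g by auto
  note [simp] = e' s(1) g Bialg.kernel_ofD(1-3)[OF k]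
  obtain k' where k': "kernel_of Bialg e k'" "kernel_of C (forget e) (forget k')"
    using Bialg_kernel[OF e'] .
  note [simp] = Bialg.kernel_ofD(2,3)[OF k'(1)]
  obtain t where t: "\<guillemotleft>t : src k' \<rightarrow> src k\<guillemotright>\<^bsub>Bialg\<^esub>" "k \<star>\<^bsub>Bialg\<^esub> t = k'"
    using Bialg.kernel_factor[OF k, of k' "src k'"] Bialg.kernel_ofD(4)[OF k'(1)] by auto
  have "g \<star>\<^bsub>Bialg\<^esub> k' = \<zero>\<^bsub>Bialg\<^esub> (src k') B"
    using t(1) B by (simp add: Bialg.comp_prefix[OF gk] flip: t(2))
  then have "forget g \<star> forget k' = \<zero> (fst (src k')) (fst B)"
    by (metis forget_comp forget_zero)
  then have factor: "forget g \<star> s \<star> forget e = forget g"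
    using comp_split_epi_kernel[OF k'(2), of s "forget g"] s by simp
  have "bilinear_between (tgt e) B (forget g \<star> s)"
  proof (rule bilinear_descend_split_epi[OF _ _ _ _ _ s(2)[folded action_sel(4)]])
    show "bialgebra (left_action (src e)) (right_action (src e))"
      "bialgebra (left_action (tgt e)) (right_action (tgt e))"
      "bialgebra (left_action B) (right_action B)"
      using B by (simp_all flip: Bialg_Ob_iff)
    show "bilinear_between (src e) (tgt e) (forget e)"
      by (rule bilinear_forget) simp
    show "bilinear_between (src e) B ((forget g \<star> s) \<star> forget e)"
      using bilinear_forget[OF g] by (simp add: factor)
  qed simp_all
  then obtain h where h: "\<guillemotleft>h : tgt e \<rightarrow> B\<guillemotright>\<^bsub>Bialg\<^esub>" "forget h = forget g \<star> s"
    using lift_bilinear[of "tgt e" B] B by auto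
  then have "h \<star>\<^bsub>Bialg\<^esub> e = g"
    using factor by (intro forget_eqI) simp_all
  then show thesis using that h(1) by blast
qed

definition free :: "'o \<Rightarrow> 'o \<times> 'm \<times> 'm" where
  "free X = (R0 (L0 X), mor (free_left X), mor (free_right X))"

lemma free_actions [simp]:
  assumes "X \<in> Ob C"
  shows "left_action (free X) = free_left X" "right_action (free X) = free_right X"
  using assms bialgebraD(5-8)[OF bialgebra_free[OF assms]]
  by (simp_all add: free_def left_action_def right_action_def)

lemma fst_free [simp]: "fst (free X) = R0 (L0 X)"
  by (simp add: free_def)

lemma free_Ob [simp]: "X \<in> Ob C \<Longrightarrow> free X \<in> Ob Bialg"
  by (simp add: Bialg_Ob_iff bialgebra_free)

lemma free_E_projective:
  assumes X [simp]: "X \<in> Ob C"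
  shows "E_projective Bialg split_epi (free X)"
proof (rule Bialg.E_projectiveI)
  show "arr Bialg e" if "in_class Bialg split_epi e" for e
    using that by (simp add: in_class_split_epi_iff)
  show "free X \<in> Ob Bialg" by simp
  fix e f assume "in_class Bialg split_epi e" and f: "\<guillemotleft>f : free X \<rightarrow> tgt e\<guillemotright>\<^bsub>Bialg\<^esub>"
  then obtain s where e: "arr Bialg e"
    and s: "\<guillemotleft>s : fst (tgt e) \<rightarrow> fst (src e)\<guillemotright>" "forget e \<star> s = idt (fst (tgt e))"
    by (auto elim: in_class_split_epiE)
  note [simp] = e s(1) f
  have B: "bialgebra (left_action (src e)) (right_action (src e))"
    "bialgebra (left_action (tgt e)) (right_action (tgt e))"
    using e by (simp_all flip: Bialg_Ob_iff)
  obtain g0 where g0: "bilinear_between (free X) (src e) g0"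
    "g0 \<star> free_unit X = s \<star> forget f \<star> free_unit X"
    using free_extension[OF B(1), of "s \<star> forget f \<star> free_unit X" X] by auto
  then obtain g where g: "\<guillemotleft>g : free X \<rightarrow> src e\<guillemotright>\<^bsub>Bialg\<^esub>" "forget g = g0"
    using lift_bilinear[of "free X" "src e" g0] by auto
  have "forget e \<star> forget g = forget f"
  proof (rule bilinear_free_eqI[OF X B(2)])
    show "bilinear (free_left X) (free_right X) (left_action (tgt e)) (right_action (tgt e))
        (forget e \<star> forget g)"
      using bilinear_forget[of "e \<star>\<^bsub>Bialg\<^esub> g" "free X" "tgt e"] g(1) by simp
    show "bilinear (free_left X) (free_right X) (left_action (tgt e)) (right_action (tgt e))
        (forget f)"
      using bilinear_forget[OF f] by simp
    show "(forget e \<star> forget g) \<star> free_unit X = forget f \<star> free_unit X"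
      using bilinearD(3-5)[OF g0(1)] by (simp add: g(2) g0(2) comp_prefix[OF s(2)])
  qed
  then show "\<exists>g. \<guillemotleft>g : free X \<rightarrow> src e\<guillemotright>\<^bsub>Bialg\<^esub> \<and> e \<star>\<^bsub>Bialg\<^esub> g = f"
    using g by (intro exI[of _ g]) (auto intro: forget_eqI)
qed

lemma free_counit_split_epi:
  assumes B: "B \<in> Ob Bialg"
  obtains e where "in_class Bialg split_epi e" "src e = free (fst B)" "tgt e = B"
proof -
  have X [simp]: "fst B \<in> Ob C" using B by simp
  obtain e0 where e0: "bilinear_between (free (fst B)) B e0" "e0 \<star> free_unit (fst B) = idt (fst B)"
    using free_extension[of "left_action B" "right_action B" "idt (fst B)" "fst B"] B
    by (auto simp: Bialg_Ob_iff)
  obtain e where e: "\<guillemotleft>e : free (fst B) \<rightarrow> B\<guillemotright>\<^bsub>Bialg\<^esub>" "forget e = e0"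
    using lift_bilinear[OF _ B e0(1)] by auto
  then have "in_class Bialg split_epi e"
    unfolding in_class_split_epi_iff using e0(2) by (auto intro!: exI[of _ "free_unit (fst B)"])
  then show thesis using that e(1) by blast
qed

sublocale Bialg: relative_cat Bialg split_epi
proof unfold_locales
  fix f assume "arr Bialg f"
  then show "\<exists>k. kernel_of Bialg f k" using Bialg_kernel by blast
next
  fix e assume "in_class Bialg split_epi e"
  then show "epic Bialg e"
    using in_class_split_epi_iff[of e] by (auto simp: epic_def in_class_def split_epi_def)
next
  fix e k g assume "in_class Bialg split_epi e" "kernel_of Bialg e k" "arr Bialg g" "src g = src e"
    "g \<star>\<^bsub>Bialg\<^esub> k = \<zero>\<^bsub>Bialg\<^esub> (src k) (tgt g)"
  then show "\<exists>h. \<guillemotleft>h : tgt e \<rightarrow> tgt g\<guillemotright>\<^bsub>Bialg\<^esub> \<and> h \<star>\<^bsub>Bialg\<^esub> e = g"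
    using split_epi_cokernel[of e k g "tgt g"] by blast
next
  fix B assume "B \<in> Ob Bialg"
  then show "\<exists>e. in_class Bialg split_epi e \<and> tgt e = B \<and> E_projective Bialg split_epi (src e)"
    using free_counit_split_epi[of B] free_E_projective[of "fst B"] by (metis Bialg_Ob_fst)
qed

end


section \<open>Coherence in monoidal categories\<close>

definition tensor_arrow :: "('o, 'm, 'x) moncat_scheme \<Rightarrow> ('o, 'm) arrow \<Rightarrow> ('o, 'm) arrow \<Rightarrow>
    ('o, 'm) arrow"
    (infixr \<open>\<otimes>\<^sub>a\<index>\<close> 75) where
  "f \<otimes>\<^sub>a\<^bsub>M\<^esub> g = Arrow (src f \<otimes>\<^sub>o\<^bsub>M\<^esub> src g) (tgt f \<otimes>\<^sub>o\<^bsub>M\<^esub> tgt g) (mor f \<otimes>\<^sub>m\<^bsub>M\<^esub> mor g)"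

context monoidal_cat
begin

definition assoc :: "'o \<Rightarrow> 'o \<Rightarrow> 'o \<Rightarrow> ('o, 'm) arrow" where
  "assoc X Y Z = Arrow ((X \<otimes>\<^sub>o Y) \<otimes>\<^sub>o Z) (X \<otimes>\<^sub>o Y \<otimes>\<^sub>o Z) (asc M X Y Z)"

definition lunit :: "'o \<Rightarrow> ('o, 'm) arrow" where
  "lunit X = Arrow (unitob M \<otimes>\<^sub>o X) X (lun M X)"

definition runit :: "'o \<Rightarrow> ('o, 'm) arrow" where
  "runit X = Arrow (X \<otimes>\<^sub>o unitob M) X (run M X)"

lemma tensor_sel [simp]:
  "src (f \<otimes>\<^sub>a g) = src f \<otimes>\<^sub>o src g" "tgt (f \<otimes>\<^sub>a g) = tgt f \<otimes>\<^sub>o tgt g"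
  "mor (f \<otimes>\<^sub>a g) = mor f \<otimes>\<^sub>m mor g"
  by (simp_all add: tensor_arrow_def)

lemma structure_sel [simp]:
  "src (assoc X Y Z) = (X \<otimes>\<^sub>o Y) \<otimes>\<^sub>o Z" "tgt (assoc X Y Z) = X \<otimes>\<^sub>o Y \<otimes>\<^sub>o Z"
  "mor (assoc X Y Z) = asc M X Y Z"
  "src (lunit X) = unitob M \<otimes>\<^sub>o X" "tgt (lunit X) = X" "mor (lunit X) = lun M X"
  "src (runit X) = X \<otimes>\<^sub>o unitob M" "tgt (runit X) = X" "mor (runit X) = run M X"
  by (simp_all add: assoc_def lunit_def runit_def)

lemma tensor_Ob [simp]: "unitob M \<in> Ob M" "\<lbrakk>X \<in> Ob M; Y \<in> Ob M\<rbrakk> \<Longrightarrow> X \<otimes>\<^sub>o Y \<in> Ob M"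
  by (auto intro: unitob_in tob_in)

lemma iso_structure [simp]:
  "\<lbrakk>X \<in> Ob M; Y \<in> Ob M; Z \<in> Ob M\<rbrakk> \<Longrightarrow> iso_arrow M (assoc X Y Z)"
  "X \<in> Ob M \<Longrightarrow> iso_arrow M (lunit X)" "X \<in> Ob M \<Longrightarrow> iso_arrow M (runit X)"
  using asc_iso[of X Y Z] lun_iso[of X] run_iso[of X] unfolding iso_arrow_def arr_def
  by (simp_all add: is_iso_def is_inverse_def)

lemma arr_tensor [simp]: "\<lbrakk>arr M f; arr M g\<rbrakk> \<Longrightarrow> arr M (f \<otimes>\<^sub>a g)"
  using tmor_in[of "src f" "tgt f" "src g" "tgt g" "mor f" "mor g"]
  by (simp add: tensor_arrow_def arr_Arrow)

lemma tensor_idt [simp]: "\<lbrakk>X \<in> Ob M; Y \<in> Ob M\<rbrakk> \<Longrightarrow> idt X \<otimes>\<^sub>a idt Y = idt (X \<otimes>\<^sub>o Y)"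
  by (simp add: tensor_arrow_def id_arrow_def tmor_Id)

lemma tensor_comp:
  "\<lbrakk>arr M f; arr M f'; arr M g; arr M g'; tgt f = src f'; tgt g = src g'\<rbrakk>
    \<Longrightarrow> (f' \<star> f) \<otimes>\<^sub>a (g' \<star> g) = (f' \<otimes>\<^sub>a g') \<star> (f \<otimes>\<^sub>a g)"
  using tmor_comp[of "src f" "src f'" "tgt f'" "src g" "src g'" "tgt g'" "mor f" "mor f'" "mor g"
    "mor g'"]
  by (simp add: tensor_arrow_def comp_arrow_def)

lemma idt_tensor_comp:
  "\<lbrakk>arr M g; arr M g'; X \<in> Ob M; tgt g = src g'\<rbrakk>
      \<Longrightarrow> idt X \<otimes>\<^sub>a (g' \<star> g) = (idt X \<otimes>\<^sub>a g') \<star> (idt X \<otimes>\<^sub>a g)"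
  using tensor_comp[of "idt X" "idt X" g g'] by simp

lemma comp_tensor_idt:
  "\<lbrakk>arr M f; arr M f'; X \<in> Ob M; tgt f = src f'\<rbrakk>
      \<Longrightarrow> (f' \<star> f) \<otimes>\<^sub>a idt X = (f' \<otimes>\<^sub>a idt X) \<star> (f \<otimes>\<^sub>a idt X)"
  using tensor_comp[of f f' "idt X" "idt X"] by simp

lemma tensor_interchange:
  assumes "\<guillemotleft>f : X \<rightarrow> X'\<guillemotright>" "\<guillemotleft>g : Y \<rightarrow> Y'\<guillemotright>"
  shows "(f \<otimes>\<^sub>a idt Y') \<star> (idt X \<otimes>\<^sub>a g) = (idt X' \<otimes>\<^sub>a g) \<star> (f \<otimes>\<^sub>a idt Y)"
  using assms tensor_comp[of "idt X" f g "idt Y'"] tensor_comp[of f "idt X'" "idt Y" g] by auto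

lemma tensor_inverse_cancel [simp]:
  assumes "iso_arrow M f" "X \<in> Ob M"
  shows "(idt X \<otimes>\<^sub>a f) \<star> (idt X \<otimes>\<^sub>a f\<inverse>) = idt (X \<otimes>\<^sub>o tgt f)"
    "(idt X \<otimes>\<^sub>a f\<inverse>) \<star> (idt X \<otimes>\<^sub>a f) = idt (X \<otimes>\<^sub>o src f)"
    "(f \<otimes>\<^sub>a idt X) \<star> (f\<inverse> \<otimes>\<^sub>a idt X) = idt (tgt f \<otimes>\<^sub>o X)"
    "(f\<inverse> \<otimes>\<^sub>a idt X) \<star> (f \<otimes>\<^sub>a idt X) = idt (src f \<otimes>\<^sub>o X)"
  using assms by (simp_all flip: idt_tensor_comp comp_tensor_idt)

lemmas tensor_inverse_cancel_comp [simp] = tensor_inverse_cancel[THEN comp_prefix]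

lemma assoc_natural:
  assumes "\<guillemotleft>f : X \<rightarrow> X'\<guillemotright>" "\<guillemotleft>g : Y \<rightarrow> Y'\<guillemotright>" "\<guillemotleft>h : Z \<rightarrow> Z'\<guillemotright>"
  shows "assoc X' Y' Z' \<star> ((f \<otimes>\<^sub>a g) \<otimes>\<^sub>a h) = (f \<otimes>\<^sub>a g \<otimes>\<^sub>a h) \<star> assoc X Y Z"
  using assms asc_natural[of X X' Y Y' Z Z' "mor f" "mor g" "mor h"]
  by (intro arrow_eqI) auto

lemma assoc_inv_natural:
  assumes "\<guillemotleft>f : X \<rightarrow> X'\<guillemotright>" "\<guillemotleft>g : Y \<rightarrow> Y'\<guillemotright>" "\<guillemotleft>h : Z \<rightarrow> Z'\<guillemotright>"
  shows "(assoc X' Y' Z')\<inverse> \<star> (f \<otimes>\<^sub>a g \<otimes>\<^sub>a h) = ((f \<otimes>\<^sub>a g) \<otimes>\<^sub>a h) \<star> (assoc X Y Z)\<inverse>"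
  using assms by (intro iso_square_inverse assoc_natural) auto

text \<open>
  The simplifier collapses \<open>idt X \<otimes>\<^sub>a idt Y\<close>, so naturality with two identities needs its
  own rewrite rules.
\<close>

lemma assoc_push:
  "\<lbrakk>arr M f; arr M g; arr M h; tgt f = X; tgt g = Y; tgt h = Z\<rbrakk>
    \<Longrightarrow> assoc X Y Z \<star> ((f \<otimes>\<^sub>a g) \<otimes>\<^sub>a h) = (f \<otimes>\<^sub>a g \<otimes>\<^sub>a h) \<star> assoc (src f) (src g) (src h)"
  "\<lbrakk>arr M h; tgt h = Z; X \<in> Ob M; Y \<in> Ob M\<rbrakk>
    \<Longrightarrow> assoc X Y Z \<star> (idt (X \<otimes>\<^sub>o Y) \<otimes>\<^sub>a h) = (idt X \<otimes>\<^sub>a idt Y \<otimes>\<^sub>a h) \<star> assoc X Y (src h)"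
  "\<lbrakk>arr M f; arr M g; arr M h; tgt f = X; tgt g = Y; tgt h = Z\<rbrakk>
    \<Longrightarrow> (assoc X Y Z)\<inverse> \<star> (f \<otimes>\<^sub>a g \<otimes>\<^sub>a h) = ((f \<otimes>\<^sub>a g) \<otimes>\<^sub>a h) \<star> (assoc (src f) (src g) (src h))\<inverse>"
  "\<lbrakk>arr M f; tgt f = X; Y \<in> Ob M; Z \<in> Ob M\<rbrakk>
    \<Longrightarrow> (assoc X Y Z)\<inverse> \<star> (f \<otimes>\<^sub>a idt (Y \<otimes>\<^sub>o Z)) = ((f \<otimes>\<^sub>a idt Y) \<otimes>\<^sub>a idt Z) \<star> (assoc (src f) Y Z)\<inverse>"
  using assoc_natural[of f "src f" X g "src g" Y h "src h" Z]
    assoc_natural[of "idt X" X X "idt Y" Y Y h "src h" Z]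
    assoc_inv_natural[of f "src f" X g "src g" Y h "src h" Z]
    assoc_inv_natural[of f "src f" X "idt Y" Y Y "idt Z" Z Z]
  by auto

lemmas assoc_pushes = assoc_push assoc_push[THEN comp_prefix]

lemma lunit_natural: "\<guillemotleft>f : X \<rightarrow> Y\<guillemotright> \<Longrightarrow> lunit Y \<star> (idt (unitob M) \<otimes>\<^sub>a f) = f \<star> lunit X"
  using lun_natural[of X Y "mor f"] by (intro arrow_eqI) auto

lemma runit_natural: "\<guillemotleft>f : X \<rightarrow> Y\<guillemotright> \<Longrightarrow> runit Y \<star> (f \<otimes>\<^sub>a idt (unitob M)) = f \<star> runit X"
  using run_natural[of X Y "mor f"] by (intro arrow_eqI) auto

lemma lunit_inv_natural: "\<guillemotleft>f : X \<rightarrow> Y\<guillemotright> \<Longrightarrow> (lunit Y)\<inverse> \<star> f = (idt (unitob M) \<otimes>\<^sub>a f) \<star> (lunit X)\<inverse>"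
  by (intro iso_square_inverse lunit_natural) auto

lemma runit_inv_natural: "\<guillemotleft>f : X \<rightarrow> Y\<guillemotright> \<Longrightarrow> (runit Y)\<inverse> \<star> f = (f \<otimes>\<^sub>a idt (unitob M)) \<star> (runit X)\<inverse>"
  by (intro iso_square_inverse runit_natural) auto

lemma pentagon_arrow:
  assumes "W \<in> Ob M" "X \<in> Ob M" "Y \<in> Ob M" "Z \<in> Ob M"
  shows "assoc W X (Y \<otimes>\<^sub>o Z) \<star> assoc (W \<otimes>\<^sub>o X) Y Z =
    (idt W \<otimes>\<^sub>a assoc X Y Z) \<star> assoc W (X \<otimes>\<^sub>o Y) Z \<star> (assoc W X Y \<otimes>\<^sub>a idt Z)"
proof -
  have "assoc W X (Y \<otimes>\<^sub>o Z) \<star> assoc (W \<otimes>\<^sub>o X) Y Z =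
    ((idt W \<otimes>\<^sub>a assoc X Y Z) \<star> assoc W (X \<otimes>\<^sub>o Y) Z) \<star> (assoc W X Y \<otimes>\<^sub>a idt Z)"
    using pentagon[OF assms] by (intro arrow_eqI) simp_all
  then show ?thesis using assms by simp
qed

lemma triangle_arrow:
  assumes "X \<in> Ob M" "Y \<in> Ob M"
  shows "(idt X \<otimes>\<^sub>a lunit Y) \<star> assoc X (unitob M) Y = runit X \<otimes>\<^sub>a idt Y"
  using triangle[OF assms] by (intro arrow_eqI) simp_all

lemma pentagon_inv_arrow:
  assumes [simp]: "W \<in> Ob M" "X \<in> Ob M" "Y \<in> Ob M" "Z \<in> Ob M"
  shows "(assoc W X Y \<otimes>\<^sub>a idt Z) \<star> (assoc (W \<otimes>\<^sub>o X) Y Z)\<inverse> =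
      (assoc W (X \<otimes>\<^sub>o Y) Z)\<inverse> \<star> (idt W \<otimes>\<^sub>a (assoc X Y Z)\<inverse>) \<star> assoc W X (Y \<otimes>\<^sub>o Z)" (is ?left)
    and "assoc (W \<otimes>\<^sub>o X) Y Z \<star> ((assoc W X Y)\<inverse> \<otimes>\<^sub>a idt Z) =
      (assoc W X (Y \<otimes>\<^sub>o Z))\<inverse> \<star> (idt W \<otimes>\<^sub>a assoc X Y Z) \<star> assoc W (X \<otimes>\<^sub>o Y) Z" (is ?right)
proof -
  have "(assoc W X Y \<otimes>\<^sub>a idt Z) \<star> (assoc (W \<otimes>\<^sub>o X) Y Z)\<inverse> =
      (assoc W (X \<otimes>\<^sub>o Y) Z)\<inverse> \<star> (idt W \<otimes>\<^sub>a (assoc X Y Z)\<inverse>) \<star>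
        ((idt W \<otimes>\<^sub>a assoc X Y Z) \<star> assoc W (X \<otimes>\<^sub>o Y) Z \<star> (assoc W X Y \<otimes>\<^sub>a idt Z)) \<star>
          (assoc (W \<otimes>\<^sub>o X) Y Z)\<inverse>"
    by simp
  then show ?left by (simp flip: pentagon_arrow)
  have "assoc (W \<otimes>\<^sub>o X) Y Z \<star> ((assoc W X Y)\<inverse> \<otimes>\<^sub>a idt Z) =
      (assoc W X (Y \<otimes>\<^sub>o Z))\<inverse> \<star> (assoc W X (Y \<otimes>\<^sub>o Z) \<star> assoc (W \<otimes>\<^sub>o X) Y Z) \<star>
        ((assoc W X Y)\<inverse> \<otimes>\<^sub>a idt Z)"
    by simp
  then show ?right by (simp only: pentagon_arrow assms) simp
qed

lemma tensor_unit_right_faithful: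
  assumes "\<guillemotleft>f : X \<rightarrow> Y\<guillemotright>" "\<guillemotleft>g : X \<rightarrow> Y\<guillemotright>" and eq: "f \<otimes>\<^sub>a idt (unitob M) = g \<otimes>\<^sub>a idt (unitob M)"
  shows "f = g"
proof -
  have X: "X \<in> Ob M" using assms(1) by auto
  have "f \<star> runit X = g \<star> runit X"
    using runit_natural[OF assms(1)] runit_natural[OF assms(2)] eq by simp
  then show ?thesis
    using assms(1,2) X comp_iso_eq_iff[of "runit X" f "g \<star> runit X"] by simp
qed

lemma tensor_unit_left_faithful:
  assumes "\<guillemotleft>f : X \<rightarrow> Y\<guillemotright>" "\<guillemotleft>g : X \<rightarrow> Y\<guillemotright>" and eq: "idt (unitob M) \<otimes>\<^sub>a f = idt (unitob M) \<otimes>\<^sub>a g"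
  shows "f = g"
proof -
  have X: "X \<in> Ob M" using assms(1) by auto
  have "f \<star> lunit X = g \<star> lunit X"
    using lunit_natural[OF assms(1)] lunit_natural[OF assms(2)] eq by simp
  then show ?thesis
    using assms(1,2) X comp_iso_eq_iff[of "lunit X" f "g \<star> lunit X"] by simp
qed

text \<open>
  Kelly's argument: \<open>- \<otimes> \<one>\<close> and \<open>\<one> \<otimes> -\<close> are faithful, and after applying them the claims follow from
  the pentagon and the triangle.
\<close>

lemma runit_tensor:
  assumes [simp]: "X \<in> Ob M" "Y \<in> Ob M"
  shows "runit (X \<otimes>\<^sub>o Y) = (idt X \<otimes>\<^sub>a runit Y) \<star> assoc X Y (unitob M)"
proof -
  let ?I = "unitob M"
  have "assoc X Y ?I \<star> (runit (X \<otimes>\<^sub>o Y) \<otimes>\<^sub>a idt ?I) =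
      assoc X Y ?I \<star> (idt (X \<otimes>\<^sub>o Y) \<otimes>\<^sub>a lunit ?I) \<star> assoc (X \<otimes>\<^sub>o Y) ?I ?I"
    by (simp add: triangle_arrow)
  also have "\<dots> = (idt X \<otimes>\<^sub>a idt Y \<otimes>\<^sub>a lunit ?I) \<star> assoc X Y (?I \<otimes>\<^sub>o ?I) \<star> assoc (X \<otimes>\<^sub>o Y) ?I ?I"
    by (simp add: assoc_pushes)
  also have "\<dots> = (idt X \<otimes>\<^sub>a ((idt Y \<otimes>\<^sub>a lunit ?I) \<star> assoc Y ?I ?I)) \<star>
      assoc X (Y \<otimes>\<^sub>o ?I) ?I \<star> (assoc X Y ?I \<otimes>\<^sub>a idt ?I)"
    by (simp add: pentagon_arrow idt_tensor_comp)
  also have "\<dots> = (idt X \<otimes>\<^sub>a runit Y \<otimes>\<^sub>a idt ?I) \<star> assoc X (Y \<otimes>\<^sub>o ?I) ?I \<star> (assoc X Y ?I \<otimes>\<^sub>a idt ?I)"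
    by (simp add: triangle_arrow)
  also have "\<dots> = assoc X Y ?I \<star> (((idt X \<otimes>\<^sub>a runit Y) \<star> assoc X Y ?I) \<otimes>\<^sub>a idt ?I)"
    by (simp add: assoc_pushes comp_tensor_idt)
  finally have "runit (X \<otimes>\<^sub>o Y) \<otimes>\<^sub>a idt ?I = ((idt X \<otimes>\<^sub>a runit Y) \<star> assoc X Y ?I) \<otimes>\<^sub>a idt ?I"
    by (rule monic_cancel[OF monic_iso, rotated]) simp_all
  then show ?thesis by (rule tensor_unit_right_faithful[rotated 2]) simp_all
qed

lemma lunit_tensor:
  assumes [simp]: "X \<in> Ob M" "Y \<in> Ob M"
  shows "lunit X \<otimes>\<^sub>a idt Y = lunit (X \<otimes>\<^sub>o Y) \<star> assoc (unitob M) X Y"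
proof -
  let ?I = "unitob M"
  let ?c = "assoc ?I (?I \<otimes>\<^sub>o X) Y \<star> (assoc ?I ?I X \<otimes>\<^sub>a idt Y)"
  have iso_c: "iso_arrow M ?c"
    by (rule iso_arrowI[of _ _ _ "((assoc ?I ?I X)\<inverse> \<otimes>\<^sub>a idt Y) \<star> (assoc ?I (?I \<otimes>\<^sub>o X) Y)\<inverse>"]) auto
  have "(idt ?I \<otimes>\<^sub>a (lunit (X \<otimes>\<^sub>o Y) \<star> assoc ?I X Y)) \<star> ?c =
      (idt ?I \<otimes>\<^sub>a lunit (X \<otimes>\<^sub>o Y)) \<star> assoc ?I ?I (X \<otimes>\<^sub>o Y) \<star> assoc (?I \<otimes>\<^sub>o ?I) X Y"
    by (simp add: pentagon_arrow idt_tensor_comp)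
  also have "\<dots> = (runit ?I \<otimes>\<^sub>a idt (X \<otimes>\<^sub>o Y)) \<star> assoc (?I \<otimes>\<^sub>o ?I) X Y"
    by (simp add: comp_prefix[OF triangle_arrow])
  also have "\<dots> = assoc ?I X Y \<star> ((runit ?I \<otimes>\<^sub>a idt X) \<otimes>\<^sub>a idt Y)"
    by (simp add: assoc_pushes)
  also have "\<dots> = assoc ?I X Y \<star> ((idt ?I \<otimes>\<^sub>a lunit X) \<otimes>\<^sub>a idt Y) \<star> (assoc ?I ?I X \<otimes>\<^sub>a idt Y)"
    by (simp add: comp_tensor_idt flip: triangle_arrow)
  also have "\<dots> = (idt ?I \<otimes>\<^sub>a lunit X \<otimes>\<^sub>a idt Y) \<star> ?c"
    by (simp add: assoc_pushes)
  finally have "(idt ?I \<otimes>\<^sub>a (lunit (X \<otimes>\<^sub>o Y) \<star> assoc ?I X Y)) = idt ?I \<otimes>\<^sub>a lunit X \<otimes>\<^sub>a idt Y"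
    by (rule epic_cancel[OF epic_iso[OF iso_c]]) auto
  then show ?thesis by (rule tensor_unit_left_faithful[symmetric, rotated 2]) simp_all
qed

lemma lunit_inv_tensor:
  assumes [simp]: "X \<in> Ob M" "Y \<in> Ob M"
  shows "assoc (unitob M) X Y \<star> ((lunit X)\<inverse> \<otimes>\<^sub>a idt Y) = (lunit (X \<otimes>\<^sub>o Y))\<inverse>"
proof -
  have "assoc (unitob M) X Y \<star> ((lunit X)\<inverse> \<otimes>\<^sub>a idt Y) =
      (lunit (X \<otimes>\<^sub>o Y))\<inverse> \<star> (lunit X \<otimes>\<^sub>a idt Y) \<star> ((lunit X)\<inverse> \<otimes>\<^sub>a idt Y)"
    by (simp add: lunit_tensor)
  also have "\<dots> = (lunit (X \<otimes>\<^sub>o Y))\<inverse>" by simp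
  finally show ?thesis .
qed

lemma runit_inv_tensor:
  assumes [simp]: "X \<in> Ob M" "Y \<in> Ob M"
  shows "assoc X Y (unitob M) \<star> (runit (X \<otimes>\<^sub>o Y))\<inverse> = idt X \<otimes>\<^sub>a (runit Y)\<inverse>"
proof -
  have "assoc X Y (unitob M) \<star> (runit (X \<otimes>\<^sub>o Y))\<inverse> =
      (idt X \<otimes>\<^sub>a (runit Y)\<inverse>) \<star> ((idt X \<otimes>\<^sub>a runit Y) \<star> assoc X Y (unitob M)) \<star> (runit (X \<otimes>\<^sub>o Y))\<inverse>"
    by simp
  also have "\<dots> = idt X \<otimes>\<^sub>a (runit Y)\<inverse>" by (simp flip: runit_tensor)
  finally show ?thesis .
qed

end


section \<open>Bimodules\<close>

context algebra_in
begin

definition m_arrow :: "('o, 'm) arrow" where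
  "m_arrow = Arrow (A \<otimes>\<^sub>o A) A m"

definition u_arrow :: "('o, 'm) arrow" where
  "u_arrow = Arrow (unitob M) A u"

definition left_mult :: "'o \<Rightarrow> ('o, 'm) arrow" where
  "left_mult X = (m_arrow \<otimes>\<^sub>a idt X) \<star> (assoc A A X)\<inverse>"

definition left_unit :: "'o \<Rightarrow> ('o, 'm) arrow" where
  "left_unit X = (u_arrow \<otimes>\<^sub>a idt X) \<star> (lunit X)\<inverse>"

definition right_mult :: "'o \<Rightarrow> ('o, 'm) arrow" where
  "right_mult X = (idt X \<otimes>\<^sub>a m_arrow) \<star> assoc X A A"

definition right_unit :: "'o \<Rightarrow> ('o, 'm) arrow" where
  "right_unit X = (idt X \<otimes>\<^sub>a u_arrow) \<star> (runit X)\<inverse>"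

lemma algebra_sel [simp]:
  "A \<in> Ob M" "arr M m_arrow" "src m_arrow = A \<otimes>\<^sub>o A" "tgt m_arrow = A" "mor m_arrow = m"
  "arr M u_arrow" "src u_arrow = unitob M" "tgt u_arrow = A" "mor u_arrow = u"
  using A_in m_in u_in by (simp_all add: m_arrow_def u_arrow_def arr_Arrow)

lemma m_arrow_assoc: "m_arrow \<star> (m_arrow \<otimes>\<^sub>a idt A) = m_arrow \<star> (idt A \<otimes>\<^sub>a m_arrow) \<star> assoc A A A"
proof -
  have "m_arrow \<star> (m_arrow \<otimes>\<^sub>a idt A) = (m_arrow \<star> (idt A \<otimes>\<^sub>a m_arrow)) \<star> assoc A A A"
    using m_assoc by (intro arrow_eqI) (simp_all del: comp_arrow_assoc)
  then show ?thesis by simp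
qed

lemma m_arrow_unit:
  "m_arrow \<star> (u_arrow \<otimes>\<^sub>a idt A) = lunit A" "m_arrow \<star> (idt A \<otimes>\<^sub>a u_arrow) = runit A"
  using unit_left unit_right by (auto intro: arrow_eqI)

lemma left_monad: "monad M (\<lambda>X. A \<otimes>\<^sub>o X) (\<lambda>f. idt A \<otimes>\<^sub>a f) left_mult left_unit"
proof unfold_locales
  fix f X Y assume f: "\<guillemotleft>f : X \<rightarrow> Y\<guillemotright>"
  then have [simp]: "X \<in> Ob M" "Y \<in> Ob M" by auto
  show "left_mult Y \<star> (idt A \<otimes>\<^sub>a idt A \<otimes>\<^sub>a f) = (idt A \<otimes>\<^sub>a f) \<star> left_mult X"
    using f comp_prefix[OF tensor_interchange[of m_arrow "A \<otimes>\<^sub>o A" A f X Y]]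
    by (simp add: left_mult_def assoc_pushes)
  show "left_unit Y \<star> f = (idt A \<otimes>\<^sub>a f) \<star> left_unit X"
    using f comp_prefix[OF tensor_interchange[of u_arrow "unitob M" A f X Y]]
    by (simp add: left_unit_def lunit_inv_natural[OF f])
next
  fix X assume [simp]: "X \<in> Ob M"
  let ?I = "unitob M"
  have "left_mult X \<star> (idt A \<otimes>\<^sub>a left_mult X) =
      ((m_arrow \<star> (idt A \<otimes>\<^sub>a m_arrow) \<star> assoc A A A) \<otimes>\<^sub>a idt X) \<star>
      (assoc (A \<otimes>\<^sub>o A) A X)\<inverse> \<star> (assoc A A (A \<otimes>\<^sub>o X))\<inverse>"
    by (simp add: left_mult_def idt_tensor_comp comp_tensor_idt assoc_pushes
        comp_prefix[OF pentagon_inv_arrow(1)])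
  also have "\<dots> = left_mult X \<star> left_mult (A \<otimes>\<^sub>o X)"
    by (simp add: left_mult_def comp_tensor_idt assoc_pushes flip: m_arrow_assoc)
  finally show "left_mult X \<star> (idt A \<otimes>\<^sub>a left_mult X) = left_mult X \<star> left_mult (A \<otimes>\<^sub>o X)" .
  have "left_mult X \<star> left_unit (A \<otimes>\<^sub>o X) =
      ((m_arrow \<star> (u_arrow \<otimes>\<^sub>a idt A)) \<otimes>\<^sub>a idt X) \<star> (assoc ?I A X)\<inverse> \<star> (lunit (A \<otimes>\<^sub>o X))\<inverse>"
    by (simp add: left_mult_def left_unit_def comp_tensor_idt assoc_pushes)
  also have "\<dots> = idt (A \<otimes>\<^sub>o X)"
    by (simp add: m_arrow_unit lunit_tensor)
  finally show "left_mult X \<star> left_unit (A \<otimes>\<^sub>o X) = idt (A \<otimes>\<^sub>o X)" .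
  have "left_mult X \<star> (idt A \<otimes>\<^sub>a left_unit X) =
      ((m_arrow \<star> (idt A \<otimes>\<^sub>a u_arrow)) \<otimes>\<^sub>a idt X) \<star> (assoc A ?I X)\<inverse> \<star> (idt A \<otimes>\<^sub>a (lunit X)\<inverse>)"
    by (simp add: left_mult_def left_unit_def idt_tensor_comp comp_tensor_idt assoc_pushes)
  also have "\<dots> = idt (A \<otimes>\<^sub>o X)"
    by (simp add: m_arrow_unit flip: triangle_arrow)
  finally show "left_mult X \<star> (idt A \<otimes>\<^sub>a left_unit X) = idt (A \<otimes>\<^sub>o X)" .
qed (auto simp: left_mult_def left_unit_def idt_tensor_comp)

lemma right_monad: "monad M (\<lambda>X. X \<otimes>\<^sub>o A) (\<lambda>f. f \<otimes>\<^sub>a idt A) right_mult right_unit"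
proof unfold_locales
  fix f X Y assume f: "\<guillemotleft>f : X \<rightarrow> Y\<guillemotright>"
  then have [simp]: "X \<in> Ob M" "Y \<in> Ob M" by auto
  show "right_mult Y \<star> ((f \<otimes>\<^sub>a idt A) \<otimes>\<^sub>a idt A) = (f \<otimes>\<^sub>a idt A) \<star> right_mult X"
    using f comp_prefix[OF tensor_interchange[of f X Y m_arrow "A \<otimes>\<^sub>o A" A, symmetric]]
    by (simp add: right_mult_def assoc_pushes)
  show "right_unit Y \<star> f = (f \<otimes>\<^sub>a idt A) \<star> right_unit X"
    using f comp_prefix[OF tensor_interchange[of f X Y u_arrow "unitob M" A, symmetric]]
    by (simp add: right_unit_def runit_inv_natural[OF f])
next
  fix X assume [simp]: "X \<in> Ob M"
  let ?I = "unitob M"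
  have "right_mult X \<star> (right_mult X \<otimes>\<^sub>a idt A) =
      (idt X \<otimes>\<^sub>a (m_arrow \<star> (m_arrow \<otimes>\<^sub>a idt A))) \<star> assoc X (A \<otimes>\<^sub>o A) A \<star> (assoc X A A \<otimes>\<^sub>a idt A)"
    by (simp add: right_mult_def idt_tensor_comp comp_tensor_idt assoc_pushes)
  also have "\<dots> = right_mult X \<star> right_mult (X \<otimes>\<^sub>o A)"
    by (simp add: right_mult_def m_arrow_assoc idt_tensor_comp assoc_pushes flip: pentagon_arrow)
  finally show "right_mult X \<star> (right_mult X \<otimes>\<^sub>a idt A) = right_mult X \<star> right_mult (X \<otimes>\<^sub>o A)" .
  have "right_mult X \<star> right_unit (X \<otimes>\<^sub>o A) =
      (idt X \<otimes>\<^sub>a (m_arrow \<star> (idt A \<otimes>\<^sub>a u_arrow))) \<star> assoc X A ?I \<star> (runit (X \<otimes>\<^sub>o A))\<inverse>"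
    by (simp add: right_mult_def right_unit_def idt_tensor_comp assoc_pushes)
  also have "\<dots> = idt (X \<otimes>\<^sub>o A)"
    by (simp add: m_arrow_unit comp_prefix[OF runit_tensor[symmetric]])
  finally show "right_mult X \<star> right_unit (X \<otimes>\<^sub>o A) = idt (X \<otimes>\<^sub>o A)" .
  have "right_mult X \<star> (right_unit X \<otimes>\<^sub>a idt A) =
      (idt X \<otimes>\<^sub>a (m_arrow \<star> (u_arrow \<otimes>\<^sub>a idt A))) \<star> assoc X ?I A \<star> ((runit X)\<inverse> \<otimes>\<^sub>a idt A)"
    by (simp add: right_mult_def right_unit_def idt_tensor_comp comp_tensor_idt assoc_pushes)
  also have "\<dots> = idt (X \<otimes>\<^sub>o A)"
    by (simp add: m_arrow_unit comp_prefix[OF triangle_arrow])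
  finally show "right_mult X \<star> (right_unit X \<otimes>\<^sub>a idt A) = idt (X \<otimes>\<^sub>o A)" .
qed (auto simp: right_mult_def right_unit_def comp_tensor_idt)

sublocale distributive_law M "\<lambda>X. A \<otimes>\<^sub>o X" "\<lambda>f. idt A \<otimes>\<^sub>a f" left_mult left_unit
  "\<lambda>X. X \<otimes>\<^sub>o A" "\<lambda>f. f \<otimes>\<^sub>a idt A" right_mult right_unit "\<lambda>X. assoc A X A"
proof (intro distributive_law.intro distributive_law_axioms.intro cat_axioms left_monad right_monad)
  fix f X Y assume f: "\<guillemotleft>f : X \<rightarrow> Y\<guillemotright>"
  then show "assoc A Y A \<star> ((idt A \<otimes>\<^sub>a f) \<otimes>\<^sub>a idt A) = (idt A \<otimes>\<^sub>a f \<otimes>\<^sub>a idt A) \<star> assoc A X A"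
    by (intro assoc_natural) auto
next
  fix X assume [simp]: "X \<in> Ob M"
  let ?I = "unitob M"
  show "assoc A X A \<star> (left_mult X \<otimes>\<^sub>a idt A) =
      left_mult (X \<otimes>\<^sub>o A) \<star> (idt A \<otimes>\<^sub>a assoc A X A) \<star> assoc A (A \<otimes>\<^sub>o X) A"
    by (simp add: left_mult_def comp_tensor_idt assoc_pushes pentagon_inv_arrow(2))
  show "assoc A X A \<star> (left_unit X \<otimes>\<^sub>a idt A) = left_unit (X \<otimes>\<^sub>o A)"
    by (simp add: left_unit_def comp_tensor_idt assoc_pushes lunit_inv_tensor)
  show "assoc A X A \<star> right_mult (A \<otimes>\<^sub>o X) =
      (idt A \<otimes>\<^sub>a right_mult X) \<star> assoc A (X \<otimes>\<^sub>o A) A \<star> (assoc A X A \<otimes>\<^sub>a idt A)"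
    by (simp add: right_mult_def idt_tensor_comp assoc_pushes pentagon_arrow)
  show "assoc A X A \<star> right_unit (A \<otimes>\<^sub>o X) = idt A \<otimes>\<^sub>a right_unit X"
    by (simp add: right_unit_def assoc_pushes runit_inv_tensor idt_tensor_comp)
qed simp_all

lemma is_left_module_iff:
  "is_left_module M A m u X l \<longleftrightarrow> L.algebra (Arrow (A \<otimes>\<^sub>o X) X l)"
proof -
  let ?l = "Arrow (A \<otimes>\<^sub>o X) X l"
  have "is_left_module M A m u X l \<longleftrightarrow> arr M ?l \<and>
      ?l \<star> (m_arrow \<otimes>\<^sub>a idt X) = (?l \<star> (idt A \<otimes>\<^sub>a ?l)) \<star> assoc A A X \<and>
      ?l \<star> (u_arrow \<otimes>\<^sub>a idt X) = lunit X"
    by (auto simp: is_left_module_def arr_Arrow comp_arrow_def tensor_arrow_def lunit_def)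
  also have "\<dots> \<longleftrightarrow> L.algebra ?l"
  proof (cases "arr M ?l")
    case True
    then have [simp]: "X \<in> Ob M" by (simp add: arr_Arrow)
    show ?thesis
      using True comp_iso_eq_iff[of "assoc A A X" "?l \<star> (idt A \<otimes>\<^sub>a ?l)" "?l \<star> (m_arrow \<otimes>\<^sub>a idt X)"]
        comp_iso_eq_iff[of "lunit X" "idt X" "?l \<star> (u_arrow \<otimes>\<^sub>a idt X)"]
      by (auto simp: L.algebra_def left_mult_def left_unit_def)
  qed (auto simp: L.algebra_def)
  finally show ?thesis .
qed

lemma is_right_module_iff:
  "is_right_module M A m u X r \<longleftrightarrow> R.algebra (Arrow (X \<otimes>\<^sub>o A) X r)"
proof -
  let ?r = "Arrow (X \<otimes>\<^sub>o A) X r"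
  have "is_right_module M A m u X r \<longleftrightarrow> arr M ?r \<and>
      ?r \<star> (?r \<otimes>\<^sub>a idt A) = (?r \<star> (idt X \<otimes>\<^sub>a m_arrow)) \<star> assoc X A A \<and>
      ?r \<star> (idt X \<otimes>\<^sub>a u_arrow) = runit X"
    by (auto simp: is_right_module_def arr_Arrow comp_arrow_def tensor_arrow_def runit_def)
  also have "\<dots> \<longleftrightarrow> R.algebra ?r"
  proof (cases "arr M ?r")
    case True
    then have [simp]: "X \<in> Ob M" by (simp add: arr_Arrow)
    show ?thesis
      using True comp_iso_eq_iff[of "runit X" "idt X" "?r \<star> (idt X \<otimes>\<^sub>a u_arrow)"]
      by (auto simp: R.algebra_def right_mult_def right_unit_def)
  qed (auto simp: R.algebra_def)
  finally show ?thesis .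
qed

lemma is_bimodule_iff: "is_bimodule M A m u B \<longleftrightarrow> bialgebra (left_action B) (right_action B)"
proof -
  obtain X l r where B: "B = (X, l, r)" by (metis prod_cases3)
  let ?l = "Arrow (A \<otimes>\<^sub>o X) X l" and ?r = "Arrow (X \<otimes>\<^sub>o A) X r"
  have "bialgebra ?l ?r \<longleftrightarrow> L.algebra ?l \<and> R.algebra ?r \<and>
      ?r \<star> (?l \<otimes>\<^sub>a idt A) = (?l \<star> (idt A \<otimes>\<^sub>a ?r)) \<star> assoc A X A"
    using L.algebraD(1)[of ?l] R.algebraD(1)[of ?r] by (auto simp: bialgebra_def arr_Arrow)
  then show ?thesis
    by (auto simp: B is_bimodule_def left_action_def right_action_def is_left_module_iff
        is_right_module_iff comp_arrow_def tensor_arrow_def)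
qed

lemma Bimod_eq_Bialg: "Bimod M A m u = Bialg"
proof -
  have "bimod_hom M A B B' = {f \<in> Hom M (fst B) (fst B').
      Arrow (fst B) (fst B') f \<star> left_action B = left_action B' \<star>
        (idt A \<otimes>\<^sub>a Arrow (fst B) (fst B') f) \<and>
      Arrow (fst B) (fst B') f \<star> right_action B = right_action B' \<star>
        (Arrow (fst B) (fst B') f \<otimes>\<^sub>a idt A)}" for B B'
    by (cases B; cases B')
      (auto simp: bimod_hom_def left_action_def right_action_def comp_arrow_def tensor_arrow_def)
  then show ?thesis
    by (simp add: Bimod_def Bialg_def is_bimodule_iff fun_eq_iff)
qed

lemma regular_actions [simp]:
  "left_action (regular_bimod A m) = m_arrow" "right_action (regular_bimod A m) = m_arrow"
  by (simp_all add: regular_bimod_def left_action_def right_action_def m_arrow_def)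

lemma tensor_square_actions [simp]:
  "left_action (tensor_square_bimod M A m) = induced_left m_arrow"
  "right_action (tensor_square_bimod M A m) = right_mult A"
  by (rule arrow_eqI; simp add: tensor_square_bimod_def left_action_def right_action_def
      induced_left_def right_mult_def inv_arrow_def)+

lemma fst_bimod [simp]:
  "fst (regular_bimod A m) = A" "fst (tensor_square_bimod M A m) = A \<otimes>\<^sub>o A"
  by (simp_all add: regular_bimod_def tensor_square_bimod_def)

lemma algebra_m_arrow: "L.algebra m_arrow" "R.algebra m_arrow"
  using is_left_module_iff[of A m] is_right_module_iff[of A m]
  by (simp_all add: m_arrow_def is_left_module_def is_right_module_def A_in m_in m_assoc
      unit_left unit_right)

lemma regular_bimod_Ob: "regular_bimod A m \<in> Ob Bialg"
  using algebra_m_arrow by (simp add: Bialg_Ob_iff bialgebra_def m_arrow_assoc)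

lemma tensor_square_bimod_Ob: "tensor_square_bimod M A m \<in> Ob Bialg"
  using bialgebra_induced[OF algebra_m_arrow(1)] by (simp add: Bialg_Ob_iff)

lemma bilinear_m_arrow: "bilinear_between (tensor_square_bimod M A m) (regular_bimod A m) m_arrow"
  using bilinear_induced_extension[OF algebra_m_arrow(1) _ L.linear_idt[OF algebra_m_arrow(1)],
      of m_arrow] regular_bimod_Ob
  by (simp add: Bialg_Ob_iff)

end

lemma (in abelian_cat) kernel_of_exists:
  assumes f: "arr C f"
  shows "\<exists>k. kernel_of C f k"
proof -
  obtain K k where "is_kernel C (src f) (tgt f) (mor f) K k"
    using ex_kernel[of "src f" "tgt f" "mor f"] f by auto
  then have "kernel_of C f (Arrow K (src f) k)" using f by (simp add: kernel_of_def)
  then show ?thesis ..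
qed

lemma (in abelian_monoidal_cat) group_hom_tensor:
  assumes "X \<in> Ob M" "Y \<in> Ob M" "Z \<in> Ob M"
  shows "group_hom (hom_group M Y Z) (hom_group M (X \<otimes>\<^sub>o Y) (X \<otimes>\<^sub>o Z)) (\<lambda>f. Id M X \<otimes>\<^sub>m f)"
    and "group_hom (hom_group M Y Z) (hom_group M (Y \<otimes>\<^sub>o X) (Z \<otimes>\<^sub>o X)) (\<lambda>f. f \<otimes>\<^sub>m Id M X)"
  using assms tmor_in[of X X Y Z "Id M X"] tmor_in[of Y Z X X _ "Id M X"] tmor_madd_right[of X Y Z]
    tmor_madd_left[of X Y Z]
  by (auto simp: group_hom_def group_hom_axioms_def hom_def group_hom_group Id_in)

locale abelian_algebra = abelian_monoidal_cat M + algebra_in M A m u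
  for M :: "('o, 'm, 'x) moncat_scheme" (structure) and A m u
begin

sublocale additive_distributive_law M "\<lambda>X. A \<otimes>\<^sub>o X" "\<lambda>f. idt A \<otimes>\<^sub>a f" left_mult left_unit
  "\<lambda>X. X \<otimes>\<^sub>o A" "\<lambda>f. f \<otimes>\<^sub>a idt A" right_mult right_unit "\<lambda>X. assoc A X A"
proof (intro additive_distributive_law.intro additive_distributive_law_axioms.intro
    additive_monad.intro additive_monad_axioms.intro preadditive_cat_axioms left_monad right_monad
    distributive_law_axioms kernel_of_exists)
  fix X Y assume "X \<in> Ob M" "Y \<in> Ob M"
  then show "group_hom (hom_group M X Y) (hom_group M (A \<otimes>\<^sub>o X) (A \<otimes>\<^sub>o Y))
      (\<lambda>f. mor (idt A \<otimes>\<^sub>a Arrow X Y f))"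
    "group_hom (hom_group M X Y) (hom_group M (X \<otimes>\<^sub>o A) (Y \<otimes>\<^sub>o A))
      (\<lambda>f. mor (Arrow X Y f \<otimes>\<^sub>a idt A))"
    using group_hom_tensor[OF A_in] by simp_all
qed

lemma split_epi_class_eq: "split_epi_class M A m u = split_epi"
  by (simp add: fun_eq_iff split_epi_class_def split_epi_def Bimod_eq_Bialg)

lemma regular_mult:
  obtains \<mu> where "\<guillemotleft>\<mu> : tensor_square_bimod M A m \<rightarrow> regular_bimod A m\<guillemotright>\<^bsub>Bialg\<^esub>" "forget \<mu> = m_arrow"
  by (rule lift_bilinear[OF tensor_square_bimod_Ob regular_bimod_Ob bilinear_m_arrow])

lemma separable_iff_section:
  assumes \<mu>: "\<guillemotleft>\<mu> : tensor_square_bimod M A m \<rightarrow> regular_bimod A m\<guillemotright>\<^bsub>Bialg\<^esub>" "forget \<mu> = m_arrow"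
  shows "separable M A m u \<longleftrightarrow>
    (\<exists>s. \<guillemotleft>s : regular_bimod A m \<rightarrow> tensor_square_bimod M A m\<guillemotright>\<^bsub>Bialg\<^esub> \<and>
      \<mu> \<star>\<^bsub>Bialg\<^esub> s = idt\<^bsub>Bialg\<^esub> (regular_bimod A m))"
proof -
  have "mor \<mu> = m" using \<mu>(2) by (metis algebra_sel(5) forget_sel(3))
  then show ?thesis
    using Bialg.has_section_iff[OF \<mu>(1)] by (simp add: separable_def Bimod_eq_Bialg)
qed

lemma tensor_square_E_projective: "E_projective Bialg split_epi (tensor_square_bimod M A m)"
proof -
  let ?I = "unitob M" and ?T = "tensor_square_bimod M A m"
  have lin: "L.linear (left_mult ?I) m_arrow (runit A)"
    using L.linear_extension[OF algebra_m_arrow(1), of u_arrow ?I] by (simp add: m_arrow_unit)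
  have lin_inv: "L.linear m_arrow (left_mult ?I) ((runit A)\<inverse>)"
    by (rule L.linear_descend_split_epi[OF L.algebra_free algebra_m_arrow(1) L.algebra_free lin,
          where s = "(runit A)\<inverse>"])
      (use L.linear_idt[OF L.algebra_free[of ?I]] in simp_all)
  have "bilinear_between (free ?I) ?T (runit A \<otimes>\<^sub>a idt A)"
    using bilinear_induced_map[OF L.algebra_free algebra_m_arrow(1) lin]
    by (simp add: free_left_def free_right_def)
  then obtain a where a: "\<guillemotleft>a : free ?I \<rightarrow> ?T\<guillemotright>\<^bsub>Bialg\<^esub>" "forget a = runit A \<otimes>\<^sub>a idt A"
    by (rule lift_bilinear[OF free_Ob[OF tensor_Ob(1)] tensor_square_bimod_Ob])
  have "bilinear_between ?T (free ?I) ((runit A)\<inverse> \<otimes>\<^sub>a idt A)"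
    using bilinear_induced_map[OF algebra_m_arrow(1) L.algebra_free lin_inv]
    by (simp add: free_left_def free_right_def)
  then obtain s where s: "\<guillemotleft>s : ?T \<rightarrow> free ?I\<guillemotright>\<^bsub>Bialg\<^esub>" "forget s = (runit A)\<inverse> \<otimes>\<^sub>a idt A"
    by (rule lift_bilinear[OF tensor_square_bimod_Ob free_Ob[OF tensor_Ob(1)]])
  have "a \<star>\<^bsub>Bialg\<^esub> s = idt\<^bsub>Bialg\<^esub> ?T"
    using a s by (intro forget_eqI) simp_all
  then show ?thesis
    using Bialg.E_projective_retract[OF free_E_projective a(1) s(1)] by simp
qed

theorem separable_iff_E_projective:
  "separable M A m u \<longleftrightarrow> E_projective Bialg split_epi (regular_bimod A m)"
proof -
  let ?A = "regular_bimod A m" and ?T = "tensor_square_bimod M A m"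
  obtain \<mu> where \<mu>: "\<guillemotleft>\<mu> : ?T \<rightarrow> ?A\<guillemotright>\<^bsub>Bialg\<^esub>" "forget \<mu> = m_arrow" by (rule regular_mult)
  show ?thesis unfolding separable_iff_section[OF \<mu>]
  proof
    assume "\<exists>s. \<guillemotleft>s : ?A \<rightarrow> ?T\<guillemotright>\<^bsub>Bialg\<^esub> \<and> \<mu> \<star>\<^bsub>Bialg\<^esub> s = idt\<^bsub>Bialg\<^esub> ?A"
    then show "E_projective Bialg split_epi ?A"
      using Bialg.E_projective_retract[OF tensor_square_E_projective \<mu>(1)] by blast
  next
    assume proj: "E_projective Bialg split_epi ?A"
    have "m_arrow \<star> right_unit A = idt A" using R.algebraD(4)[OF algebra_m_arrow(2)] by simp
    then have "in_class Bialg split_epi \<mu>"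
      unfolding in_class_split_epi_iff using \<mu> by (intro conjI exI[of _ "right_unit A"]) auto
    moreover have "\<guillemotleft>idt\<^bsub>Bialg\<^esub> ?A : ?A \<rightarrow> tgt \<mu>\<guillemotright>\<^bsub>Bialg\<^esub>"
      using \<mu>(1) regular_bimod_Ob by simp
    ultimately show "\<exists>s. \<guillemotleft>s : ?A \<rightarrow> ?T\<guillemotright>\<^bsub>Bialg\<^esub> \<and> \<mu> \<star>\<^bsub>Bialg\<^esub> s = idt\<^bsub>Bialg\<^esub> ?A"
      using Bialg.E_projective_lift[OF proj] \<mu>(1) by metis
  qed
qed

end

theorem theorem2p4:
  fixes M :: "('o, 'm) moncat" and A :: 'o and m u :: 'm
  assumes "abelian_monoidal_cat M" and "algebra_in M A m u"
  shows "(separable M A m u \<longleftrightarrow>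
            (\<forall>B\<in>Ob (Bimod M A m u). trivial_group (Hochschild M A m u 1 B))) \<and>
         (separable M A m u \<longleftrightarrow>
            (\<forall>B\<in>Ob (Bimod M A m u). \<forall>n>0. trivial_group (Hochschild M A m u n B)))"
proof -
  interpret abelian_algebra M A m u
    using assms by (rule abelian_algebra.intro)
  show ?thesis
    unfolding separable_iff_E_projective Hochschild_def Bimod_eq_Bialg split_epi_class_eq
    using Bialg.E_projective_iff_Ext_trivial[OF regular_bimod_Ob] by blast
qed

end
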